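(* The flag truncated shifted iYangian $FY$ and the truncated shifted iYangian $Y$ are Morita equivalent.
   Context: **Quiver.** $Q=(Q_0,Q_1,s,t)$ is a loop-free quiver with at most one arrow (both directions counted) between two distinct vertices; $\tau$ is an involution of $Q_0$ and $Q_1$ with $s(\tau h)=\tau(t(h))$, $t(\tau h)=\tau(s(h))$, with $\tau(s(h))=t(h)$ iff $\tau(h)=h$, and without fixed vertices. $i\to j$ means there is an arrow from $i$ to $j$; $\delta_{i\to\tau i}\in\{0,1\}$ accordingly; $c_{i,\tau i}=-1$ if $i,\tau i$ are joined by an arrow, else $0$. Fix a partition $Q_0=Q_0^{(+)}\sqcup Q_0^{(-)}$ with $\tau(Q_0^{(\pm)})=Q_0^{(\mp)}$ and all arrows going from $Q_0^{(+)}$ to $Q_0^{(-)}$. **Data.** $\lambda=\sum\lambda_i\varpi_i$ dominant, $\mu$ a $\tau$-invariant weight with $\lambda+\tau\lambda-\mu=\sum v_i\alpha_i$, $v_i=v_{\tau i}\ge0$; $\mathbf R=(\mathbf R_i)_{i\in Q_0}$ with $\mathbf R_i$ a multiset of $\lambda_i$ complex numbers; $p_i(u)=\prod_{c\in\mathbf R_i}(u-c\hbar)$. **Truncated shifted iYangian $Y$.** $P=\mathbb C(\hbar)[x_{i,k}:i\in Q_0^{(+)},1\le k\le v_i]$, $\Sigma=\prod_{i\in Q_0^{(+)}}S_{v_i}$ permutes the variables. $d_{i,k}$ is the automorphism $x_{i,k}\mapsto x_{i,k}+\hbar$ fixing the other variables; $x_{\tau i,k}=-x_{i,k}$, $d_{\tau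 i,k}=d_{i,k}^{-1}$ for $i\in Q_0^{(+)}$. $V_i(z)=\prod_k(z-x_{i,k})$, $V_{i,r}(z)=V_i(z)/(z-x_{i,r})$. For $i\in Q_0$ consider the series in $z^{-1}$ of operators preserving $P^\Sigma$ $$b_i(z)=\sum_{r=1}^{v_i}\frac{1}{-z-x_{i,r}-\frac\hbar2}\prod_{i\to\tau i}V_{\tau i,r}(x_{i,r}+\tfrac\hbar2)\prod_{j\ne\tau i,\,i\to j}V_j(x_{i,r}+\tfrac\hbar2)\frac{p_{\tau i}(x_{\tau i,r})}{V_{i,r}(x_{i,r})}d_{i,r},$$ $$h_i(z)=(-1)^{v_i-1+\delta_{i\to\tau i}}(2z)^{c_{i,\tau i}}\frac{p_i(-z)p_{\tau i}(z)}{V_i(-z+\frac\hbar2)V_i(-z-\frac\hbar2)}\prod_{i\to j}V_j(-z)\prod_{\tau i\to j}V_j(z)$$ (first product in $b_i$: present only if $i\to\tau i$). $Y\subset\operatorname{End}(P^\Sigma)$ is the $\mathbb C(\hbar)$-subalgebra generated by all coefficients of all $b_i(z),h_i(z)$ (the image of the shifted iYangian under the iGKLO homomorphism). **Flag version.** $\partial_{i,k}=\frac{s_{i,k}-1}{x_{i,k+1}-x_{i,k}}$ ($s_{i,k}$ swaps $x_{i,k},x_{i,k+1}$); $e_\Sigma=\prod_{i\in Q_0^{(+)}}\frac1{v_i!}\partial_{i,w_0}\prod_{k<l}(x_{i,k}-x_{i,l})$ is the projection of $P$ onto $P^\Sigma$ ($\partial_{i,w_0}$: product of the $\partial_{i,k}$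 along a reduced word of the longest element of $S_{v_i}$). $FY$ is the subalgebra of $\operatorname{End}(P)$ generated by the divided difference operators $\partial_{i,k}$, multiplications by elements of $P$, and the image of $Y$, where $X\in Y$ is regarded as $X\circ e_\Sigma\in\operatorname{End}(P)$. *)

theory Defs
  imports
    "HOL-Algebra.Module"
    "HOL-Combinatorics.Permutations"
    "HOL-Computational_Algebra.Polynomial_Factorial"
    "HOL-Computational_Algebra.Formal_Laurent_Series"
    "HOL-Library.Poly_Mapping"
    "HOL-Library.Product_Lexorder"
    "HOL-Library.Multiset"
    "Graph_Theory.Digraph"
begin

section \<open>Morita equivalence of algebras over a field\<close>

text \<open>
  Associative unital, not necessarily commutative, algebras over the field given by the type
  \<open>'k\<close>.  As in HOL-Algebra, the record type of modules carries the scalar multiplication.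
\<close>

locale assoc_algebra = ring A for A :: "('k::field, 'a) module" (structure) +
  assumes smult_closed: "x \<in> carrier A \<Longrightarrow> c \<odot> x \<in> carrier A"
    and smult_add_scalar: "x \<in> carrier A \<Longrightarrow> (c + d) \<odot> x = c \<odot> x \<oplus> d \<odot> x"
    and smult_add: "x \<in> carrier A \<Longrightarrow> y \<in> carrier A \<Longrightarrow> c \<odot> (x \<oplus> y) = c \<odot> x \<oplus> c \<odot> y"
    and smult_smult: "x \<in> carrier A \<Longrightarrow> (c * d) \<odot> x = c \<odot> (d \<odot> x)"
    and smult_one: "x \<in> carrier A \<Longrightarrow> 1 \<odot> x = x"
    and smult_mult_left: "x \<in> carrier A \<Longrightarrow> y \<in> carrier A \<Longrightarrow> (c \<odot> x) \<otimes> y = c \<odot> (x \<otimes> y)"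
    and smult_mult_right: "x \<in> carrier A \<Longrightarrow> y \<in> carrier A \<Longrightarrow> x \<otimes> (c \<odot> y) = c \<odot> (x \<otimes> y)"

text \<open>
  The axioms of the HOL-Algebra locale for modules, over a ring that need not be commutative.
  As there, the fields \<open>mult\<close> and \<open>one\<close> of \<open>M\<close> play no role.
\<close>

locale left_module = A: ring A + M: abelian_group M
  for A :: "('k, 'a) module" and M :: "('a, 'u) module" +
  assumes act_closed: "a \<in> carrier A \<Longrightarrow> x \<in> carrier M \<Longrightarrow> a \<odot>\<^bsub>M\<^esub> x \<in> carrier M"
    and act_add_left: "a \<in> carrier A \<Longrightarrow> b \<in> carrier A \<Longrightarrow> x \<in> carrier M \<Longrightarrow>
      (a \<oplus>\<^bsub>A\<^esub> b) \<odot>\<^bsub>M\<^esub> x = a \<odot>\<^bsub>M\<^esub> x \<oplus>\<^bsub>M\<^esub> b \<odot>\<^bsub>M\<^esub> x"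
    and act_add_right: "a \<in> carrier A \<Longrightarrow> x \<in> carrier M \<Longrightarrow> y \<in> carrier M \<Longrightarrow>
      a \<odot>\<^bsub>M\<^esub> (x \<oplus>\<^bsub>M\<^esub> y) = a \<odot>\<^bsub>M\<^esub> x \<oplus>\<^bsub>M\<^esub> a \<odot>\<^bsub>M\<^esub> y"
    and act_mult: "a \<in> carrier A \<Longrightarrow> b \<in> carrier A \<Longrightarrow> x \<in> carrier M \<Longrightarrow>
      (a \<otimes>\<^bsub>A\<^esub> b) \<odot>\<^bsub>M\<^esub> x = a \<odot>\<^bsub>M\<^esub> (b \<odot>\<^bsub>M\<^esub> x)"
    and act_one: "x \<in> carrier M \<Longrightarrow> \<one>\<^bsub>A\<^esub> \<odot>\<^bsub>M\<^esub> x = x"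

definition module_hom ::
  "('k, 'a) module \<Rightarrow> ('a, 'u) module \<Rightarrow> ('a, 'u) module \<Rightarrow> ('u \<Rightarrow> 'u) set" where
  "module_hom A M N = {f \<in> carrier M \<rightarrow>\<^sub>E carrier N.
     (\<forall>x\<in>carrier M. \<forall>y\<in>carrier M. f (x \<oplus>\<^bsub>M\<^esub> y) = f x \<oplus>\<^bsub>N\<^esub> f y) \<and>
     (\<forall>a\<in>carrier A. \<forall>x\<in>carrier M. f (a \<odot>\<^bsub>M\<^esub> x) = a \<odot>\<^bsub>N\<^esub> f x)}"

text \<open>
  A functor between categories of left modules is given by its action \<open>Fo\<close> on objects and its
  action \<open>Fm M N\<close> on morphisms from \<open>M\<close> to \<open>N\<close>.  Linearity is over the ground field \<open>'k\<close>,
  whose element \<open>c\<close> acts on an \<open>A\<close>-module as the algebra element \<open>c \<odot> \<one>\<close>.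
\<close>

type_synonym ('a, 'b, 'u) obj_map = "('a, 'u) module \<Rightarrow> ('b, 'u) module"
type_synonym ('a, 'u) mor_map =
  "('a, 'u) module \<Rightarrow> ('a, 'u) module \<Rightarrow> ('u \<Rightarrow> 'u) \<Rightarrow> ('u \<Rightarrow> 'u)"

definition linear_functor ::
  "('k::field, 'a) module \<Rightarrow> ('k, 'b) module \<Rightarrow>
   ('a, 'b, 'u) obj_map \<Rightarrow> ('a, 'u) mor_map \<Rightarrow> bool" where
  "linear_functor A B Fo Fm \<longleftrightarrow>
     (\<forall>M. left_module A M \<longrightarrow> left_module B (Fo M)) \<and>
     (\<forall>M N. left_module A M \<longrightarrow> left_module A N \<longrightarrow>
        Fm M N \<in> module_hom A M N \<rightarrow> module_hom B (Fo M) (Fo N)) \<and>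
     (\<forall>M. left_module A M \<longrightarrow> Fm M M (\<lambda>x\<in>carrier M. x) = (\<lambda>x\<in>carrier (Fo M). x)) \<and>
     (\<forall>L M N. left_module A L \<longrightarrow> left_module A M \<longrightarrow> left_module A N \<longrightarrow>
        (\<forall>f\<in>module_hom A L M. \<forall>g\<in>module_hom A M N.
           Fm L N (compose (carrier L) g f) = compose (carrier (Fo L)) (Fm M N g) (Fm L M f))) \<and>
     (\<forall>M N. left_module A M \<longrightarrow> left_module A N \<longrightarrow>
        (\<forall>f\<in>module_hom A M N. \<forall>g\<in>module_hom A M N.
           Fm M N (\<lambda>x\<in>carrier M. f x \<oplus>\<^bsub>N\<^esub> g x) =
             (\<lambda>x\<in>carrier (Fo M). Fm M N f x \<oplus>\<^bsub>Fo N\<^esub> Fm M N g x)) \<and>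
        (\<forall>f\<in>module_hom A M N. \<forall>c.
           Fm M N (\<lambda>x\<in>carrier M. (c \<odot>\<^bsub>A\<^esub> \<one>\<^bsub>A\<^esub>) \<odot>\<^bsub>N\<^esub> f x) =
             (\<lambda>x\<in>carrier (Fo M). (c \<odot>\<^bsub>B\<^esub> \<one>\<^bsub>B\<^esub>) \<odot>\<^bsub>Fo N\<^esub> Fm M N f x)))"

definition natural_iso ::
  "('k, 'a) module \<Rightarrow> ('k, 'b) module \<Rightarrow>
   ('a, 'b, 'u) obj_map \<Rightarrow> ('a, 'u) mor_map \<Rightarrow> ('a, 'b, 'u) obj_map \<Rightarrow> ('a, 'u) mor_map \<Rightarrow>
   (('a, 'u) module \<Rightarrow> 'u \<Rightarrow> 'u) \<Rightarrow> bool" where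
  "natural_iso A B Fo Fm Go Gm \<eta> \<longleftrightarrow>
     (\<forall>M. left_module A M \<longrightarrow>
        \<eta> M \<in> module_hom B (Fo M) (Go M) \<and> bij_betw (\<eta> M) (carrier (Fo M)) (carrier (Go M))) \<and>
     (\<forall>M N. left_module A M \<longrightarrow> left_module A N \<longrightarrow>
        (\<forall>f\<in>module_hom A M N.
           compose (carrier (Fo M)) (\<eta> N) (Fm M N f) =
           compose (carrier (Fo M)) (Gm M N f) (\<eta> M)))"

text \<open>
  Morita equivalence: the categories of left modules are equivalent as \<open>'k\<close>-linear categories.
  HOL has no type of all modules, so the universe of underlying sets consists of the subsets of
  a type \<open>'u\<close>, which is a parameter; a theorem about \<open>TYPE('u)\<close> with a type variable \<open>'u\<close>
  asserts the equivalence for every choice of universe, in particular for arbitrarily large ones.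
\<close>

definition morita_equivalent ::
  "'u itself \<Rightarrow> ('k::field, 'a) module \<Rightarrow> ('k, 'b) module \<Rightarrow> bool" where
  "morita_equivalent U A B \<longleftrightarrow> assoc_algebra A \<and> assoc_algebra B \<and>
     (\<exists>(Fo :: ('a, 'b, 'u) obj_map) Fm (Go :: ('b, 'a, 'u) obj_map) Gm \<eta> \<epsilon>.
        linear_functor A B Fo Fm \<and> linear_functor B A Go Gm \<and>
        natural_iso A A (\<lambda>M. M) (\<lambda>M N f. f)
          (\<lambda>M. Go (Fo M)) (\<lambda>M N f. Gm (Fo M) (Fo N) (Fm M N f)) \<eta> \<and>
        natural_iso B B (\<lambda>M. Fo (Go M)) (\<lambda>M N f. Fm (Go M) (Go N) (Gm M N f))
          (\<lambda>M. M) (\<lambda>M N f. f) \<epsilon>)"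

inductive_set generated_subalgebra ::
  "('k::field, 'a) module \<Rightarrow> 'a set \<Rightarrow> 'a set" for A S where
  one: "\<one>\<^bsub>A\<^esub> \<in> generated_subalgebra A S"
| incl: "x \<in> S \<Longrightarrow> x \<in> generated_subalgebra A S"
| smult: "x \<in> generated_subalgebra A S \<Longrightarrow> c \<odot>\<^bsub>A\<^esub> x \<in> generated_subalgebra A S"
| add: "x \<in> generated_subalgebra A S \<Longrightarrow> y \<in> generated_subalgebra A S \<Longrightarrow>
    x \<oplus>\<^bsub>A\<^esub> y \<in> generated_subalgebra A S"
| mult: "x \<in> generated_subalgebra A S \<Longrightarrow> y \<in> generated_subalgebra A S \<Longrightarrow>
    x \<otimes>\<^bsub>A\<^esub> y \<in> generated_subalgebra A S"


section \<open>Polynomials over the field of rational functions in hbar\<close>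

text \<open>
  \<open>'q xpoly\<close> is the ring of polynomials in variables indexed by pairs \<open>(i, k)\<close>; the linear
  order on \<open>'q\<close> is what the library needs to know that it is an integral domain.
\<close>

type_synonym hfield = "complex poly fract"
type_synonym 'q xpoly = "(('q \<times> nat) \<Rightarrow>\<^sub>0 nat) \<Rightarrow>\<^sub>0 hfield"

definition hbar :: hfield where
  "hbar = to_fract [:0, 1:]"

definition Const :: "hfield \<Rightarrow> 'q::linorder xpoly" where
  "Const c = Poly_Mapping.single 0 c"

definition Var :: "'q \<times> nat \<Rightarrow> 'q::linorder xpoly" where
  "Var y = Poly_Mapping.single (Poly_Mapping.single y 1) 1"

definition poly_subst :: "('q \<times> nat \<Rightarrow> 'q xpoly) \<Rightarrow> 'q::linorder xpoly \<Rightarrow> 'q xpoly" where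
  "poly_subst \<sigma> f = (\<Sum>m\<in>Poly_Mapping.keys f.
     Const (Poly_Mapping.lookup f m) *
     (\<Prod>y\<in>Poly_Mapping.keys m. \<sigma> y ^ Poly_Mapping.lookup m y))"

text \<open>
  The inverse of the embedding of polynomials into their fraction field, used to turn operators
  given by rational formulas that happen to preserve polynomials into operators on polynomials.
\<close>

definition poly_of_fract :: "'q::linorder xpoly fract \<Rightarrow> 'q xpoly" where
  "poly_of_fract r = (THE f. to_fract f = r)"

definition End_algebra ::
  "'q::linorder xpoly set \<Rightarrow> (hfield, 'q xpoly \<Rightarrow> 'q xpoly) module" where
  "End_algebra W = \<lparr>
     partial_object.carrier = {T \<in> W \<rightarrow>\<^sub>E W. (\<forall>f\<in>W. \<forall>g\<in>W. T (f + g) = T f + T g) \<and>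
                             (\<forall>c. \<forall>f\<in>W. T (Const c * f) = Const c * T f)},
     monoid.mult = (\<lambda>S T. compose W S T),
     monoid.one = (\<lambda>f\<in>W. f),
     ring.zero = (\<lambda>f\<in>W. 0),
     ring.add = (\<lambda>S T. \<lambda>f\<in>W. S f + T f),
     module.smult = (\<lambda>c T. \<lambda>f\<in>W. Const c * T f)\<rparr>"


section \<open>The truncated shifted iYangian and its flag version\<close>

text \<open>
  \<open>Q = (verts, arcs, tail, head)\<close> is the quiver, \<open>i \<rightarrow>\<^bsub>Q\<^esub> j\<close> says that it has an arrow from
  \<open>i\<close> to \<open>j\<close>, and \<open>\<tau>\<close>, \<open>\<tau>a\<close> are the involution on vertices and on arrows.  The weights \<open>lam\<close>
  and \<open>mu\<close> are given by their coordinates with respect to the fundamental weights, so that the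
  simple root \<open>\<alpha>\<^sub>j\<close> has coordinates \<open>cartan Q i j\<close>.
\<close>

definition cartan :: "('q, 'e) pre_digraph \<Rightarrow> 'q \<Rightarrow> 'q \<Rightarrow> int" where
  "cartan Q i j = (if i = j then 2 else if i \<rightarrow>\<^bsub>Q\<^esub> j \<or> j \<rightarrow>\<^bsub>Q\<^esub> i then -1 else 0)"

locale iyangian_data =
  fin_digraph Q + loopfree_digraph Q
  for Q :: "('q::linorder, 'e) pre_digraph" (structure) +
  fixes \<tau> :: "'q \<Rightarrow> 'q" and \<tau>a :: "'e \<Rightarrow> 'e"
    and Qp Qm :: "'q set"
    and lam :: "'q \<Rightarrow> nat" and mu :: "'q \<Rightarrow> int" and v :: "'q \<Rightarrow> nat"
    and R :: "'q \<Rightarrow> complex multiset"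
  assumes at_most_one_arrow: "a \<in> arcs Q \<Longrightarrow> b \<in> arcs Q \<Longrightarrow>
      {tail Q a, head Q a} = {tail Q b, head Q b} \<Longrightarrow> a = b"
    and tau_verts: "i \<in> verts Q \<Longrightarrow> \<tau> i \<in> verts Q"
    and tau_invol: "i \<in> verts Q \<Longrightarrow> \<tau> (\<tau> i) = i"
    and tau_no_fixed: "i \<in> verts Q \<Longrightarrow> \<tau> i \<noteq> i"
    and tau_arcs: "a \<in> arcs Q \<Longrightarrow> \<tau>a a \<in> arcs Q"
    and tau_arcs_invol: "a \<in> arcs Q \<Longrightarrow> \<tau>a (\<tau>a a) = a"
    and tau_tail: "a \<in> arcs Q \<Longrightarrow> tail Q (\<tau>a a) = \<tau> (head Q a)"
    and tau_head: "a \<in> arcs Q \<Longrightarrow> head Q (\<tau>a a) = \<tau> (tail Q a)"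
    and tau_fixed_arc: "a \<in> arcs Q \<Longrightarrow> \<tau> (tail Q a) = head Q a \<longleftrightarrow> \<tau>a a = a"
    and partition: "verts Q = Qp \<union> Qm" "Qp \<inter> Qm = {}"
    and tau_partition: "\<tau> ` Qp = Qm" "\<tau> ` Qm = Qp"
    and arrows_direction: "a \<in> arcs Q \<Longrightarrow> tail Q a \<in> Qp \<and> head Q a \<in> Qm"
    and mu_invariant: "i \<in> verts Q \<Longrightarrow> mu (\<tau> i) = mu i"
    and v_invariant: "i \<in> verts Q \<Longrightarrow> v (\<tau> i) = v i"
    and weight_eq: "i \<in> verts Q \<Longrightarrow>
      int (lam i) + int (lam (\<tau> i)) - mu i = (\<Sum>j\<in>verts Q. cartan Q i j * int (v j))"
    and size_R: "i \<in> verts Q \<Longrightarrow> size (R i) = lam i"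
begin

definition P :: "'q xpoly set" where
  "P = {f. \<forall>m\<in>Poly_Mapping.keys f. Poly_Mapping.keys m \<subseteq> {(i, k). i \<in> Qp \<and> 1 \<le> k \<and> k \<le> v i}}"

definition P_inv :: "'q xpoly set" where
  "P_inv = {f \<in> P. \<forall>\<pi>. (\<forall>i\<in>Qp. \<pi> i permutes {1..v i}) \<longrightarrow>
     poly_subst (\<lambda>(i, k). if i \<in> Qp then Var (i, \<pi> i k) else Var (i, k)) f = f}"

definition xvar :: "'q \<Rightarrow> nat \<Rightarrow> 'q xpoly" where
  "xvar i k = (if i \<in> Qp then Var (i, k) else - Var (\<tau> i, k))"

definition dop :: "'q \<Rightarrow> nat \<Rightarrow> 'q xpoly \<Rightarrow> 'q xpoly" where
  "dop i k = (if i \<in> Qp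
     then poly_subst (\<lambda>y. if y = (i, k) then Var y + Const hbar else Var y)
     else poly_subst (\<lambda>y. if y = (\<tau> i, k) then Var y - Const hbar else Var y))"

text \<open>
  All rational expressions in \<open>z\<close> and the variables are computed in the field of Laurent series
  in \<open>z\<inverse>\<close> over the fraction field of the polynomial ring.  The Laurent series variable
  \<open>fls_X\<close> of the library stands for \<open>z\<inverse>\<close>, hence \<open>z\<close> is \<open>fls_X_inv\<close>, and the coefficient of
  \<open>z\<^sup>-\<^sup>n\<close> is \<open>fls_nth _ n\<close>.
\<close>

definition zv :: "'q xpoly fract fls" where
  "zv = fls_X_inv"

definition emb :: "'q xpoly \<Rightarrow> 'q xpoly fract fls" where
  "emb f = fls_const (to_fract f)"

definition hb :: "'q xpoly fract fls" where
  "hb = emb (Const hbar)"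

definition pfun :: "'q \<Rightarrow> 'q xpoly fract fls \<Rightarrow> 'q xpoly fract fls" where
  "pfun i u = (\<Prod>c\<in>#R i. u - emb (Const (to_fract [:c:])) * hb)"

definition V :: "'q \<Rightarrow> 'q xpoly fract fls \<Rightarrow> 'q xpoly fract fls" where
  "V i u = (\<Prod>k\<in>{1..v i}. u - emb (xvar i k))"

text \<open>\<open>V_del i r u\<close> is \<open>V i u\<close> with the factor \<open>u - xvar i r\<close> cancelled, also where it vanishes.\<close>

definition V_del :: "'q \<Rightarrow> nat \<Rightarrow> 'q xpoly fract fls \<Rightarrow> 'q xpoly fract fls" where
  "V_del i r u = (\<Prod>k\<in>{1..v i} - {r}. u - emb (xvar i k))"

definition b_summand :: "'q \<Rightarrow> nat \<Rightarrow> 'q xpoly fract fls" where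
  "b_summand i r =
     1 / (- zv - emb (xvar i r) - hb / 2) *
     (if i \<rightarrow>\<^bsub>Q\<^esub> \<tau> i then V_del (\<tau> i) r (emb (xvar i r) + hb / 2) else 1) *
     (\<Prod>j\<in>{j \<in> verts Q. j \<noteq> \<tau> i \<and> i \<rightarrow>\<^bsub>Q\<^esub> j}. V j (emb (xvar i r) + hb / 2)) *
     (pfun (\<tau> i) (emb (xvar (\<tau> i) r)) / V_del i r (emb (xvar i r)))"

definition hser :: "'q \<Rightarrow> 'q xpoly fract fls" where
  "hser i = (- 1) powi (int (v i) - 1 + of_bool (i \<rightarrow>\<^bsub>Q\<^esub> \<tau> i)) *
     (2 * zv) powi cartan Q i (\<tau> i) *
     (pfun i (- zv) * pfun (\<tau> i) zv / (V i (- zv + hb / 2) * V i (- zv - hb / 2))) *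
     (\<Prod>j\<in>{j \<in> verts Q. i \<rightarrow>\<^bsub>Q\<^esub> j}. V j (- zv)) *
     (\<Prod>j\<in>{j \<in> verts Q. \<tau> i \<rightarrow>\<^bsub>Q\<^esub> j}. V j zv)"

definition b_coeff :: "'q \<Rightarrow> int \<Rightarrow> 'q xpoly \<Rightarrow> 'q xpoly" where
  "b_coeff i n = (\<lambda>f\<in>P_inv.
     poly_of_fract (fls_nth (\<Sum>r\<in>{1..v i}. b_summand i r * emb (dop i r f)) n))"

definition h_coeff :: "'q \<Rightarrow> int \<Rightarrow> 'q xpoly \<Rightarrow> 'q xpoly" where
  "h_coeff i n = (\<lambda>f\<in>P_inv. poly_of_fract (fls_nth (hser i * emb f) n))"

definition Y :: "(hfield, 'q xpoly \<Rightarrow> 'q xpoly) module" where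
  "Y = (End_algebra P_inv)\<lparr>carrier := generated_subalgebra (End_algebra P_inv)
     ({b_coeff i n |i n. i \<in> verts Q} \<union> {h_coeff i n |i n. i \<in> verts Q})\<rparr>"

definition divided_diff :: "'q \<Rightarrow> nat \<Rightarrow> 'q xpoly \<Rightarrow> 'q xpoly" where
  "divided_diff i k f = poly_of_fract
     (to_fract (poly_subst (\<lambda>(j, l). Var (j, if j = i then transpose k (Suc k) l else l)) f - f) /
      to_fract (Var (i, Suc k) - Var (i, k)))"

text \<open>The reduced word \<open>(s\<^sub>1) (s\<^sub>2 s\<^sub>1) (s\<^sub>3 s\<^sub>2 s\<^sub>1) \<dots>\<close> of the longest element of \<open>S\<^sub>n\<close>.\<close>

definition longest_word :: "nat \<Rightarrow> nat list" where
  "longest_word n = concat (map (\<lambda>m. rev [1..<Suc m]) [1..<n])"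

definition divided_diff_w0 :: "'q \<Rightarrow> 'q xpoly \<Rightarrow> 'q xpoly" where
  "divided_diff_w0 i = foldr (\<lambda>k T. divided_diff i k \<circ> T) (longest_word (v i)) id"

definition e_factor :: "'q \<Rightarrow> 'q xpoly \<Rightarrow> 'q xpoly" where
  "e_factor i f = Const (1 / of_nat (fact (v i))) *
     divided_diff_w0 i ((\<Prod>(k, l)\<in>{(k, l). 1 \<le> k \<and> k < l \<and> l \<le> v i}. Var (i, k) - Var (i, l)) * f)"

text \<open>The factors for different \<open>i\<close> commute, so the order of the composition is immaterial.\<close>

definition e_inv :: "'q xpoly \<Rightarrow> 'q xpoly" where
  "e_inv = foldr (\<lambda>i T. e_factor i \<circ> T) (sorted_list_of_set Qp) id"

definition FY :: "(hfield, 'q xpoly \<Rightarrow> 'q xpoly) module" where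
  "FY = (End_algebra P)\<lparr>carrier := generated_subalgebra (End_algebra P)
     ({\<lambda>f\<in>P. divided_diff i k f |i k. i \<in> Qp \<and> 1 \<le> k \<and> k < v i} \<union>
      {\<lambda>f\<in>P. g * f |g. g \<in> P} \<union>
      {\<lambda>f\<in>P. X (e_inv f) |X. X \<in> carrier Y})\<rparr>"

end

end

theory Submission
  imports Defs "HOL-Algebra.Ideal"
begin

text \<open>
  The projection \<open>e = e_inv\<close> is an idempotent of \<open>FY\<close>.  It generates \<open>FY\<close> as a two-sided ideal:
  the operator \<open>W\<close> of the longest element satisfies \<open>W = e W\<close>, and repeatedly forming
  \<open>x\<^sub>j T - T x\<^sub>n\<close> peels the divided differences off \<open>W\<close> until the identity is left.  Hence \<open>FY\<close> is
  Morita equivalent to the corner \<open>e FY e\<close>.  NilHecke operators are linear over the symmetric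
  polynomials, so this corner is generated by \<open>Y\<close> and the multiplications by symmetric
  polynomials, and it remains to see that the latter lie in \<open>Y\<close>.

  Let \<open>q\<^sub>N\<close> be the vector of the \<open>N\<close>-th power sums of the variables at the vertices in \<open>Qp\<close>.  The
  coefficients of the logarithmic derivative of \<open>h\<^sub>i(z)\<close> show that \<open>Y\<close> contains
  \<open>B q\<^sub>N + c q\<^sub>N\<^sub>-\<^sub>2 + \<dots>\<close> with an integral symmetric matrix \<open>B\<close> and a nonzero multiple \<open>c\<close> of
  \<open>hbar\<^sup>2\<close>.  As \<open>B\<close> may be singular (for a cyclic quiver, say), one uses two consecutive relations:
  if \<open>N\<close> is minimal with \<open>q\<^sub>N\<close> not in \<open>Y\<close>, then modulo \<open>Y\<close> both \<open>B q\<^sub>N = 0\<close> and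
  \<open>c q\<^sub>N = - B q\<^sub>N\<^sub>+\<^sub>2\<close>, and a vector in the kernel and the image of a real symmetric matrix vanishes.
\<close>

section \<open>Morita equivalence with a full corner\<close>

text \<open>The shifts by \<open>hbar / 2\<close> are what makes the statement true for every
  quiver: without them \<open>h_i(z)\<close> would yield only the combinations \<open>B q_N\<close>,
  which need not generate the symmetric polynomials. The factors \<open>V_i(-z + hbar/2)\<close> and
  \<open>V_i(-z - hbar/2)\<close> enter a logarithmic derivative with opposite shifts, so the
  corrections of odd order cancel and \<open>q_N\<close> is followed by \<open>q_(N-2)\<close>, with
  coefficient \<open>(N choose 2) hbar^2 / 2\<close>. The entry of \<open>B\<close> at
  \<open>i\<close>, \<open>j\<close> is 2 if \<open>i = j\<close>, minus \<open>(-1)^N\<close> if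
  there is an arrow from \<open>i\<close> to \<open>\<tau> j\<close>. The sign arises because the
  variables at a vertex of \<open>Qm\<close> are the negated variables of its partner; it is the
  same for \<open>N\<close> and \<open>N + 2\<close>, so both relations involve the same matrix.
  Symmetry of \<open>B\<close> is the action of \<tau> on arrows. Positivity of sums of squares
  separates kernel from image, so the linear algebra is done over the reals although the ground
  field is \<open>C(hbar)\<close>. The generators of \<open>Y\<close> are given by rational
  formulas. That they preserve symmetric polynomials is part of the proof: the sum defining
  \<open>b_i(z)\<close> is a Newton divided difference.\<close>

lemma left_moduleI:
  fixes A :: "('k, 'a) module" and M :: "('a, 'u) module"
  assumes "ring A" "abelian_group M"
    "\<And>a x. a \<in> carrier A \<Longrightarrow> x \<in> carrier M \<Longrightarrow> a \<odot>\<^bsub>M\<^esub> x \<in> carrier M"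
    "\<And>a b x. a \<in> carrier A \<Longrightarrow> b \<in> carrier A \<Longrightarrow> x \<in> carrier M \<Longrightarrow>
      (a \<oplus>\<^bsub>A\<^esub> b) \<odot>\<^bsub>M\<^esub> x = a \<odot>\<^bsub>M\<^esub> x \<oplus>\<^bsub>M\<^esub> b \<odot>\<^bsub>M\<^esub> x"
    "\<And>a x y. a \<in> carrier A \<Longrightarrow> x \<in> carrier M \<Longrightarrow> y \<in> carrier M \<Longrightarrow>
      a \<odot>\<^bsub>M\<^esub> (x \<oplus>\<^bsub>M\<^esub> y) = a \<odot>\<^bsub>M\<^esub> x \<oplus>\<^bsub>M\<^esub> a \<odot>\<^bsub>M\<^esub> y"
    "\<And>a b x. a \<in> carrier A \<Longrightarrow> b \<in> carrier A \<Longrightarrow> x \<in> carrier M \<Longrightarrow>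
      (a \<otimes>\<^bsub>A\<^esub> b) \<odot>\<^bsub>M\<^esub> x = a \<odot>\<^bsub>M\<^esub> (b \<odot>\<^bsub>M\<^esub> x)"
    "\<And>x. x \<in> carrier M \<Longrightarrow> \<one>\<^bsub>A\<^esub> \<odot>\<^bsub>M\<^esub> x = x"
  shows "left_module A M"
  using assms by (auto intro!: left_module.intro left_module_axioms.intro)

context left_module
begin

lemma act_zero_right: "a \<in> carrier A \<Longrightarrow> a \<odot>\<^bsub>M\<^esub> \<zero>\<^bsub>M\<^esub> = \<zero>\<^bsub>M\<^esub>"
  by (metis M.add.l_cancel_one' M.l_zero M.zero_closed act_add_right act_closed)

lemma act_minus_right:
  "a \<in> carrier A \<Longrightarrow> x \<in> carrier M \<Longrightarrow> a \<odot>\<^bsub>M\<^esub> (\<ominus>\<^bsub>M\<^esub> x) = \<ominus>\<^bsub>M\<^esub> (a \<odot>\<^bsub>M\<^esub> x)"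
  by (metis M.a_inv_closed M.l_neg M.minus_equality act_add_right act_closed act_zero_right)

end

lemma (in assoc_algebra) one_smult_mult: "x \<in> carrier A \<Longrightarrow> (c \<odot> \<one>) \<otimes> x = c \<odot> x"
  by (simp add: smult_mult_left)

text \<open>Two scalars with the same effect on \<open>x\<close> differ by a scalar that annihilates
  \<open>x\<close>; if they were distinct, this difference would be invertible and \<open>x\<close>
  would vanish. So the multiples of a nonzero \<open>x\<close> form a copy of the infinite ground
  field.\<close>

lemma infinite_left_module:
  fixes A :: "('k::field, 'a) module"
  assumes "assoc_algebra A" "left_module A M" "infinite (UNIV :: 'k set)"
    "x \<in> carrier M" "x \<noteq> \<zero>\<^bsub>M\<^esub>"
  shows "infinite (carrier M)"
proof -
  interpret A: assoc_algebra A by fact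
  interpret M: left_module A M by fact
  define s where "s c = c \<odot>\<^bsub>A\<^esub> \<one>\<^bsub>A\<^esub>" for c
  have s: "s c \<in> carrier A" for c by (simp add: s_def A.smult_closed)
  have "inj (\<lambda>c. s c \<odot>\<^bsub>M\<^esub> x)"
  proof (rule injI, rule ccontr)
    fix c d assume eq: "s c \<odot>\<^bsub>M\<^esub> x = s d \<odot>\<^bsub>M\<^esub> x" and "c \<noteq> d"
    have "s c = s d \<oplus>\<^bsub>A\<^esub> s (c - d)"
      unfolding s_def by (subst A.smult_add_scalar[symmetric]) auto
    hence "s d \<odot>\<^bsub>M\<^esub> x \<oplus>\<^bsub>M\<^esub> s (c - d) \<odot>\<^bsub>M\<^esub> x = s d \<odot>\<^bsub>M\<^esub> x"
      using eq s assms by (metis M.act_add_left)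
    hence z: "s (c - d) \<odot>\<^bsub>M\<^esub> x = \<zero>\<^bsub>M\<^esub>"
      using s assms(4) by (simp add: M.M.add.l_cancel_one M.act_closed)
    have "s (inverse (c - d)) \<otimes>\<^bsub>A\<^esub> s (c - d) = \<one>\<^bsub>A\<^esub>"
      unfolding s_def using \<open>c \<noteq> d\<close>
      by (simp add: A.one_smult_mult A.smult_closed A.smult_smult[symmetric] A.smult_one)
    hence "x = s (inverse (c - d)) \<odot>\<^bsub>M\<^esub> (s (c - d) \<odot>\<^bsub>M\<^esub> x)"
      using s assms(4) by (metis M.act_mult M.act_one)
    thus False using z s assms by (simp add: M.act_zero_right)
  qed
  moreover have "range (\<lambda>c. s c \<odot>\<^bsub>M\<^esub> x) \<subseteq> carrier M"
    using s assms by (auto simp: M.act_closed)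
  ultimately show ?thesis
    using assms(3) finite_subset finite_imageD by blast
qed

text \<open>An infinite set absorbs its own square, so the coordinates of a tuple can be absorbed
  one at a time. This is how a finite tuple of module elements is stored as one element of the
  universe.\<close>

lemma ex_inj_on_PiE_finite:
  assumes "finite I" "infinite N"
  shows "\<exists>f :: ('i \<Rightarrow> 'u) \<Rightarrow> 'u. inj_on f (I \<rightarrow>\<^sub>E N) \<and> f ` (I \<rightarrow>\<^sub>E N) \<subseteq> N"
  using assms(1)
proof induction
  case empty
  from \<open>infinite N\<close> obtain n where "n \<in> N" by fastforce
  thus ?case by (intro exI[of _ "\<lambda>_. n"]) auto
next
  case (insert i I)
  then obtain f where f: "inj_on f (I \<rightarrow>\<^sub>E N)" "f ` (I \<rightarrow>\<^sub>E N) \<subseteq> N" by blast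
  have "(card_of (N \<times> N), card_of N) \<in> ordLeq"
    using card_of_Times_same_infinite[OF \<open>infinite N\<close>] ordIso_imp_ordLeq by blast
  then obtain p where p: "inj_on p (N \<times> N)" "p ` (N \<times> N) \<subseteq> N"
    unfolding card_of_ordLeq[symmetric] by blast
  let ?r = "\<lambda>g. restrict g I"
  have r: "?r g \<in> I \<rightarrow>\<^sub>E N" "g i \<in> N" if "g \<in> insert i I \<rightarrow>\<^sub>E N" for g
    using that by auto
  show ?case
  proof (intro exI[of _ "\<lambda>g. p (g i, f (?r g))"] conjI inj_onI)
    fix g h assume gh: "g \<in> insert i I \<rightarrow>\<^sub>E N" "h \<in> insert i I \<rightarrow>\<^sub>E N"
      and eq: "p (g i, f (?r g)) = p (h i, f (?r h))"
    have "f (?r g) \<in> N" "f (?r h) \<in> N" using f r gh by blast+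
    hence "g i = h i" "f (?r g) = f (?r h)"
      using inj_onD[OF p(1) eq] r gh by auto
    hence "?r g = ?r h" using inj_onD[OF f(1)] r gh by blast
    show "g = h"
    proof (rule PiE_ext[OF gh])
      fix x assume "x \<in> insert i I"
      thus "g x = h x" using \<open>g i = h i\<close> fun_cong[OF \<open>?r g = ?r h\<close>, of x] by auto
    qed
  next
    show "(\<lambda>g. p (g i, f (?r g))) ` (insert i I \<rightarrow>\<^sub>E N) \<subseteq> N"
    proof (rule image_subsetI)
      fix g assume g: "g \<in> insert i I \<rightarrow>\<^sub>E N"
      have "f (?r g) \<in> N" using f(2) r(1)[OF g] by blast
      hence "(g i, f (?r g)) \<in> N \<times> N" using r(2)[OF g] by blast
      thus "p (g i, f (?r g)) \<in> N" using p(2) by blast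
    qed
  qed
qed

text \<open>Right factors are restricted to \<open>S\<close> so that the finitely many occurring in
  one expression can be singled out. Rules for zero and negatives are dispensable: left factors
  range over the whole ring and supply them.\<close>

inductive_set corner_span :: "('a, 'm) ring_scheme \<Rightarrow> 'a \<Rightarrow> 'a set \<Rightarrow> 'a set" for A e S where
  gen: "p \<in> carrier A \<Longrightarrow> q \<in> S \<Longrightarrow> p \<otimes>\<^bsub>A\<^esub> e \<otimes>\<^bsub>A\<^esub> q \<in> corner_span A e S"
| add: "x \<in> corner_span A e S \<Longrightarrow> y \<in> corner_span A e S \<Longrightarrow> x \<oplus>\<^bsub>A\<^esub> y \<in> corner_span A e S"

lemma corner_span_mono: "S \<subseteq> T \<Longrightarrow> corner_span A e S \<subseteq> corner_span A e T"
proof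
  fix x assume "S \<subseteq> T" "x \<in> corner_span A e S"
  from this(2,1) show "x \<in> corner_span A e T"
    by induction (auto intro: corner_span.intros)
qed

lemma corner_span_finite:
  assumes "x \<in> corner_span A e S"
  shows "\<exists>F. finite F \<and> F \<subseteq> S \<and> x \<in> corner_span A e F"
  using assms
proof induction
  case (gen p q)
  thus ?case by (intro exI[of _ "{q}"]) (auto intro: corner_span.intros)
next
  case (add x y)
  then obtain F G where "finite F" "F \<subseteq> S" "x \<in> corner_span A e F"
    "finite G" "G \<subseteq> S" "y \<in> corner_span A e G" by blast
  thus ?case using corner_span_mono[of F "F \<union> G" A e, THEN subsetD]
      corner_span_mono[of G "F \<union> G" A e, THEN subsetD]
    by (intro exI[of _ "F \<union> G"]) (auto intro!: corner_span.add)
qed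

text \<open>The sums of products \<open>p e q\<close> form a two-sided ideal containing
  \<open>e = 1 e 1\<close>, and the generated ideal is the smallest such ideal.\<close>

lemma (in ring) genideal_subset_corner_span:
  fixes e assumes e: "e \<in> carrier R"
  shows "Idl {e} \<subseteq> corner_span R e (carrier R)"
proof (rule genideal_minimal)
  let ?I = "corner_span R e (carrier R)"
  have closed: "x \<in> carrier R" if "x \<in> ?I" for x
    using that e by induction auto
  have L: "a \<otimes> x \<in> ?I" if "x \<in> ?I" "a \<in> carrier R" for x a
    using that
  proof induction
    case (gen p q)
    thus ?case using e corner_span.gen[of "a \<otimes> p" R q "carrier R" e] by (simp add: m_assoc)
  next
    case (add x y)
    thus ?case using closed by (simp add: r_distr corner_span.add)
  qed
  have Rm: "x \<otimes> a \<in> ?I" if "x \<in> ?I" "a \<in> carrier R" for x a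
    using that
  proof induction
    case (gen p q)
    thus ?case using e corner_span.gen[of p R "q \<otimes> a" "carrier R" e] by (simp add: m_assoc)
  next
    case (add x y)
    thus ?case using closed by (simp add: l_distr corner_span.add)
  qed
  have z: "\<zero> \<in> ?I"
    using corner_span.gen[of \<zero> R \<zero> "carrier R" e] e by simp
  have n: "\<ominus> x \<in> ?I" if "x \<in> ?I" for x
    using L[OF that, of "\<ominus> \<one>"] closed[OF that] by (simp add: l_minus)
  show "ideal ?I R"
  proof (rule idealI)
    show "subgroup ?I (add_monoid R)"
      by (rule add.subgroupI) (use closed z n in \<open>auto simp: a_inv_def intro: corner_span.add\<close>)
  qed (use L Rm ring_axioms in auto)
  show "{e} \<subseteq> ?I" using corner_span.gen[of \<one> R \<one> "carrier R" e] e by simp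
qed

text \<open>\<open>B\<close> is a separate algebra with an embedding onto the corner
  \<open>e A e\<close>, not a subset of \<open>A\<close>: in the application the elements of
  \<open>Y\<close> act on symmetric polynomials and those of \<open>FY\<close> on all polynomials.
  The embedding takes the unit of \<open>B\<close> to \<open>e\<close>, not to the unit of
  \<open>A\<close>.\<close>

locale full_corner = A: assoc_algebra A + B: assoc_algebra B
  for A :: "('k::field, 'a) module" (structure) and B :: "('k, 'b) module" +
  fixes e :: 'a and \<iota> :: "'b \<Rightarrow> 'a"
  assumes e_closed: "e \<in> carrier A"
    and \<iota>_closed: "b \<in> carrier B \<Longrightarrow> \<iota> b \<in> carrier A"
    and \<iota>_inj: "inj_on \<iota> (carrier B)"
    and \<iota>_add: "b \<in> carrier B \<Longrightarrow> c \<in> carrier B \<Longrightarrow> \<iota> (b \<oplus>\<^bsub>B\<^esub> c) = \<iota> b \<oplus> \<iota> c"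
    and \<iota>_mult: "b \<in> carrier B \<Longrightarrow> c \<in> carrier B \<Longrightarrow> \<iota> (b \<otimes>\<^bsub>B\<^esub> c) = \<iota> b \<otimes> \<iota> c"
    and \<iota>_one: "\<iota> \<one>\<^bsub>B\<^esub> = e"
    and \<iota>_smult: "b \<in> carrier B \<Longrightarrow> \<iota> (k \<odot>\<^bsub>B\<^esub> b) = k \<odot> \<iota> b"
    and corner: "a \<in> carrier A \<Longrightarrow> e \<otimes> a \<otimes> e \<in> \<iota> ` carrier B"
    and full: "\<one> \<in> genideal A {e}"
    and infinite_field: "infinite (UNIV :: 'k set)"
begin

lemma e_idem: "e \<otimes> e = e"
  using \<iota>_mult[of "\<one>\<^bsub>B\<^esub>" "\<one>\<^bsub>B\<^esub>"] \<iota>_one by simp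

lemma e_\<iota>: "b \<in> carrier B \<Longrightarrow> e \<otimes> \<iota> b = \<iota> b"
  and \<iota>_e: "b \<in> carrier B \<Longrightarrow> \<iota> b \<otimes> e = \<iota> b"
  using \<iota>_mult[of "\<one>\<^bsub>B\<^esub>" b] \<iota>_mult[of b "\<one>\<^bsub>B\<^esub>"] \<iota>_one by auto

text \<open>The compression of \<open>A\<close> onto its corner, read in \<open>B\<close>. It is
  additive, left \<open>B\<close>-linear and inverse to \<open>\<iota>\<close> on the
  corner.\<close>

definition \<kappa> :: "'a \<Rightarrow> 'b" where
  "\<kappa> a = inv_into (carrier B) \<iota> (e \<otimes> a \<otimes> e)"

lemma \<kappa>_closed: "a \<in> carrier A \<Longrightarrow> \<kappa> a \<in> carrier B"
  unfolding \<kappa>_def using corner by (rule inv_into_into)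

lemma \<iota>_\<kappa>: "a \<in> carrier A \<Longrightarrow> \<iota> (\<kappa> a) = e \<otimes> a \<otimes> e"
  unfolding \<kappa>_def using corner by (rule f_inv_into_f)

lemma \<kappa>_eqI: "b \<in> carrier B \<Longrightarrow> a \<in> carrier A \<Longrightarrow> e \<otimes> a \<otimes> e = \<iota> b \<Longrightarrow> \<kappa> a = b"
  using \<iota>_inj \<iota>_\<kappa> \<kappa>_closed by (metis inj_onD)

text \<open>The right ideal \<open>e A\<close> as a set of fixed points. It is a bimodule:
  \<open>B\<close> acts from the left through \<open>\<iota>\<close>, and \<open>A\<close> acts from
  the right.\<close>

definition eA :: "'a set" where
  "eA = {x \<in> carrier A. e \<otimes> x = x}"

lemma eA_closed: "x \<in> eA \<Longrightarrow> x \<in> carrier A"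
  and eA_absorb: "x \<in> eA \<Longrightarrow> e \<otimes> x = x"
  by (auto simp: eA_def)

lemma eA_mult: "x \<in> eA \<Longrightarrow> a \<in> carrier A \<Longrightarrow> x \<otimes> a \<in> eA"
  using e_closed by (auto simp: eA_def A.m_assoc[symmetric])

lemma eA_add: "x \<in> eA \<Longrightarrow> y \<in> eA \<Longrightarrow> x \<oplus> y \<in> eA"
  using e_closed by (auto simp: eA_def A.r_distr)

lemma e_mult_eA: "a \<in> carrier A \<Longrightarrow> e \<otimes> a \<in> eA"
  using e_closed e_idem by (auto simp: eA_def A.m_assoc[symmetric])

lemma e_eA: "e \<in> eA"
  using e_closed e_idem by (auto simp: eA_def)

lemma \<iota>_mult_eA: "b \<in> carrier B \<Longrightarrow> x \<in> eA \<Longrightarrow> \<iota> b \<otimes> x \<in> eA"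
  using e_\<iota> \<iota>_closed e_closed by (auto simp: eA_def A.m_assoc[symmetric])

lemma \<iota>_\<kappa>_eA: "x \<in> eA \<Longrightarrow> a \<in> carrier A \<Longrightarrow> \<iota> (\<kappa> (x \<otimes> a)) = x \<otimes> a \<otimes> e"
  using e_closed eA_closed eA_absorb by (simp add: \<iota>_\<kappa> A.m_assoc[symmetric])

text \<open>Finitely many right factors \<open>q\<close> that suffice to write 1 as a sum of
  products \<open>p e q\<close>. Since \<open>x = x 1\<close> is then a sum of terms
  \<open>(x p e) (e q)\<close>, the elements \<open>e q\<close> generate \<open>eA\<close> as a left
  \<open>B\<close>-module.\<close>

definition base :: "'a set" where
  "base = (SOME F. finite F \<and> F \<subseteq> carrier A \<and> \<one> \<in> corner_span A e F)"

lemma base: "finite base" "base \<subseteq> carrier A" "\<one> \<in> corner_span A e base"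
proof -
  have "\<one> \<in> corner_span A e (carrier A)"
    using A.genideal_subset_corner_span[OF e_closed] full by blast
  from corner_span_finite[OF this]
  have "finite base \<and> base \<subseteq> carrier A \<and> \<one> \<in> corner_span A e base"
    unfolding base_def by (rule someI_ex)
  thus "finite base" "base \<subseteq> carrier A" "\<one> \<in> corner_span A e base" by blast+
qed

text \<open>The property is followed along one expression of 1 as a sum of products
  \<open>p e q\<close>; this is how fullness of the idempotent enters the later arguments.\<close>

lemma base_induct [consumes 0, case_names gen add]:
  assumes "\<And>p q. p \<in> carrier A \<Longrightarrow> q \<in> base \<Longrightarrow> Pr (p \<otimes> e \<otimes> q)"
    and "\<And>x y. x \<in> carrier A \<Longrightarrow> y \<in> carrier A \<Longrightarrow> Pr x \<Longrightarrow> Pr y \<Longrightarrow> Pr (x \<oplus> y)"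
  shows "Pr \<one>"
proof -
  have "x \<in> carrier A \<and> Pr x" if "x \<in> corner_span A e base" for x
    using that by induction (use assms base(2) e_closed in auto)
  thus ?thesis using base(3) by blast
qed

definition corner_module :: "('a, 'u) module \<Rightarrow> ('b, 'u) module" where
  "corner_module M = \<lparr>partial_object.carrier = {x \<in> carrier M. e \<odot>\<^bsub>M\<^esub> x = x},
     monoid.mult = undefined, monoid.one = undefined, ring.zero = \<zero>\<^bsub>M\<^esub>,
     ring.add = ring.add M, module.smult = (\<lambda>b x. \<iota> b \<odot>\<^bsub>M\<^esub> x)\<rparr>"

lemma corner_module_simps:
  "carrier (corner_module M) = {x \<in> carrier M. e \<odot>\<^bsub>M\<^esub> x = x}"
  "\<zero>\<^bsub>corner_module M\<^esub> = \<zero>\<^bsub>M\<^esub>"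
  "x \<oplus>\<^bsub>corner_module M\<^esub> y = x \<oplus>\<^bsub>M\<^esub> y"
  "b \<odot>\<^bsub>corner_module M\<^esub> x = \<iota> b \<odot>\<^bsub>M\<^esub> x"
  by (simp_all add: corner_module_def)

lemma left_module_corner_module:
  assumes "left_module A M"
  shows "left_module B (corner_module M)"
proof -
  interpret M: left_module A M by fact
  show ?thesis
  proof (rule left_moduleI)
    show "abelian_group (corner_module M)"
    proof (rule abelian_groupI)
      fix x assume "x \<in> carrier (corner_module M)"
      thus "\<exists>y\<in>carrier (corner_module M). y \<oplus>\<^bsub>corner_module M\<^esub> x = \<zero>\<^bsub>corner_module M\<^esub>"
        using e_closed by (intro bexI[of _ "\<ominus>\<^bsub>M\<^esub> x"])
          (auto simp: corner_module_simps M.M.l_neg M.act_minus_right)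
    qed (use e_closed in \<open>auto simp: corner_module_simps M.act_add_right M.act_zero_right
            M.M.a_ac\<close>)
    show "b \<odot>\<^bsub>corner_module M\<^esub> x \<in> carrier (corner_module M)"
      if "b \<in> carrier B" "x \<in> carrier (corner_module M)" for b x
      using that e_closed
      by (simp add: corner_module_simps M.act_closed \<iota>_closed M.act_mult[symmetric] e_\<iota>)
  qed (use B.ring_axioms in \<open>auto simp: corner_module_simps M.act_add_right M.act_add_left
        M.act_mult \<iota>_closed \<iota>_add \<iota>_mult \<iota>_one\<close>)
qed

text \<open>
  The quasi-inverse sends \<open>N\<close> to \<open>Hom\<^sub>B(eA, N)\<close>.  Its elements are functions, which have to be encoded
  in the universe \<open>'u\<close>: a homomorphism is determined by its values on the finite set \<open>e base\<close>, and
  \<open>N\<close> is zero or infinite.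
\<close>

definition hom_set :: "('b, 'u) module \<Rightarrow> ('a \<Rightarrow> 'u) set" where
  "hom_set N = {f \<in> eA \<rightarrow>\<^sub>E carrier N.
     (\<forall>x\<in>eA. \<forall>y\<in>eA. f (x \<oplus> y) = f x \<oplus>\<^bsub>N\<^esub> f y) \<and>
     (\<forall>b\<in>carrier B. \<forall>x\<in>eA. f (\<iota> b \<otimes> x) = b \<odot>\<^bsub>N\<^esub> f x)}"

lemma hom_setD:
  assumes "f \<in> hom_set N"
  shows "f \<in> eA \<rightarrow>\<^sub>E carrier N"
    and "x \<in> eA \<Longrightarrow> f x \<in> carrier N"
    and "x \<in> eA \<Longrightarrow> y \<in> eA \<Longrightarrow> f (x \<oplus> y) = f x \<oplus>\<^bsub>N\<^esub> f y"
    and "b \<in> carrier B \<Longrightarrow> x \<in> eA \<Longrightarrow> f (\<iota> b \<otimes> x) = b \<odot>\<^bsub>N\<^esub> f x"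
  using assms by (auto simp: hom_set_def)

lemma hom_set_extensional: "f \<in> hom_set N \<Longrightarrow> f \<in> extensional eA"
  by (auto simp: hom_set_def PiE_def)

text \<open>Since \<open>x = e x\<close>, the product \<open>x p e\<close> lies in the corner, and
  \<open>x p e q = (x p e) (e q)\<close>; linearity over \<open>B\<close> pulls the first factor out
  of \<open>f\<close>.\<close>

lemma hom_set_generated:
  assumes "f \<in> hom_set N" "x \<in> eA" "p \<in> carrier A" "q \<in> carrier A"
  shows "f (x \<otimes> (p \<otimes> e \<otimes> q)) = \<kappa> (x \<otimes> p) \<odot>\<^bsub>N\<^esub> f (e \<otimes> q)"
proof -
  have "x \<otimes> (p \<otimes> e \<otimes> q) = x \<otimes> p \<otimes> e \<otimes> (e \<otimes> q)"
    using assms(2-4) e_closed eA_closed e_idem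
    by (simp add: A.m_assoc) (simp add: A.m_assoc[symmetric])
  also have "\<dots> = \<iota> (\<kappa> (x \<otimes> p)) \<otimes> (e \<otimes> q)"
    using assms by (simp add: \<iota>_\<kappa>_eA)
  finally show ?thesis
    using assms \<kappa>_closed eA_closed e_mult_eA by (simp add: hom_setD(4))
qed

lemma hom_set_eqI:
  assumes "left_module B N" "f \<in> hom_set N" "g \<in> hom_set N"
    and "\<And>q. q \<in> base \<Longrightarrow> f (e \<otimes> q) = g (e \<otimes> q)"
  shows "f = g"
proof (rule PiE_ext)
  show "f \<in> eA \<rightarrow>\<^sub>E carrier N" "g \<in> eA \<rightarrow>\<^sub>E carrier N" using assms hom_setD(1) by blast+
  fix x assume x: "x \<in> eA"
  have "f (x \<otimes> \<one>) = g (x \<otimes> \<one>)"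
  proof (induction rule: base_induct)
    case (gen p q)
    thus ?case using assms x base(2) by (simp add: hom_set_generated subset_iff)
  next
    case (add u w)
    thus ?case using assms(2,3) x eA_closed[OF x] eA_mult by (simp add: A.r_distr hom_setD(3))
  qed
  thus "f x = g x" using eA_closed[OF x] by simp
qed

lemma ex_inj_on_hom_set:
  fixes N :: "('b, 'u) module"
  assumes N: "left_module B N"
  shows "\<exists>enc :: ('a \<Rightarrow> 'u) \<Rightarrow> 'u. inj_on enc (hom_set N)"
proof -
  interpret N: left_module B N by fact
  let ?r = "\<lambda>f. \<lambda>q\<in>base. f (e \<otimes> q)"
  have r: "inj_on ?r (hom_set N)"
  proof (rule inj_onI)
    fix f g assume "f \<in> hom_set N" "g \<in> hom_set N" "?r f = ?r g"
    thus "f = g" by (intro hom_set_eqI[OF N]) (metis restrict_apply')+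
  qed
  have r': "?r ` hom_set N \<subseteq> base \<rightarrow>\<^sub>E carrier N"
  proof (intro image_subsetI restrict_PiE_iff[THEN iffD2] ballI)
    fix f q assume f: "f \<in> hom_set N" and "q \<in> base"
    hence "e \<otimes> q \<in> eA" using base(2) e_mult_eA by blast
    thus "f (e \<otimes> q) \<in> carrier N" by (rule hom_setD(2)[OF f])
  qed
  show ?thesis
  proof (cases "\<exists>x\<in>carrier N. x \<noteq> \<zero>\<^bsub>N\<^esub>")
    case True
    hence "infinite (carrier N)"
      using infinite_left_module[OF B.assoc_algebra_axioms N infinite_field] by blast
    from ex_inj_on_PiE_finite[OF base(1) this] obtain \<phi> :: "('a \<Rightarrow> 'u) \<Rightarrow> 'u"
      where "inj_on \<phi> (base \<rightarrow>\<^sub>E carrier N)" by blast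
    hence "inj_on (\<phi> \<circ> ?r) (hom_set N)"
      using r r' by (meson comp_inj_on inj_on_subset)
    thus ?thesis by blast
  next
    case False
    hence z: "f (e \<otimes> q) = \<zero>\<^bsub>N\<^esub>" if "f \<in> hom_set N" "q \<in> base" for f q
      using hom_setD(2)[OF that(1) e_mult_eA] that(2) base(2) by blast
    have "f = g" if "f \<in> hom_set N" "g \<in> hom_set N" for f g
      using that by (intro hom_set_eqI[OF N] trans[OF z z[symmetric]])
    thus ?thesis by (auto simp: inj_on_def)
  qed
qed

definition enc :: "('b, 'u) module \<Rightarrow> ('a \<Rightarrow> 'u) \<Rightarrow> 'u" where
  "enc N = (SOME \<phi>. inj_on \<phi> (hom_set N))"

definition dec :: "('b, 'u) module \<Rightarrow> 'u \<Rightarrow> 'a \<Rightarrow> 'u" where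
  "dec N = inv_into (hom_set N) (enc N)"

lemma inj_on_enc: "left_module B N \<Longrightarrow> inj_on (enc N) (hom_set N)"
  unfolding enc_def by (rule someI_ex[OF ex_inj_on_hom_set])

lemma dec_enc: "left_module B N \<Longrightarrow> f \<in> hom_set N \<Longrightarrow> dec N (enc N f) = f"
  unfolding dec_def by (rule inv_into_f_f[OF inj_on_enc])

text \<open>Structure transported along \<open>enc\<close>: decode, compute pointwise, encode. The
  right action of \<open>A\<close> on \<open>eA\<close> becomes a left action on
  homomorphisms.\<close>

definition hom_module :: "('b, 'u) module \<Rightarrow> ('a, 'u) module" where
  "hom_module N = \<lparr>partial_object.carrier = enc N ` hom_set N,
     monoid.mult = undefined, monoid.one = undefined,
     ring.zero = enc N (\<lambda>x\<in>eA. \<zero>\<^bsub>N\<^esub>),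
     ring.add = (\<lambda>s t. enc N (\<lambda>x\<in>eA. dec N s x \<oplus>\<^bsub>N\<^esub> dec N t x)),
     module.smult = (\<lambda>a s. enc N (\<lambda>x\<in>eA. dec N s (x \<otimes> a)))\<rparr>"

lemma hom_module_simps:
  "carrier (hom_module N) = enc N ` hom_set N"
  "\<zero>\<^bsub>hom_module N\<^esub> = enc N (\<lambda>x\<in>eA. \<zero>\<^bsub>N\<^esub>)"
  "s \<oplus>\<^bsub>hom_module N\<^esub> t = enc N (\<lambda>x\<in>eA. dec N s x \<oplus>\<^bsub>N\<^esub> dec N t x)"
  "a \<odot>\<^bsub>hom_module N\<^esub> s = enc N (\<lambda>x\<in>eA. dec N s (x \<otimes> a))"
  by (simp_all add: hom_module_def)

lemma hom_set_zero:
  assumes "left_module B N" shows "(\<lambda>x\<in>eA. \<zero>\<^bsub>N\<^esub>) \<in> hom_set N"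
proof -
  interpret N: left_module B N by fact
  show ?thesis by (auto simp: hom_set_def eA_add \<iota>_mult_eA N.act_zero_right)
qed

lemma hom_set_add:
  assumes "left_module B N" "f \<in> hom_set N" "g \<in> hom_set N"
  shows "(\<lambda>x\<in>eA. f x \<oplus>\<^bsub>N\<^esub> g x) \<in> hom_set N"
proof -
  interpret N: left_module B N by fact
  show ?thesis
    unfolding hom_set_def mem_Collect_eq
    using assms(2,3) by (auto simp: eA_add \<iota>_mult_eA hom_setD N.act_add_right N.M.a_ac)
qed

lemma hom_set_uminus:
  assumes "left_module B N" "f \<in> hom_set N"
  shows "(\<lambda>x\<in>eA. \<ominus>\<^bsub>N\<^esub> f x) \<in> hom_set N"
proof -
  interpret N: left_module B N by fact
  show ?thesis
    unfolding hom_set_def mem_Collect_eq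
    using assms(2) by (auto simp: eA_add \<iota>_mult_eA hom_setD N.M.minus_add N.act_minus_right)
qed

lemma hom_set_act:
  assumes "f \<in> hom_set N" "a \<in> carrier A"
  shows "(\<lambda>x\<in>eA. f (x \<otimes> a)) \<in> hom_set N"
  unfolding hom_set_def mem_Collect_eq
  using assms by (auto simp: eA_add \<iota>_mult_eA hom_setD eA_mult A.l_distr eA_closed A.m_assoc \<iota>_closed)

lemma left_module_hom_module:
  assumes N: "left_module B N"
  shows "left_module A (hom_module N)"
proof -
  interpret N: left_module B N by fact
  note [simp] = hom_module_simps dec_enc[OF N] hom_set_zero[OF N] hom_set_add[OF N] hom_set_act
  have cong: "enc N f = enc N g" if "\<And>x. x \<in> eA \<Longrightarrow> f x = g x" "f \<in> extensional eA" "g \<in> extensional eA"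
    for f g using that by (metis extensionalityI)
  show ?thesis
  proof (rule left_moduleI)
    show "abelian_group (hom_module N)"
    proof (rule abelian_groupI)
      fix s assume "s \<in> carrier (hom_module N)"
      then obtain f where f: "f \<in> hom_set N" "s = enc N f" by auto
      show "\<exists>t\<in>carrier (hom_module N). t \<oplus>\<^bsub>hom_module N\<^esub> s = \<zero>\<^bsub>hom_module N\<^esub>"
        using f hom_set_uminus[OF N f(1)] hom_setD(2)[OF f(1)]
        by (intro bexI[of _ "enc N (\<lambda>x\<in>eA. \<ominus>\<^bsub>N\<^esub> f x)"]) (auto intro!: cong simp: N.M.l_neg)
    qed (auto intro!: cong simp: hom_setD(2) N.M.a_ac extensional_restrict hom_set_extensional)
    show "ring A" by (rule A.ring_axioms)
    show "\<one> \<odot>\<^bsub>hom_module N\<^esub> s = s" if "s \<in> carrier (hom_module N)" for s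
      using that by (auto intro!: cong simp: eA_closed hom_set_extensional)
    fix a b s t assume ab: "a \<in> carrier A" "b \<in> carrier A"
      and "s \<in> carrier (hom_module N)" "t \<in> carrier (hom_module N)"
    then obtain f g where fg: "f \<in> hom_set N" "s = enc N f" "g \<in> hom_set N" "t = enc N g"
      by auto
    show "a \<odot>\<^bsub>hom_module N\<^esub> s \<in> carrier (hom_module N)"
      using ab fg by simp
    show "(a \<oplus> b) \<odot>\<^bsub>hom_module N\<^esub> s =
        a \<odot>\<^bsub>hom_module N\<^esub> s \<oplus>\<^bsub>hom_module N\<^esub> b \<odot>\<^bsub>hom_module N\<^esub> s"
      using ab fg by (auto intro!: cong simp: A.r_distr eA_closed eA_mult hom_setD(3))
    show "a \<odot>\<^bsub>hom_module N\<^esub> (s \<oplus>\<^bsub>hom_module N\<^esub> t) =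
        a \<odot>\<^bsub>hom_module N\<^esub> s \<oplus>\<^bsub>hom_module N\<^esub> a \<odot>\<^bsub>hom_module N\<^esub> t"
      using ab fg by (auto intro!: cong simp: eA_mult)
    show "(a \<otimes> b) \<odot>\<^bsub>hom_module N\<^esub> s = a \<odot>\<^bsub>hom_module N\<^esub> (b \<odot>\<^bsub>hom_module N\<^esub> s)"
      using ab fg by (auto intro!: cong simp: eA_mult eA_closed A.m_assoc)
  qed
qed

end

lemma module_homI:
  assumes "\<And>x. x \<in> carrier M \<Longrightarrow> f x \<in> carrier N" "f \<in> extensional (carrier M)"
    "\<And>x y. x \<in> carrier M \<Longrightarrow> y \<in> carrier M \<Longrightarrow> f (x \<oplus>\<^bsub>M\<^esub> y) = f x \<oplus>\<^bsub>N\<^esub> f y"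
    "\<And>a x. a \<in> carrier A \<Longrightarrow> x \<in> carrier M \<Longrightarrow> f (a \<odot>\<^bsub>M\<^esub> x) = a \<odot>\<^bsub>N\<^esub> f x"
  shows "f \<in> module_hom A M N"
  using assms by (auto simp: module_hom_def PiE_def)

lemma module_homD:
  assumes "f \<in> module_hom A M N"
  shows "x \<in> carrier M \<Longrightarrow> f x \<in> carrier N" "f \<in> extensional (carrier M)"
    "x \<in> carrier M \<Longrightarrow> y \<in> carrier M \<Longrightarrow> f (x \<oplus>\<^bsub>M\<^esub> y) = f x \<oplus>\<^bsub>N\<^esub> f y"
    "a \<in> carrier A \<Longrightarrow> x \<in> carrier M \<Longrightarrow> f (a \<odot>\<^bsub>M\<^esub> x) = a \<odot>\<^bsub>N\<^esub> f x"
  using assms by (auto simp: module_hom_def PiE_def)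

section \<open>The two functors on morphisms, with unit and counit\<close>

context full_corner
begin

definition corner_map :: "('a, 'u) mor_map" where
  "corner_map M M' f = restrict f (carrier (corner_module M))"

definition hom_map :: "('b, 'u) mor_map" where
  "hom_map N N' g = (\<lambda>s\<in>carrier (hom_module N). enc N' (\<lambda>x\<in>eA. g (dec N s x)))"

text \<open>A homomorphism commutes with \<open>e\<close> and therefore restricts to the fixed
  points of \<open>e\<close>. A scalar \<open>c\<close> acts on them through \<open>c e\<close>,
  which there agrees with \<open>c 1\<close>.\<close>

lemma linear_functor_corner: "linear_functor A B corner_module (corner_map :: ('a, 'u) mor_map)"
  unfolding linear_functor_def
proof (intro conjI allI impI ballI funcsetI)
  fix M :: "('a, 'u) module" assume "left_module A M"
  thus "left_module B (corner_module M)" by (rule left_module_corner_module)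
next
  fix M N :: "('a, 'u) module" and f assume MN: "left_module A M" "left_module A N"
    and f: "f \<in> module_hom A M N"
  interpret M: left_module A M by fact
  note f' = module_homD[OF f]
  have c: "\<iota> b \<odot>\<^bsub>M\<^esub> x \<in> carrier M" "e \<odot>\<^bsub>M\<^esub> (\<iota> b \<odot>\<^bsub>M\<^esub> x) = \<iota> b \<odot>\<^bsub>M\<^esub> x"
    if "b \<in> carrier B" "x \<in> carrier M" for b x
    using that e_closed by (simp_all add: M.act_closed \<iota>_closed M.act_mult[symmetric] e_\<iota>)
  have fe: "e \<odot>\<^bsub>N\<^esub> f x = f x" if "x \<in> carrier M" "e \<odot>\<^bsub>M\<^esub> x = x" for x
    using f'(4)[OF e_closed that(1)] that(2) by simp
  show "corner_map M N f \<in> module_hom B (corner_module M) (corner_module N)"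
    by (rule module_homI)
      (use c e_closed in \<open>auto simp: corner_map_def corner_module_simps f' fe
        M.act_add_right \<iota>_closed\<close>)
next
  fix M :: "('a, 'u) module"
  show "corner_map M M (\<lambda>x\<in>carrier M. x) = (\<lambda>x\<in>carrier (corner_module M). x)"
    by (auto simp: corner_map_def corner_module_simps)
next
  fix L M N :: "('a, 'u) module" and f g
  assume "f \<in> module_hom A L M" "g \<in> module_hom A M N"
  note f = module_homD[OF this(1)]
  show "corner_map L N (compose (carrier L) g f) =
      compose (carrier (corner_module L)) (corner_map M N g) (corner_map L M f)"
  proof (rule ext)
    fix x
    have "e \<odot>\<^bsub>M\<^esub> f x = f x" if "x \<in> carrier L" "e \<odot>\<^bsub>L\<^esub> x = x"
      using f(4)[OF e_closed that(1)] that(2) by simp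
    thus "corner_map L N (compose (carrier L) g f) x =
        compose (carrier (corner_module L)) (corner_map M N g) (corner_map L M f) x"
      using f(1) by (auto simp: corner_map_def compose_def corner_module_simps)
  qed
next
  fix M N :: "('a, 'u) module" and f g
  assume "f \<in> module_hom A M N" "g \<in> module_hom A M N"
  show "corner_map M N (\<lambda>x\<in>carrier M. f x \<oplus>\<^bsub>N\<^esub> g x) =
      (\<lambda>x\<in>carrier (corner_module M). corner_map M N f x \<oplus>\<^bsub>corner_module N\<^esub> corner_map M N g x)"
    by (auto simp: corner_map_def corner_module_simps)
next
  fix M N :: "('a, 'u) module" and f c assume "left_module A N"
    and f: "f \<in> module_hom A M N"
  interpret N: left_module A N by fact
  note f' = module_homD[OF f]
  have "\<iota> (c \<odot>\<^bsub>B\<^esub> \<one>\<^bsub>B\<^esub>) \<odot>\<^bsub>N\<^esub> f x = (c \<odot> \<one>) \<odot>\<^bsub>N\<^esub> f x" if "x \<in> carrier M" "e \<odot>\<^bsub>M\<^esub> x = x" for x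
  proof -
    have "\<iota> (c \<odot>\<^bsub>B\<^esub> \<one>\<^bsub>B\<^esub>) = (c \<odot> \<one>) \<otimes> e"
      using e_closed by (simp add: \<iota>_smult \<iota>_one A.one_smult_mult)
    moreover have "e \<odot>\<^bsub>N\<^esub> f x = f x" using f'(4)[OF e_closed that(1)] that(2) by simp
    ultimately show ?thesis
      using that e_closed f'(1) by (simp add: N.act_mult A.smult_closed)
  qed
  thus "corner_map M N (\<lambda>x\<in>carrier M. (c \<odot> \<one>) \<odot>\<^bsub>N\<^esub> f x) =
      (\<lambda>x\<in>carrier (corner_module M). (c \<odot>\<^bsub>B\<^esub> \<one>\<^bsub>B\<^esub>) \<odot>\<^bsub>corner_module N\<^esub> corner_map M N f x)"
    by (auto simp: corner_map_def corner_module_simps)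
qed

lemma hom_set_comp:
  assumes "f \<in> hom_set N" "g \<in> module_hom B N N'"
  shows "(\<lambda>x\<in>eA. g (f x)) \<in> hom_set N'"
  unfolding hom_set_def mem_Collect_eq
  using assms by (auto simp: eA_add \<iota>_mult_eA hom_setD module_homD)

lemma hom_map_enc:
  assumes "left_module B N" "f \<in> hom_set N"
  shows "hom_map N N' g (enc N f) = enc N' (\<lambda>x\<in>eA. g (f x))"
  using assms by (simp add: hom_map_def hom_module_simps dec_enc)

lemma linear_functor_hom: "linear_functor B A hom_module (hom_map :: ('b, 'u) mor_map)"
  unfolding linear_functor_def
proof (intro conjI allI impI ballI funcsetI)
  fix N :: "('b, 'u) module" assume "left_module B N"
  thus "left_module A (hom_module N)" by (rule left_module_hom_module)
next
  fix M N :: "('b, 'u) module" and g assume MN: "left_module B M" "left_module B N"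
    and g: "g \<in> module_hom B M N"
  note g' = module_homD[OF g]
  note [simp] = dec_enc[OF MN(1)] dec_enc[OF MN(2)] hom_set_comp[OF _ g] hom_map_enc[OF MN(1)]
    hom_set_add[OF MN(1)] hom_set_act
  show "hom_map M N g \<in> module_hom A (hom_module M) (hom_module N)"
  proof (rule module_homI)
    show "hom_map M N g \<in> extensional (carrier (hom_module M))" by (simp add: hom_map_def)
  next
    fix x assume "x \<in> carrier (hom_module M)"
    thus "hom_map M N g x \<in> carrier (hom_module N)" by (auto simp: hom_module_simps)
  next
    fix s t assume "s \<in> carrier (hom_module M)" "t \<in> carrier (hom_module M)"
    then obtain f h where "f \<in> hom_set M" "s = enc M f" "h \<in> hom_set M" "t = enc M h"
      by (auto simp: hom_module_simps)
    thus "hom_map M N g (s \<oplus>\<^bsub>hom_module M\<^esub> t) = hom_map M N g s \<oplus>\<^bsub>hom_module N\<^esub> hom_map M N g t"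
      by (auto simp: hom_module_simps g' hom_setD(2) intro!: arg_cong[where f = "enc N"] restrict_ext)
  next
    fix a s assume "a \<in> carrier A" "s \<in> carrier (hom_module M)"
    then obtain f where "f \<in> hom_set M" "s = enc M f" by (auto simp: hom_module_simps)
    thus "hom_map M N g (a \<odot>\<^bsub>hom_module M\<^esub> s) = a \<odot>\<^bsub>hom_module N\<^esub> hom_map M N g s"
      using \<open>a \<in> carrier A\<close>
      by (auto simp: hom_module_simps eA_mult intro!: arg_cong[where f = "enc N"] restrict_ext)
  qed
next
  fix M :: "('b, 'u) module" assume M: "left_module B M"
  show "hom_map M M (\<lambda>x\<in>carrier M. x) = (\<lambda>s\<in>carrier (hom_module M). s)"
  proof (rule extensionalityI[of _ "carrier (hom_module M)"])
    fix s assume "s \<in> carrier (hom_module M)"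
    then obtain f where f: "f \<in> hom_set M" "s = enc M f" by (auto simp: hom_module_simps)
    have "(\<lambda>x\<in>eA. (\<lambda>x\<in>carrier M. x) (f x)) = f"
      using f(1) by (intro extensionalityI[of _ eA]) (auto simp: hom_setD(2) hom_set_extensional)
    thus "hom_map M M (\<lambda>x\<in>carrier M. x) s = (\<lambda>s\<in>carrier (hom_module M). s) s"
      using f by (simp add: hom_map_enc[OF M] hom_module_simps)
  qed (auto simp: hom_map_def)
next
  fix L M N :: "('b, 'u) module" and f g
  assume LM: "left_module B L" "left_module B M" "f \<in> module_hom B L M" "g \<in> module_hom B M N"
  show "hom_map L N (compose (carrier L) g f) =
      compose (carrier (hom_module L)) (hom_map M N g) (hom_map L M f)"
  proof (rule extensionalityI[of _ "carrier (hom_module L)"])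
    fix s assume s: "s \<in> carrier (hom_module L)"
    then obtain h where "h \<in> hom_set L" "s = enc L h" by (auto simp: hom_module_simps)
    thus "hom_map L N (compose (carrier L) g f) s =
        compose (carrier (hom_module L)) (hom_map M N g) (hom_map L M f) s"
      using s LM by (auto simp: hom_map_enc compose_eq hom_set_comp hom_setD(2)
          intro!: arg_cong[where f = "enc N"] restrict_ext)
  qed (auto simp: hom_map_def)
next
  fix M N :: "('b, 'u) module" and f g
  assume MN: "left_module B M" "left_module B N" "f \<in> module_hom B M N" "g \<in> module_hom B M N"
  show "hom_map M N (\<lambda>x\<in>carrier M. f x \<oplus>\<^bsub>N\<^esub> g x) =
      (\<lambda>s\<in>carrier (hom_module M). hom_map M N f s \<oplus>\<^bsub>hom_module N\<^esub> hom_map M N g s)"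
  proof (rule extensionalityI[of _ "carrier (hom_module M)"])
    fix s assume s: "s \<in> carrier (hom_module M)"
    then obtain h where "h \<in> hom_set M" "s = enc M h" by (auto simp: hom_module_simps)
    thus "hom_map M N (\<lambda>x\<in>carrier M. f x \<oplus>\<^bsub>N\<^esub> g x) s =
        (\<lambda>s\<in>carrier (hom_module M). hom_map M N f s \<oplus>\<^bsub>hom_module N\<^esub> hom_map M N g s) s"
      using s MN by (auto simp: hom_map_enc hom_set_comp hom_setD(2) dec_enc hom_module_simps
          intro!: arg_cong[where f = "enc N"] restrict_ext)
  qed (auto simp: hom_map_def)
next
  fix M N :: "('b, 'u) module" and g c
  assume MN: "left_module B M" "left_module B N" "g \<in> module_hom B M N"
  show "hom_map M N (\<lambda>x\<in>carrier M. (c \<odot>\<^bsub>B\<^esub> \<one>\<^bsub>B\<^esub>) \<odot>\<^bsub>N\<^esub> g x) =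
      (\<lambda>s\<in>carrier (hom_module M). (c \<odot> \<one>) \<odot>\<^bsub>hom_module N\<^esub> hom_map M N g s)"
  proof (rule extensionalityI[of _ "carrier (hom_module M)"])
    fix s assume s: "s \<in> carrier (hom_module M)"
    then obtain f where f: "f \<in> hom_set M" "s = enc M f" by (auto simp: hom_module_simps)
    have "g (f (x \<otimes> (c \<odot> \<one>))) = (c \<odot>\<^bsub>B\<^esub> \<one>\<^bsub>B\<^esub>) \<odot>\<^bsub>N\<^esub> g (f x)" if x: "x \<in> eA" for x
    proof -
      \<comment> \<open>Multiplying an element of \<open>eA\<close> by a scalar from the right is
        the same as multiplying by the image \<open>c e\<close> of \<open>c 1\<close> from the left,
        because \<open>e\<close> absorbs into \<open>x\<close>.\<close>
      have "x \<otimes> (c \<odot> \<one>) = \<iota> (c \<odot>\<^bsub>B\<^esub> \<one>\<^bsub>B\<^esub>) \<otimes> x"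
        using eA_closed[OF x] eA_absorb[OF x] e_closed
        by (simp add: \<iota>_smult \<iota>_one A.smult_mult_left A.smult_mult_right)
      thus ?thesis
        using f(1) x module_homD(4)[OF MN(3)] by (simp add: hom_setD B.smult_closed)
    qed
    moreover have "f x \<in> carrier M" if "x \<in> eA" for x using f(1) that by (rule hom_setD(2))
    ultimately show "hom_map M N (\<lambda>x\<in>carrier M. (c \<odot>\<^bsub>B\<^esub> \<one>\<^bsub>B\<^esub>) \<odot>\<^bsub>N\<^esub> g x) s =
        (\<lambda>s\<in>carrier (hom_module M). (c \<odot> \<one>) \<odot>\<^bsub>hom_module N\<^esub> hom_map M N g s) s"
      using s f MN by (auto simp: hom_map_enc hom_set_comp dec_enc hom_module_simps eA_mult
          A.smult_closed intro!: arg_cong[where f = "enc N"] restrict_ext)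
  qed (auto simp: hom_map_def)
qed

definition unit_map :: "('a, 'u) module \<Rightarrow> 'u \<Rightarrow> 'u" where
  "unit_map M = (\<lambda>x\<in>carrier M. enc (corner_module M) (\<lambda>y\<in>eA. y \<odot>\<^bsub>M\<^esub> x))"

text \<open>The homomorphisms fixed by \<open>e\<close> are those with \<open>f (x e) = f x\<close>.
  They factor through the corner, a copy of \<open>B\<close>, hence are determined by their value at
  \<open>e\<close>.\<close>

definition counit_map :: "('b, 'u) module \<Rightarrow> 'u \<Rightarrow> 'u" where
  "counit_map N = (\<lambda>s\<in>carrier (corner_module (hom_module N)). dec N s e)"

lemma hom_set_unit:
  assumes "left_module A M" "x \<in> carrier M"
  shows "(\<lambda>y\<in>eA. y \<odot>\<^bsub>M\<^esub> x) \<in> hom_set (corner_module M)"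
proof -
  interpret M: left_module A M by fact
  show ?thesis
    unfolding hom_set_def mem_Collect_eq
    using assms(2) e_closed eA_absorb
    by (auto simp: eA_add \<iota>_mult_eA corner_module_simps M.act_closed eA_closed M.act_add_left
        M.act_mult \<iota>_closed M.act_mult[of e, symmetric])
qed

text \<open>Bijectivity is fullness: with 1 a sum of products \<open>p e q\<close>, an element
  \<open>x\<close> is the sum of the \<open>p ((e q) x)\<close>, and a homomorphism \<open>f\<close>
  on \<open>eA\<close> is evaluation at the sum of the \<open>p (f (e q))\<close>.\<close>

lemma natural_iso_unit:
  "natural_iso A A (\<lambda>M. M) (\<lambda>M N f. f) (\<lambda>M. hom_module (corner_module M))
     (\<lambda>M N f. hom_map (corner_module M) (corner_module N) (corner_map M N f))
     (unit_map :: ('a, 'u) module \<Rightarrow> 'u \<Rightarrow> 'u)"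
  unfolding natural_iso_def
proof (intro conjI allI impI ballI)
  fix M :: "('a, 'u) module" assume M: "left_module A M"
  interpret M: left_module A M by fact
  note CM = left_module_corner_module[OF M]
  note [simp] = hom_set_unit[OF M] dec_enc[OF CM]
  show "unit_map M \<in> module_hom A M (hom_module (corner_module M))"
    by (rule module_homI)
      (auto simp: unit_map_def hom_module_simps M.act_closed corner_module_simps M.act_add_right
        eA_closed eA_mult M.act_mult intro!: arg_cong[where f = "enc (corner_module M)"] restrict_ext)
  show "bij_betw (unit_map M) (carrier M) (carrier (hom_module (corner_module M)))"
    unfolding bij_betw_def
  proof
    show "inj_on (unit_map M) (carrier M)"
    proof (rule inj_onI)
      fix x x' assume x: "x \<in> carrier M" "x' \<in> carrier M" and "unit_map M x = unit_map M x'"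
      hence "(\<lambda>y\<in>eA. y \<odot>\<^bsub>M\<^esub> x) = (\<lambda>y\<in>eA. y \<odot>\<^bsub>M\<^esub> x')"
        using inj_onD[OF inj_on_enc[OF CM]] hom_set_unit[OF M] by (simp add: unit_map_def)
      hence eq: "y \<odot>\<^bsub>M\<^esub> x = y \<odot>\<^bsub>M\<^esub> x'" if "y \<in> eA" for y
        using that by (metis restrict_apply')
      have "\<one> \<odot>\<^bsub>M\<^esub> x = \<one> \<odot>\<^bsub>M\<^esub> x'"
      proof (induction rule: base_induct)
        case (gen p q)
        have q: "q \<in> carrier A" using gen base(2) by blast
        have "p \<odot>\<^bsub>M\<^esub> ((e \<otimes> q) \<odot>\<^bsub>M\<^esub> x) = p \<odot>\<^bsub>M\<^esub> ((e \<otimes> q) \<odot>\<^bsub>M\<^esub> x')"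
          using eq[OF e_mult_eA[OF q]] by simp
        thus ?case using x gen q e_closed by (simp add: M.act_mult[symmetric] A.m_assoc)
      next
        case (add a b)
        thus ?case using x by (simp add: M.act_add_left)
      qed
      thus "x = x'" using x by (simp add: M.act_one)
    qed
    show "unit_map M ` carrier M = carrier (hom_module (corner_module M))"
    proof
      show "unit_map M ` carrier M \<subseteq> carrier (hom_module (corner_module M))"
        by (auto simp: unit_map_def hom_module_simps)
      show "carrier (hom_module (corner_module M)) \<subseteq> unit_map M ` carrier M"
      proof
        fix s assume "s \<in> carrier (hom_module (corner_module M))"
        then obtain f where f: "f \<in> hom_set (corner_module M)" "s = enc (corner_module M) f"
          by (auto simp: hom_module_simps)
        have fM: "f y \<in> carrier M" "e \<odot>\<^bsub>M\<^esub> f y = f y" if "y \<in> eA" for y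
          using hom_setD(2)[OF f(1) that] by (simp_all add: corner_module_simps)
        have "\<exists>x\<in>carrier M. \<forall>y\<in>eA. f (y \<otimes> \<one>) = y \<odot>\<^bsub>M\<^esub> x"
        proof (induction rule: base_induct)
          case (gen p q)
          have q: "q \<in> carrier A" using gen base(2) by blast
          show ?case
          proof (intro bexI[of _ "p \<odot>\<^bsub>M\<^esub> f (e \<otimes> q)"] ballI)
            fix y assume y: "y \<in> eA"
            have "f (y \<otimes> (p \<otimes> e \<otimes> q)) = (y \<otimes> p \<otimes> e) \<odot>\<^bsub>M\<^esub> f (e \<otimes> q)"
              using hom_set_generated[OF f(1) y gen(1) q] y gen
              by (simp add: corner_module_simps \<iota>_\<kappa>_eA)
            also have "\<dots> = y \<odot>\<^bsub>M\<^esub> (p \<odot>\<^bsub>M\<^esub> f (e \<otimes> q))"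
              using y gen e_closed fM[OF e_mult_eA[OF q]] eA_closed[OF y]
              by (simp add: M.act_mult M.act_closed)
            finally show "f (y \<otimes> (p \<otimes> e \<otimes> q)) = y \<odot>\<^bsub>M\<^esub> (p \<odot>\<^bsub>M\<^esub> f (e \<otimes> q))" .
          qed (use gen fM[OF e_mult_eA[OF q]] in \<open>simp add: M.act_closed\<close>)
        next
          case (add a b)
          then obtain x x' where x: "x \<in> carrier M" "\<forall>y\<in>eA. f (y \<otimes> a) = y \<odot>\<^bsub>M\<^esub> x"
            "x' \<in> carrier M" "\<forall>y\<in>eA. f (y \<otimes> b) = y \<odot>\<^bsub>M\<^esub> x'" by blast
          show ?case
          proof (intro bexI[of _ "x \<oplus>\<^bsub>M\<^esub> x'"] ballI)
            fix y assume y: "y \<in> eA"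
            have "f (y \<otimes> (a \<oplus> b)) = f (y \<otimes> a) \<oplus>\<^bsub>M\<^esub> f (y \<otimes> b)"
              using hom_setD(3)[OF f(1) eA_mult[OF y add(1)] eA_mult[OF y add(2)]] eA_closed[OF y] add
              by (simp add: A.r_distr corner_module_simps)
            thus "f (y \<otimes> (a \<oplus> b)) = y \<odot>\<^bsub>M\<^esub> (x \<oplus>\<^bsub>M\<^esub> x')"
              using x y eA_closed[OF y] by (simp add: M.act_add_right)
          qed (use x in simp)
        qed
        then obtain x where x: "x \<in> carrier M" "\<forall>y\<in>eA. f (y \<otimes> \<one>) = y \<odot>\<^bsub>M\<^esub> x" by blast
        hence "f = (\<lambda>y\<in>eA. y \<odot>\<^bsub>M\<^esub> x)"
          using eA_closed by (intro extensionalityI[OF hom_set_extensional[OF f(1)]]) auto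
        thus "s \<in> unit_map M ` carrier M" using x(1) f(2) by (auto simp: unit_map_def)
      qed
    qed
  qed
next
  fix M N :: "('a, 'u) module" and f
  assume MN: "left_module A M" "left_module A N" and f: "f \<in> module_hom A M N"
  interpret M: left_module A M by fact
  note f' = module_homD[OF f]
  note CM = left_module_corner_module[OF MN(1)]
  show "compose (carrier M) (unit_map N) f =
    compose (carrier M) (hom_map (corner_module M) (corner_module N) (corner_map M N f)) (unit_map M)"
  proof (rule extensionalityI[of _ "carrier M"])
    fix x assume x: "x \<in> carrier M"
    have "corner_map M N f (y \<odot>\<^bsub>M\<^esub> x) = y \<odot>\<^bsub>N\<^esub> f x" if y: "y \<in> eA" for y
      using x f'(4)[OF eA_closed[OF y] x] M.act_mult[OF e_closed eA_closed[OF y] x] eA_absorb[OF y]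
        M.act_closed[OF eA_closed[OF y] x]
      by (simp add: corner_map_def corner_module_simps)
    thus "compose (carrier M) (unit_map N) f x =
      compose (carrier M) (hom_map (corner_module M) (corner_module N) (corner_map M N f)) (unit_map M) x"
      using x f'(1) by (auto simp: compose_eq unit_map_def hom_map_enc[OF CM] hom_set_unit[OF MN(1)]
          intro!: arg_cong[where f = "enc (corner_module N)"] restrict_ext)
  qed auto
qed

lemma \<kappa>_add: "a \<in> carrier A \<Longrightarrow> b \<in> carrier A \<Longrightarrow> \<kappa> (a \<oplus> b) = \<kappa> a \<oplus>\<^bsub>B\<^esub> \<kappa> b"
  using e_closed by (intro \<kappa>_eqI) (simp_all add: \<kappa>_closed \<iota>_add \<iota>_\<kappa> A.l_distr A.r_distr)

lemma \<kappa>_\<iota>_mult: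
  assumes "b \<in> carrier B" "a \<in> carrier A"
  shows "\<kappa> (\<iota> b \<otimes> a) = b \<otimes>\<^bsub>B\<^esub> \<kappa> a"
proof (rule \<kappa>_eqI)
  have "\<iota> b \<otimes> (e \<otimes> a \<otimes> e) = (\<iota> b \<otimes> e) \<otimes> (a \<otimes> e)"
    using assms e_closed \<iota>_closed by (simp add: A.m_assoc)
  also have "\<dots> = e \<otimes> (\<iota> b \<otimes> a) \<otimes> e"
    using assms e_closed \<iota>_closed by (simp add: \<iota>_e e_\<iota> A.m_assoc[symmetric])
  finally show "e \<otimes> (\<iota> b \<otimes> a) \<otimes> e = \<iota> (b \<otimes>\<^bsub>B\<^esub> \<kappa> a)"
    using assms by (simp add: \<kappa>_closed \<iota>_mult \<iota>_\<kappa>)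
qed (use assms \<iota>_closed \<kappa>_closed in auto)

lemma \<kappa>_e: "\<kappa> e = \<one>\<^bsub>B\<^esub>"
  using e_closed by (intro \<kappa>_eqI) (simp_all add: e_idem \<iota>_one)

lemma hom_set_counit:
  assumes "left_module B N" "n \<in> carrier N"
  shows "(\<lambda>x\<in>eA. \<kappa> x \<odot>\<^bsub>N\<^esub> n) \<in> hom_set N"
proof -
  interpret N: left_module B N by fact
  show ?thesis
    unfolding hom_set_def mem_Collect_eq
    using assms(2) by (auto simp: eA_add \<iota>_mult_eA N.act_closed \<kappa>_closed eA_closed \<kappa>_add N.act_add_left
        \<kappa>_\<iota>_mult N.act_mult)
qed

lemma corner_hom_moduleE:
  assumes "left_module B N" "s \<in> carrier (corner_module (hom_module N))"
  obtains f where "f \<in> hom_set N" "s = enc N f" "\<And>x. x \<in> eA \<Longrightarrow> f (x \<otimes> e) = f x"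
proof -
  obtain f where f: "f \<in> hom_set N" "s = enc N f" "e \<odot>\<^bsub>hom_module N\<^esub> s = s"
    using assms(2) by (auto simp: corner_module_simps hom_module_simps)
  hence "(\<lambda>x\<in>eA. f (x \<otimes> e)) = f"
    using inj_onD[OF inj_on_enc[OF assms(1)]] hom_set_act[OF f(1) e_closed]
    by (simp add: hom_module_simps dec_enc[OF assms(1)])
  hence "f (x \<otimes> e) = f x" if "x \<in> eA" for x
    using that by (metis restrict_apply')
  thus ?thesis using that f by blast
qed

lemma counit_map_enc:
  assumes "left_module B N" "f \<in> hom_set N" "\<And>x. x \<in> eA \<Longrightarrow> f (x \<otimes> e) = f x"
  shows "enc N f \<in> carrier (corner_module (hom_module N))" "counit_map N (enc N f) = f e"
proof -
  have "(\<lambda>x\<in>eA. f (x \<otimes> e)) = f"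
    using assms by (intro extensionalityI[OF _ hom_set_extensional]) auto
  thus "enc N f \<in> carrier (corner_module (hom_module N))"
    using assms by (simp add: corner_module_simps hom_module_simps dec_enc)
  thus "counit_map N (enc N f) = f e"
    using assms by (simp add: counit_map_def dec_enc)
qed

text \<open>If \<open>f\<close> is fixed by \<open>e\<close>, then
  \<open>f x = f (x e) = \<kappa> x (f e)\<close>, since \<open>\<iota> (\<kappa> x) = x e\<close>.
  So \<open>n\<close> comes from the homomorphism sending \<open>x\<close> to
  \<open>\<kappa> x n\<close> and from no other.\<close>

lemma natural_iso_counit:
  "natural_iso B B (\<lambda>N. corner_module (hom_module N))
     (\<lambda>M N f. corner_map (hom_module M) (hom_module N) (hom_map M N f))
     (\<lambda>N. N) (\<lambda>M N f. f) (counit_map :: ('b, 'u) module \<Rightarrow> 'u \<Rightarrow> 'u)"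
  unfolding natural_iso_def
proof (intro conjI allI impI ballI)
  fix N :: "('b, 'u) module" assume N: "left_module B N"
  interpret N: left_module B N by fact
  let ?C = "corner_module (hom_module N)"
  note C = corner_hom_moduleE[OF N] and cm = counit_map_enc[OF N]
  interpret C: left_module B ?C
    by (intro left_module_corner_module left_module_hom_module N)
  show hom: "counit_map N \<in> module_hom B ?C N"
  proof (rule module_homI)
    show "counit_map N \<in> extensional (carrier ?C)" by (simp add: counit_map_def)
  next
    show "counit_map N s \<in> carrier N" if "s \<in> carrier ?C" for s
      by (rule C[OF that]) (simp add: cm(2) hom_setD(2)[OF _ e_eA])
  next
    fix s t assume st: "s \<in> carrier ?C" "t \<in> carrier ?C"
    obtain f where f: "f \<in> hom_set N" "s = enc N f" "\<And>x. x \<in> eA \<Longrightarrow> f (x \<otimes> e) = f x"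
      by (rule C[OF st(1)]) auto
    obtain g where g: "g \<in> hom_set N" "t = enc N g" "\<And>x. x \<in> eA \<Longrightarrow> g (x \<otimes> e) = g x"
      by (rule C[OF st(2)]) auto
    have "counit_map N (enc N (\<lambda>x\<in>eA. f x \<oplus>\<^bsub>N\<^esub> g x)) = f e \<oplus>\<^bsub>N\<^esub> g e"
      by (subst cm) (use f g e_eA e_closed in \<open>auto simp: hom_set_add[OF N] eA_mult\<close>)
    thus "counit_map N (s \<oplus>\<^bsub>?C\<^esub> t) = counit_map N s \<oplus>\<^bsub>N\<^esub> counit_map N t"
      using f g by (simp add: corner_module_simps hom_module_simps dec_enc[OF N] cm)
  next
    fix b s assume b: "b \<in> carrier B" and s: "s \<in> carrier ?C"
    obtain f where f: "f \<in> hom_set N" "s = enc N f" "\<And>x. x \<in> eA \<Longrightarrow> f (x \<otimes> e) = f x"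
      by (rule C[OF s]) auto
    have "counit_map N (b \<odot>\<^bsub>?C\<^esub> s) = dec N (b \<odot>\<^bsub>?C\<^esub> s) e"
      using C.act_closed[OF b s] by (simp add: counit_map_def)
    also have "\<dots> = f (e \<otimes> \<iota> b)"
      using f b e_eA hom_set_act[OF f(1) \<iota>_closed[OF b]]
      by (simp add: corner_module_simps hom_module_simps dec_enc[OF N])
    also have "\<dots> = b \<odot>\<^bsub>N\<^esub> f e"
      using hom_setD(4)[OF f(1) b e_eA] b by (simp add: e_\<iota> \<iota>_e)
    finally show "counit_map N (b \<odot>\<^bsub>?C\<^esub> s) = b \<odot>\<^bsub>N\<^esub> counit_map N s"
      using f by (simp add: cm)
  qed
  show "bij_betw (counit_map N) (carrier ?C) (carrier N)"
    unfolding bij_betw_def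
  proof
    show "inj_on (counit_map N) (carrier ?C)"
    proof (rule inj_onI)
      fix s t assume st: "s \<in> carrier ?C" "t \<in> carrier ?C" and eq: "counit_map N s = counit_map N t"
      obtain f where f: "f \<in> hom_set N" "s = enc N f" "\<And>x. x \<in> eA \<Longrightarrow> f (x \<otimes> e) = f x"
        by (rule C[OF st(1)]) auto
      obtain g where g: "g \<in> hom_set N" "t = enc N g" "\<And>x. x \<in> eA \<Longrightarrow> g (x \<otimes> e) = g x"
        by (rule C[OF st(2)]) auto
      have *: "h x = \<kappa> x \<odot>\<^bsub>N\<^esub> h e"
        if "h \<in> hom_set N" "\<And>x. x \<in> eA \<Longrightarrow> h (x \<otimes> e) = h x" "x \<in> eA" for h x
      proof -
        have "\<iota> (\<kappa> x) \<otimes> e = x \<otimes> e"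
          using that(3) e_closed eA_closed[OF that(3)] eA_absorb[OF that(3)]
          by (simp add: \<iota>_\<kappa> A.m_assoc e_idem)
        thus ?thesis using hom_setD(4)[OF that(1) \<kappa>_closed[OF eA_closed[OF that(3)]] e_eA] that(2,3)
          by metis
      qed
      have "f e = g e" using eq f g by (simp add: cm)
      hence "f = g" using *[OF f(1) f(3)] *[OF g(1) g(3)] f g
        by (intro extensionalityI[OF hom_set_extensional hom_set_extensional]) auto
      thus "s = t" using f g by simp
    qed
    show "counit_map N ` carrier ?C = carrier N"
    proof
      show "counit_map N ` carrier ?C \<subseteq> carrier N"
        using module_homD(1)[OF hom] by blast
      show "carrier N \<subseteq> counit_map N ` carrier ?C"
      proof
        fix n assume n: "n \<in> carrier N"
        have "(\<lambda>x\<in>eA. \<kappa> x \<odot>\<^bsub>N\<^esub> n) (x \<otimes> e) = (\<lambda>x\<in>eA. \<kappa> x \<odot>\<^bsub>N\<^esub> n) x" if "x \<in> eA" for x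
        proof -
          have "\<kappa> (x \<otimes> e) = \<kappa> x"
            using e_closed eA_closed[OF that] by (simp add: \<kappa>_def A.m_assoc e_idem)
          thus ?thesis using that e_closed by (simp add: eA_mult)
        qed
        note * = cm[OF hom_set_counit[OF N n] this]
        moreover have "(\<lambda>x\<in>eA. \<kappa> x \<odot>\<^bsub>N\<^esub> n) e = n" using n e_eA by (simp add: \<kappa>_e N.act_one)
        ultimately show "n \<in> counit_map N ` carrier ?C" by (metis imageI)
      qed
    qed
  qed
next
  fix M N :: "('b, 'u) module" and g
  assume MN: "left_module B M" "left_module B N" and g: "g \<in> module_hom B M N"
  let ?C = "\<lambda>M. corner_module (hom_module M)"
  show "compose (carrier (?C M)) (counit_map N) (corner_map (hom_module M) (hom_module N) (hom_map M N g)) =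
    compose (carrier (?C M)) g (counit_map M)"
  proof (rule extensionalityI[of _ "carrier (?C M)"])
    fix s assume s: "s \<in> carrier (?C M)"
    obtain f where f: "f \<in> hom_set M" "s = enc M f" "\<And>x. x \<in> eA \<Longrightarrow> f (x \<otimes> e) = f x"
      by (rule corner_hom_moduleE[OF MN(1) s]) auto
    have "counit_map N (enc N (\<lambda>x\<in>eA. g (f x))) = g (f e)"
      by (subst counit_map_enc[OF MN(2)])
        (use f e_eA e_closed hom_set_comp[OF f(1) g] in \<open>auto simp: eA_mult\<close>)
    thus "compose (carrier (?C M)) (counit_map N)
        (corner_map (hom_module M) (hom_module N) (hom_map M N g)) s =
      compose (carrier (?C M)) g (counit_map M) s"
      using s f by (simp add: compose_eq corner_map_def hom_map_enc[OF MN(1)] counit_map_enc[OF MN(1)])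
  qed auto
qed

theorem morita_equivalent: "morita_equivalent TYPE('u) A B"
  unfolding morita_equivalent_def
  using A.assoc_algebra_axioms B.assoc_algebra_axioms linear_functor_corner linear_functor_hom
    natural_iso_unit natural_iso_counit
  by (intro conjI exI[of _ corner_module] exI[of _ corner_map] exI[of _ hom_module]
      exI[of _ hom_map] exI[of _ unit_map] exI[of _ counit_map]) auto

end

section \<open>Substitution in polynomials\<close>

text \<open>Characteristic zero is used for halving \<open>hbar\<close>, for the factorials in the
  projection, for averaging over permutations, and for the ground field to be infinite.\<close>

instance fract :: ("{idom, ring_char_0}") field_char_0
proof
  have "of_nat n = to_fract (of_nat n :: 'a)" for n
    by (induction n) simp_all
  thus "inj (of_nat :: nat \<Rightarrow> 'a fract)"
    by (simp add: inj_def)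
qed

lemma poly_mapping_eq_sum_single:
  fixes f :: "'a \<Rightarrow>\<^sub>0 'b::comm_monoid_add"
  shows "f = (\<Sum>m\<in>Poly_Mapping.keys f. Poly_Mapping.single m (Poly_Mapping.lookup f m))"
proof (rule poly_mapping_eqI)
  fix k
  have "(\<Sum>m\<in>Poly_Mapping.keys f. Poly_Mapping.lookup f m when m = k) =
      (if k \<in> Poly_Mapping.keys f then Poly_Mapping.lookup f k else 0)"
    by (simp add: when_def)
  thus "Poly_Mapping.lookup f k =
      Poly_Mapping.lookup (\<Sum>m\<in>Poly_Mapping.keys f. Poly_Mapping.single m (Poly_Mapping.lookup f m)) k"
    by (simp add: lookup_sum lookup_single in_keys_iff)
qed

lemma xpoly_single_induct [case_names single add]:
  fixes f :: "'q::linorder xpoly"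
  assumes s: "\<And>m c. Pr (Poly_Mapping.single m c)" and a: "\<And>f g. Pr f \<Longrightarrow> Pr g \<Longrightarrow> Pr (f + g)"
  shows "Pr f"
proof -
  have "Pr (\<Sum>m\<in>S. Poly_Mapping.single m (Poly_Mapping.lookup f m))" for S
    by (induction S rule: infinite_finite_induct) (use s[of 0 0] s a in auto)
  thus ?thesis using poly_mapping_eq_sum_single[of f] by metis
qed

lemma Const_add [simp]: "Const (a + b) = Const a + Const b"
  and Const_mult [simp]: "Const (a * b) = Const a * Const b"
  and Const_0 [simp]: "Const 0 = 0"
  and Const_1 [simp]: "Const 1 = 1"
  and Const_uminus [simp]: "Const (- a) = - Const a"
  and Const_diff [simp]: "Const (a - b) = Const a - Const b"
  by (simp_all add: Const_def single_add mult_single single_uminus single_diff)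

lemma Const_power [simp]: "Const (a ^ n) = Const a ^ n"
  by (induction n) simp_all

lemma Const_of_nat [simp]: "Const (of_nat n) = of_nat n"
  by (induction n) simp_all

lemma Const_eq_0_iff [simp]: "Const a = 0 \<longleftrightarrow> a = 0"
  unfolding Const_def by (metis lookup_single_eq lookup_zero single_zero)

definition monom_subst :: "('q \<times> nat \<Rightarrow> 'q xpoly) \<Rightarrow> ('q \<times> nat \<Rightarrow>\<^sub>0 nat) \<Rightarrow> 'q::linorder xpoly" where
  "monom_subst \<sigma> m = (\<Prod>y\<in>Poly_Mapping.keys m. \<sigma> y ^ Poly_Mapping.lookup m y)"

lemma monom_subst_superset:
  assumes "finite S" "Poly_Mapping.keys m \<subseteq> S"
  shows "monom_subst \<sigma> m = (\<Prod>y\<in>S. \<sigma> y ^ Poly_Mapping.lookup m y)"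
  unfolding monom_subst_def
  by (rule prod.mono_neutral_left) (use assms in \<open>auto simp: in_keys_iff\<close>)

lemma monom_subst_add: "monom_subst \<sigma> (m + n) = monom_subst \<sigma> m * monom_subst \<sigma> n"
proof -
  let ?S = "Poly_Mapping.keys m \<union> Poly_Mapping.keys n"
  have "Poly_Mapping.keys (m + n) \<subseteq> ?S" by (rule keys_add)
  thus ?thesis
    by (simp add: monom_subst_superset[of ?S] lookup_add power_add prod.distrib)
qed

lemma poly_subst_superset:
  assumes "finite S" "Poly_Mapping.keys f \<subseteq> S"
  shows "poly_subst \<sigma> f = (\<Sum>m\<in>S. Const (Poly_Mapping.lookup f m) * monom_subst \<sigma> m)"
  unfolding poly_subst_def monom_subst_def
  by (rule sum.mono_neutral_left) (use assms in \<open>auto simp: in_keys_iff\<close>)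

lemma poly_subst_add [simp]: "poly_subst \<sigma> (f + g) = poly_subst \<sigma> f + poly_subst \<sigma> g"
proof -
  let ?S = "Poly_Mapping.keys f \<union> Poly_Mapping.keys g"
  have "Poly_Mapping.keys (f + g) \<subseteq> ?S" by (rule keys_add)
  thus ?thesis
    by (simp add: poly_subst_superset[of ?S] lookup_add sum.distrib distrib_right)
qed

lemma poly_subst_single: "poly_subst \<sigma> (Poly_Mapping.single m c) = Const c * monom_subst \<sigma> m"
  using keys_single[of m c] by (subst poly_subst_superset[of "{m}"]) auto

lemma poly_subst_Const [simp]: "poly_subst \<sigma> (Const c) = Const c"
  unfolding Const_def poly_subst_single by (simp add: monom_subst_def Const_def)

lemma poly_subst_Var [simp]: "poly_subst \<sigma> (Var y) = \<sigma> y"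
  unfolding Var_def poly_subst_single by (simp add: monom_subst_def)

lemma poly_subst_mult [simp]: "poly_subst \<sigma> (f * g) = poly_subst \<sigma> f * poly_subst \<sigma> g"
proof (induction f rule: xpoly_single_induct)
  case (single m c)
  show ?case
  proof (induction g rule: xpoly_single_induct)
    case (single n d)
    show ?case by (simp add: mult_single poly_subst_single monom_subst_add)
  qed (simp add: distrib_left)
qed (simp add: distrib_right)

lemma poly_subst_0 [simp]: "poly_subst \<sigma> 0 = 0"
  using poly_subst_Const[of \<sigma> 0] by simp

lemma poly_subst_1 [simp]: "poly_subst \<sigma> 1 = 1"
  using poly_subst_Const[of \<sigma> 1] by simp

lemma poly_subst_uminus [simp]: "poly_subst \<sigma> (- f) = - poly_subst \<sigma> f"
proof -
  have "poly_subst \<sigma> (Const (- 1) * f) = Const (- 1) * poly_subst \<sigma> f"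
    unfolding poly_subst_mult poly_subst_Const ..
  thus ?thesis by simp
qed

lemma poly_subst_diff [simp]: "poly_subst \<sigma> (f - g) = poly_subst \<sigma> f - poly_subst \<sigma> g"
  using poly_subst_add[of \<sigma> f "- g"] by simp

lemma poly_subst_sum [simp]: "poly_subst \<sigma> (sum f S) = (\<Sum>x\<in>S. poly_subst \<sigma> (f x))"
  by (induction S rule: infinite_finite_induct) simp_all

lemma poly_subst_prod [simp]: "poly_subst \<sigma> (prod f S) = (\<Prod>x\<in>S. poly_subst \<sigma> (f x))"
  by (induction S rule: infinite_finite_induct) simp_all

lemma poly_subst_power [simp]: "poly_subst \<sigma> (f ^ n) = poly_subst \<sigma> f ^ n"
  by (induction n) simp_all

lemma poly_subst_of_nat [simp]: "poly_subst \<sigma> (of_nat n) = of_nat n"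
  by (induction n) simp_all

lemma Var_power: "Var y ^ n = Poly_Mapping.single (Poly_Mapping.single y n) 1"
  by (induction n) (simp_all add: Var_def mult_single single_add[symmetric])

lemma prod_single_one:
  "(\<Prod>y\<in>S. Poly_Mapping.single (g y) 1) = (Poly_Mapping.single (sum g S) 1 :: 'q::linorder xpoly)"
  by (induction S rule: infinite_finite_induct) (simp_all add: mult_single)

lemma single_eq_Const_Var: "Poly_Mapping.single m c = Const c * monom_subst Var m"
proof -
  have "monom_subst Var m = (\<Prod>y\<in>Poly_Mapping.keys m.
      Poly_Mapping.single (Poly_Mapping.single y (Poly_Mapping.lookup m y)) 1)"
    by (simp add: monom_subst_def Var_power)
  also have "\<dots> = Poly_Mapping.single m 1"
    by (simp add: prod_single_one poly_mapping_eq_sum_single[symmetric])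
  finally show ?thesis by (simp add: Const_def mult_single)
qed

lemma xpoly_induct [case_names Const Var add mult]:
  fixes f :: "'q::linorder xpoly"
  assumes c: "\<And>c. Pr (Const c)" and v: "\<And>y. Pr (Var y)"
    and a: "\<And>f g. Pr f \<Longrightarrow> Pr g \<Longrightarrow> Pr (f + g)" and m: "\<And>f g. Pr f \<Longrightarrow> Pr g \<Longrightarrow> Pr (f * g)"
  shows "Pr f"
proof (induction f rule: xpoly_single_induct)
  case (single n d)
  have o: "Pr 1" using c[of 1] by simp
  have "Pr (Var y ^ k)" for y k by (induction k) (use o v m in auto)
  hence "Pr (\<Prod>y\<in>S. Var y ^ Poly_Mapping.lookup n y)" for S
    by (induction S rule: infinite_finite_induct) (use o m in auto)
  hence "Pr (monom_subst Var n)"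
    unfolding monom_subst_def .
  thus ?case unfolding single_eq_Const_Var by (intro m c)
qed (rule a)

lemma poly_subst_poly_subst:
  "poly_subst \<sigma> (poly_subst \<rho> f) = poly_subst (\<lambda>y. poly_subst \<sigma> (\<rho> y)) f"
  by (induction f rule: xpoly_induct) simp_all

lemma poly_subst_ident [simp]: "poly_subst Var f = f"
  by (induction f rule: xpoly_induct) simp_all

section \<open>Polynomials in a prescribed set of variables\<close>

definition poly_in :: "('q \<times> nat) set \<Rightarrow> 'q::linorder xpoly set" where
  "poly_in X = {f. \<forall>m\<in>Poly_Mapping.keys f. Poly_Mapping.keys m \<subseteq> X}"

lemma poly_subst_cong:
  assumes "f \<in> poly_in X" "\<And>y. y \<in> X \<Longrightarrow> \<sigma> y = \<rho> y"
  shows "poly_subst \<sigma> f = poly_subst \<rho> f"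
  unfolding poly_subst_def
  using assms
  by (intro sum.cong refl arg_cong2[where f = "(*)"] prod.cong arg_cong2[where f = "(^)"])
    (auto simp: poly_in_def subset_iff)

lemma poly_in_add [intro, simp]: "f \<in> poly_in X \<Longrightarrow> g \<in> poly_in X \<Longrightarrow> f + g \<in> poly_in X"
  using keys_add[of f g] by (auto simp: poly_in_def)

lemma poly_in_mult [intro, simp]:
  assumes "f \<in> poly_in X" "g \<in> poly_in X" shows "f * g \<in> poly_in X"
proof -
  have "Poly_Mapping.keys m \<subseteq> X" if m: "m \<in> Poly_Mapping.keys (f * g)" for m
  proof -
    obtain a b where "m = a + b" "a \<in> Poly_Mapping.keys f" "b \<in> Poly_Mapping.keys g"
      using m keys_mult[of f g] by auto
    thus ?thesis using assms keys_add[of a b] unfolding poly_in_def by blast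
  qed
  thus ?thesis by (simp add: poly_in_def)
qed

lemma poly_in_Const [intro, simp]: "Const c \<in> poly_in X"
  by (simp add: poly_in_def Const_def)

lemma poly_in_Var [intro, simp]: "y \<in> X \<Longrightarrow> Var y \<in> poly_in X"
  by (simp add: poly_in_def Var_def)

lemma poly_in_0 [intro, simp]: "0 \<in> poly_in X"
  and poly_in_1 [intro, simp]: "1 \<in> poly_in X"
  using poly_in_Const[of 0] poly_in_Const[of 1] by simp_all

lemma poly_in_uminus [intro, simp]: "f \<in> poly_in X \<Longrightarrow> - f \<in> poly_in X"
  using poly_in_mult[OF poly_in_Const[of "- 1"], of f X] by simp

lemma poly_in_diff [intro, simp]: "f \<in> poly_in X \<Longrightarrow> g \<in> poly_in X \<Longrightarrow> f - g \<in> poly_in X"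
  using poly_in_add[of f X "- g"] by simp

lemma poly_in_sum [intro]: "(\<And>x. x \<in> S \<Longrightarrow> f x \<in> poly_in X) \<Longrightarrow> sum f S \<in> poly_in X"
  by (induction S rule: infinite_finite_induct) simp_all

lemma poly_in_prod [intro]: "(\<And>x. x \<in> S \<Longrightarrow> f x \<in> poly_in X) \<Longrightarrow> prod f S \<in> poly_in X"
  by (induction S rule: infinite_finite_induct) simp_all

lemma poly_in_power [intro, simp]: "f \<in> poly_in X \<Longrightarrow> f ^ n \<in> poly_in X"
  by (induction n) simp_all

lemma poly_in_poly_subst:
  assumes "f \<in> poly_in X" "\<And>y. y \<in> X \<Longrightarrow> \<sigma> y \<in> poly_in Y"
  shows "poly_subst \<sigma> f \<in> poly_in Y"
  unfolding poly_subst_def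
proof (intro poly_in_sum poly_in_mult poly_in_prod poly_in_power poly_in_Const assms(2))
  fix m y assume "m \<in> Poly_Mapping.keys f" "y \<in> Poly_Mapping.keys m"
  thus "y \<in> X" using assms(1) unfolding poly_in_def by blast
qed

text \<open>Membership becomes a fixed point equation for a ring endomorphism, a form in which
  common factors can be cancelled.\<close>

lemma poly_in_iff_subst: "f \<in> poly_in X \<longleftrightarrow> poly_subst (\<lambda>y. if y \<in> X then Var y else 0) f = f"
proof
  assume "f \<in> poly_in X"
  from poly_subst_cong[OF this, of "\<lambda>y. if y \<in> X then Var y else 0" Var]
  show "poly_subst (\<lambda>y. if y \<in> X then Var y else 0) f = f"
    by simp
next
  have "f \<in> poly_in UNIV" by (simp add: poly_in_def)
  hence "poly_subst (\<lambda>y. if y \<in> X then Var y else 0) f \<in> poly_in X"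
    by (rule poly_in_poly_subst) auto
  moreover assume "poly_subst (\<lambda>y. if y \<in> X then Var y else 0) f = f"
  ultimately show "f \<in> poly_in X" by simp
qed

text \<open>Setting the variables outside \<open>X\<close> to zero fixes \<open>h\<close> and
  \<open>h * f\<close>, hence also \<open>f\<close>, because the polynomial ring is a domain. Exact
  quotients thus involve no new variables.\<close>

lemma poly_in_cancel:
  fixes f :: "'q::linorder xpoly"
  assumes "h * f \<in> poly_in X" "h \<in> poly_in X" "h \<noteq> 0"
  shows "f \<in> poly_in X"
proof -
  let ?\<rho> = "poly_subst (\<lambda>y. if y \<in> X then Var y else 0)"
  have "h * ?\<rho> f = h * f"
    using assms(1,2) unfolding poly_in_iff_subst by simp
  thus ?thesis using assms(3) by (simp add: poly_in_iff_subst)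
qed

section \<open>Transpositions of two variables\<close>

definition swap_vars :: "'q \<times> nat \<Rightarrow> 'q \<times> nat \<Rightarrow> 'q::linorder xpoly \<Rightarrow> 'q xpoly" where
  "swap_vars p q = poly_subst (\<lambda>y. Var (transpose p q y))"

lemma swap_vars_simps [simp]:
  "swap_vars p q (f + g) = swap_vars p q f + swap_vars p q g"
  "swap_vars p q (f - g) = swap_vars p q f - swap_vars p q g"
  "swap_vars p q (f * g) = swap_vars p q f * swap_vars p q g"
  "swap_vars p q (- f) = - swap_vars p q f"
  "swap_vars p q (Const c) = Const c"
  "swap_vars p q 0 = 0"
  "swap_vars p q 1 = 1"
  "swap_vars p q (of_nat n) = of_nat n"
  "swap_vars p q (Var y) = Var (transpose p q y)"
  "swap_vars p q (f ^ n) = swap_vars p q f ^ n"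
  "swap_vars p q (sum h S) = (\<Sum>x\<in>S. swap_vars p q (h x))"
  "swap_vars p q (prod h S) = (\<Prod>x\<in>S. swap_vars p q (h x))"
  by (simp_all add: swap_vars_def)

lemma swap_vars_swap_vars [simp]: "swap_vars p q (swap_vars p q f) = f"
  by (simp add: swap_vars_def poly_subst_poly_subst)

lemma poly_in_swap_vars [intro]:
  "f \<in> poly_in X \<Longrightarrow> p \<in> X \<Longrightarrow> q \<in> X \<Longrightarrow> swap_vars p q f \<in> poly_in X"
  unfolding swap_vars_def by (erule poly_in_poly_subst) (auto simp: transpose_def)

lemma Var_eq_iff [simp]: "Var y = Var z \<longleftrightarrow> y = z"
  unfolding Var_def by (metis inj_single[THEN injD] lookup_single_eq lookup_single_not_eq one_neq_zero)

text \<open>The twisted Leibniz rule \<open>f g - s(f g) = (f - s f) g + s f (g - s g)\<close>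
  reduces divisibility to single variables.\<close>

lemma Var_diff_dvd_diff_swap: "(Var p - Var q) dvd (f - swap_vars p q f)"
proof (induction f rule: xpoly_induct)
  case (Var y)
  have "(Var p - Var q) dvd (Var q - Var p)" by (metis dvd_refl dvd_minus_iff minus_diff_eq)
  thus ?case by (auto simp: transpose_def)
next
  case (add f g)
  have "f + g - swap_vars p q (f + g) = (f - swap_vars p q f) + (g - swap_vars p q g)" by simp
  thus ?case using add by (metis dvd_add)
next
  case (mult f g)
  have "f * g - swap_vars p q (f * g) =
      (f - swap_vars p q f) * g + swap_vars p q f * (g - swap_vars p q g)"
    by (simp add: algebra_simps)
  thus ?case using mult by (metis dvd_add dvd_mult dvd_mult2)
qed simp

text \<open>The Demazure operator \<open>(f - s f) / (x_p - x_q)\<close>, for any two variables and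
  not only adjacent ones: this is also needed for Newton interpolation and for the symmetric
  treatment of the braid relation.\<close>

definition ddiff :: "'q \<times> nat \<Rightarrow> 'q \<times> nat \<Rightarrow> 'q::linorder xpoly \<Rightarrow> 'q xpoly" where
  "ddiff p q f = (THE g. (Var p - Var q) * g = f - swap_vars p q f)"

lemma ddiff_mult:
  assumes "p \<noteq> q" shows "(Var p - Var q) * ddiff p q f = f - swap_vars p q f"
proof -
  obtain g where "f - swap_vars p q f = (Var p - Var q) * g"
    using Var_diff_dvd_diff_swap by (metis dvdE)
  hence "\<exists>!g. (Var p - Var q) * g = f - swap_vars p q f"
    using assms by (intro ex1I[of _ g]) (auto dest!: sym[of "_ * g"])
  thus ?thesis unfolding ddiff_def by (rule theI')
qed

lemma ddiff_eqI:
  "p \<noteq> q \<Longrightarrow> (Var p - Var q) * g = f - swap_vars p q f \<Longrightarrow> ddiff p q f = g"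
  using ddiff_mult[of p q f] by (metis Var_eq_iff mult_left_cancel right_minus_eq)

lemma poly_of_fract_to_fract [simp]: "poly_of_fract (to_fract f) = f"
  by (simp add: poly_of_fract_def)

section \<open>Divided differences\<close>

lemma swap_vars_commute: "swap_vars p q = swap_vars q p"
  by (simp add: swap_vars_def transpose_commute)

lemma swap_vars_comp:
  "swap_vars p q (swap_vars r t f) = poly_subst (\<lambda>y. Var (transpose p q (transpose r t y))) f"
  by (simp add: swap_vars_def poly_subst_poly_subst)

lemma ddiff_cancel:
  "p \<noteq> q \<Longrightarrow> (Var p - Var q) * f = (Var p - Var q) * g \<Longrightarrow> f = g"
  by simp

lemma ddiff_add: "p \<noteq> q \<Longrightarrow> ddiff p q (f + g) = ddiff p q f + ddiff p q g"
  by (rule ddiff_eqI) (simp_all add: distrib_left ddiff_mult)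

lemma ddiff_mult_invariant:
  "p \<noteq> q \<Longrightarrow> swap_vars p q h = h \<Longrightarrow> ddiff p q (h * f) = h * ddiff p q f"
  using ddiff_mult[of p q f] by (intro ddiff_eqI) (simp_all add: mult.left_commute right_diff_distrib)

lemma ddiff_invariant: "p \<noteq> q \<Longrightarrow> swap_vars p q f = f \<Longrightarrow> ddiff p q f = 0"
  by (rule ddiff_eqI) simp_all

lemma ddiff_eq_0_iff: "p \<noteq> q \<Longrightarrow> ddiff p q f = 0 \<longleftrightarrow> swap_vars p q f = f"
  using ddiff_mult[of p q f] ddiff_invariant[of p q f] by auto

lemma swap_vars_ddiff: "p \<noteq> q \<Longrightarrow> swap_vars p q (ddiff p q f) = ddiff p q f"
proof -
  assume pq: "p \<noteq> q"
  have "swap_vars p q ((Var p - Var q) * ddiff p q f) = swap_vars p q (f - swap_vars p q f)"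
    by (simp only: ddiff_mult[OF pq])
  hence "(Var q - Var p) * swap_vars p q (ddiff p q f) = swap_vars p q f - f"
    by simp
  hence "(Var p - Var q) * swap_vars p q (ddiff p q f) = (Var p - Var q) * ddiff p q f"
    unfolding ddiff_mult[OF pq] by (simp add: algebra_simps)
  thus ?thesis by (rule ddiff_cancel[OF pq])
qed

lemma ddiff_ddiff [simp]: "p \<noteq> q \<Longrightarrow> ddiff p q (ddiff p q f) = 0"
  by (simp add: ddiff_invariant swap_vars_ddiff)

lemma ddiff_flip: "p \<noteq> q \<Longrightarrow> ddiff q p f = - ddiff p q f"
  using ddiff_mult[of p q f] by (intro ddiff_eqI) (simp_all add: swap_vars_commute[of q p] algebra_simps)

text \<open>This is the nilHecke relation \<open>x_p D - D x_q = 1\<close>.\<close>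

lemma ddiff_Var_mult: "p \<noteq> q \<Longrightarrow> ddiff p q (Var q * f) = Var p * ddiff p q f - f"
proof (rule ddiff_eqI)
  assume pq: "p \<noteq> q"
  have "(Var p - Var q) * (Var p * ddiff p q f - f) =
      Var p * ((Var p - Var q) * ddiff p q f) - (Var p - Var q) * f" by (simp add: algebra_simps)
  also have "\<dots> = Var q * f - swap_vars p q (Var q * f)"
    unfolding ddiff_mult[OF pq] by (simp add: algebra_simps)
  finally show "(Var p - Var q) * (Var p * ddiff p q f - f) = Var q * f - swap_vars p q (Var q * f)" .
qed

lemma swap_vars_ddiff_disjoint:
  assumes "p \<noteq> q" "r \<noteq> t" "{p, q} \<inter> {r, t} = {}"
  shows "swap_vars r t (ddiff p q f) = ddiff p q (swap_vars r t f)"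
proof (rule sym, rule ddiff_eqI[OF assms(1)])
  have "swap_vars r t (swap_vars p q f) = swap_vars p q (swap_vars r t f)"
    unfolding swap_vars_comp
    by (intro arg_cong2[where f = poly_subst] refl ext arg_cong[where f = Var])
      (use assms in \<open>auto simp: transpose_def\<close>)
  moreover have "swap_vars r t (Var p - Var q) = Var p - Var q"
    using assms by (auto simp: transpose_def)
  ultimately show "(Var p - Var q) * swap_vars r t (ddiff p q f) =
      swap_vars r t f - swap_vars p q (swap_vars r t f)"
    using arg_cong[OF ddiff_mult[OF assms(1)], of "swap_vars r t" f] by simp
qed

lemma ddiff_commute:
  assumes "p \<noteq> q" "r \<noteq> t" "{p, q} \<inter> {r, t} = {}"
  shows "ddiff p q (ddiff r t f) = ddiff r t (ddiff p q f)"
proof (rule sym, rule ddiff_eqI[OF assms(2)])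
  have h: "swap_vars p q (Var r - Var t) = Var r - Var t"
    using assms by (auto simp: transpose_def)
  have "(Var r - Var t) * ddiff p q (ddiff r t f) = ddiff p q ((Var r - Var t) * ddiff r t f)"
    by (rule ddiff_mult_invariant[OF assms(1) h, symmetric])
  also have "\<dots> = ddiff p q (f + Const (- 1) * swap_vars r t f)"
    using assms(2) by (simp add: ddiff_mult)
  also have "\<dots> = ddiff p q f - ddiff p q (swap_vars r t f)"
    using assms(1) ddiff_mult_invariant[of p q "Const (- 1)" "swap_vars r t f"]
    by (simp add: ddiff_add[OF assms(1), of f "- swap_vars r t f", simplified])
  finally show "(Var r - Var t) * ddiff p q (ddiff r t f) =
      ddiff p q f - swap_vars r t (ddiff p q f)"
    by (simp add: swap_vars_ddiff_disjoint assms)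
qed

text \<open>After clearing denominators the threefold product is the alternating sum over the six
  elements of \<open>S_3\<close>. Only the expansion \<open>s(t(D f))\<close> needs care: swapping
  the variables of the two inner relations provides exactly the missing denominators.\<close>

lemma ddiff_triple:
  assumes "p \<noteq> q" "q \<noteq> r" "p \<noteq> r"
  shows "(Var p - Var q) * (Var q - Var r) * (Var p - Var r) * ddiff p q (ddiff q r (ddiff p q f)) =
    f - swap_vars p q f - swap_vars q r f + swap_vars q r (swap_vars p q f)
      + swap_vars p q (swap_vars q r f) - swap_vars p q (swap_vars q r (swap_vars p q f))"
proof -
  define a b c :: "'a xpoly" where abc: "a = Var p - Var q" "b = Var q - Var r" "c = Var p - Var r"
  define s t :: "'a xpoly \<Rightarrow> 'a xpoly" where st: "s = swap_vars p q" "t = swap_vars q r"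
  define g1 g2 g3 where g: "g1 = ddiff p q f" "g2 = ddiff q r g1" "g3 = ddiff p q g2"
  have E: "a * g1 = f - s f" "b * g2 = g1 - t g1" "a * g3 = g2 - s g2"
    unfolding abc st g using assms by (simp_all add: ddiff_mult)
  have S: "s b = c" "s c = b" "t a = c" "s g1 = g1"
    unfolding abc st g using assms by (simp_all add: swap_vars_ddiff transpose_def)
  have tE: "c * t g1 = t f - t (s f)"
    using arg_cong[OF E(1), of t] S by (simp add: st)
  have sE: "c * s g2 = g1 - s (t g1)"
    using arg_cong[OF E(2), of s] S by (simp add: st)
  have stE: "b * s (t g1) = s (t f) - s (t (s f))"
    using arg_cong[OF tE, of s] S by (simp add: st)
  have "a * b * c * g3 = b * c * (a * g3)" by (simp add: algebra_simps)
  also have "\<dots> = c * (b * g2) - b * (c * s g2)" unfolding E(3) by (simp add: algebra_simps)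
  also have "\<dots> = (c - b) * g1 - c * t g1 + b * s (t g1)"
    unfolding E(2) sE by (simp add: algebra_simps)
  also have "c - b = a" by (simp add: abc)
  finally show ?thesis
    unfolding E(1) tE stE unfolding abc st g by (simp add: algebra_simps)
qed

text \<open>The cleared form is used for \<open>p, q, r\<close> and for \<open>r, q, p\<close>; the
  alternating sum is the same. Reversing three divided differences and reversing three linear
  factors each contribute the sign -1, and the two signs cancel.\<close>

lemma ddiff_braid:
  assumes "p \<noteq> q" "q \<noteq> r" "p \<noteq> r"
  shows "ddiff p q (ddiff q r (ddiff p q f)) = ddiff q r (ddiff p q (ddiff q r f))"
proof -
  let ?h = "(Var p - Var q) * (Var q - Var r) * (Var p - Var r)"
  have n: "ddiff u w (- g) = - ddiff u w g" if "u \<noteq> w" for u w :: "'a \<times> nat" and g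
    using that ddiff_mult_invariant[of u w "Const (- 1)" g] by simp
  have "swap_vars q r (swap_vars p q (swap_vars q r f)) = swap_vars p q (swap_vars q r (swap_vars p q f))"
  proof -
    have "transpose q r (transpose p q (transpose q r y)) = transpose p q (transpose q r (transpose p q y))" for y
      using assms transpose_triple[of r p q y] transpose_triple[of p r q y] by (simp add: transpose_commute)
    thus ?thesis by (simp add: swap_vars_def poly_subst_poly_subst)
  qed
  hence "?h * ddiff p q (ddiff q r (ddiff p q f)) =
      - ((Var r - Var q) * (Var q - Var p) * (Var r - Var p)) * ddiff q r (ddiff p q (ddiff q r f))"
    using assms ddiff_triple[of r q p f] ddiff_triple[of p q r f]
    by (simp add: ddiff_flip[of q r] ddiff_flip[of p q] n swap_vars_commute[of r q] swap_vars_commute[of q p])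
  also have "- ((Var r - Var q) * (Var q - Var p) * (Var r - Var p)) = ?h"
    by (simp add: algebra_simps)
  finally show ?thesis using assms by simp
qed

section \<open>Words of divided differences and the longest element\<close>

definition dops :: "'q \<Rightarrow> nat list \<Rightarrow> 'q::linorder xpoly \<Rightarrow> 'q xpoly" where
  "dops i ks f = foldr (\<lambda>k. ddiff (i, k) (i, Suc k)) ks f"

lemma dops_simps [simp]:
  "dops i [] f = f"
  "dops i (k # ks) f = ddiff (i, k) (i, Suc k) (dops i ks f)"
  "dops i (ks @ ls) f = dops i ks (dops i ls f)"
  by (simp_all add: dops_def)

lemma dops_add: "dops i ks (f + g) = dops i ks f + dops i ks g"
  by (induction ks) (simp_all add: ddiff_add)

lemma dops_mult_invariant:
  "(\<And>k. k \<in> set ks \<Longrightarrow> swap_vars (i, k) (i, Suc k) h = h) \<Longrightarrow> dops i ks (h * f) = h * dops i ks f"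
  by (induction ks) (simp_all add: ddiff_mult_invariant)

lemma dops_Const: "dops i ks (Const c * f) = Const c * dops i ks f"
  by (rule dops_mult_invariant) simp

lemma dops_uminus: "dops i ks (- f) = - dops i ks f"
  using dops_Const[of i ks "- 1" f] by simp

lemma dops_diff: "dops i ks (f - g) = dops i ks f - dops i ks g"
  using dops_add[of i ks f "- g"] by (simp add: dops_uminus)

lemma dops_0 [simp]: "dops i ks 0 = 0"
  using dops_Const[of i ks 0 0] by simp

lemma dops_sum: "dops i ks (sum f S) = (\<Sum>x\<in>S. dops i ks (f x))"
  by (induction S rule: infinite_finite_induct) (simp_all add: dops_add)

lemma ddiff_dops_commute:
  assumes "\<And>k. k \<in> set ks \<Longrightarrow> {(j, l), (j, Suc l)} \<inter> {(i, k), (i, Suc k)} = {}"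
  shows "ddiff (j, l) (j, Suc l) (dops i ks f) = dops i ks (ddiff (j, l) (j, Suc l) f)"
  using assms by (induction ks) (simp_all add: ddiff_commute)

text \<open>A swap is expressed by the divided difference,
  \<open>s f = f - (x_l - x_(l+1)) D f\<close>, and both ingredients on the right commute with the
  word.\<close>

lemma swap_vars_dops_commute:
  assumes "\<And>k. k \<in> set ks \<Longrightarrow> {(j, l), (j, Suc l)} \<inter> {(i, k), (i, Suc k)} = {}"
  shows "swap_vars (j, l) (j, Suc l) (dops i ks f) = dops i ks (swap_vars (j, l) (j, Suc l) f)"
proof -
  have "(Var (j, l) - Var (j, Suc l)) * ddiff (j, l) (j, Suc l) (dops i ks f) =
    dops i ks ((Var (j, l) - Var (j, Suc l)) * ddiff (j, l) (j, Suc l) f)"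
    by (subst ddiff_dops_commute, use assms in blast, rule dops_mult_invariant[symmetric])
      (use assms in \<open>auto simp: transpose_def\<close>)
  thus ?thesis by (simp add: ddiff_mult dops_diff)
qed

abbreviation (input) down :: "nat \<Rightarrow> nat list" where "down m \<equiv> rev [Suc 0..<Suc m]"

text \<open>In the word \<open>m, ..., 1\<close> the letters below \<open>k\<close> commute with the
  index \<open>k + 1\<close>, the pair \<open>k + 1, k\<close> turns it into \<open>k\<close> by the
  braid relation, and the letters above commute with \<open>k\<close>.\<close>

lemma dops_down_shift:
  assumes "Suc 0 \<le> k" "k < m"
  shows "dops i (down m) (ddiff (i, Suc k) (i, Suc (Suc k)) f) =
    ddiff (i, k) (i, Suc k) (dops i (down m) f)"
  using assms(2)
proof (induction m)
  case (Suc m)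
  show ?case
  proof (cases "k < m")
    case True
    hence "ddiff (i, Suc m) (i, Suc (Suc m)) (ddiff (i, k) (i, Suc k) g) =
        ddiff (i, k) (i, Suc k) (ddiff (i, Suc m) (i, Suc (Suc m)) g)" for g
      by (intro ddiff_commute) auto
    thus ?thesis using Suc True by simp
  next
    case False
    then obtain k' where k: "k = m" "k = Suc k'" using Suc assms(1) by (cases k) auto
    have "dops i (down k') (ddiff (i, Suc k) (i, Suc (Suc k)) f) =
        ddiff (i, Suc k) (i, Suc (Suc k)) (dops i (down k') f)"
      by (rule ddiff_dops_commute[symmetric]) (use k in auto)
    moreover have "down (Suc m) = Suc k # k # down k'" using k by simp
    moreover have "ddiff (i, k) (i, Suc k) (ddiff (i, Suc k) (i, Suc (Suc k)) (ddiff (i, k) (i, Suc k) g)) =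
      ddiff (i, Suc k) (i, Suc (Suc k)) (ddiff (i, k) (i, Suc k) (ddiff (i, Suc k) (i, Suc (Suc k)) g))" for g
      by (rule ddiff_braid) auto
    ultimately show ?thesis by (simp only: dops_simps)
  qed
qed simp

lemma dops_down_map_Suc:
  "set ks \<subseteq> {1..<m} \<Longrightarrow> dops i (down m) (dops i (map Suc ks) f) = dops i ks (dops i (down m) f)"
  by (induction ks) (simp_all add: dops_down_shift del: upt_Suc)

text \<open>The second word is \<open>m, ..., 2\<close> followed by 1. The part
  \<open>m, ..., 2\<close> passes to the left of the first word with its letters lowered, and what
  remains ends with the square of the divided difference of index 1, which is zero.\<close>

lemma dops_down_down:
  assumes "m \<ge> Suc 0" shows "dops i (down m) (dops i (down m) f) = 0"
proof -
  have e: "down m = map Suc (rev [Suc 0..<m]) @ [Suc 0]"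
    using assms by (simp add: upt_conv_Cons del: upt_Suc) (metis map_Suc_upt rev_map)
  have z: "dops i (down m) (ddiff (i, Suc 0) (i, Suc (Suc 0)) g) = 0" for g
    unfolding e by simp
  have "dops i (down m) (dops i (down m) f) =
      dops i (down m) (dops i (map Suc (rev [Suc 0..<m])) (ddiff (i, Suc 0) (i, Suc (Suc 0)) f))"
    by (subst (2) e) (simp only: dops_simps)
  also have "\<dots> = 0" using z by (subst dops_down_map_Suc) auto
  finally show ?thesis .
qed

primrec w0_word :: "nat \<Rightarrow> nat list" where
  "w0_word 0 = []"
| "w0_word (Suc n) = w0_word n @ rev [Suc 0..<Suc n]"

declare w0_word.simps(2) [simp del]

lemma dops_w0_Suc: "dops i (w0_word (Suc n)) f = dops i (w0_word n) (dops i (down n) f)"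
  by (simp add: w0_word.simps(2) del: upt_Suc)

lemma set_w0_word: "set (w0_word n) \<subseteq> {1..<n}"
  by (induction n) (auto simp: w0_word.simps(2))

lemma ddiff_dops_w0_commute:
  assumes "n < m"
  shows "ddiff (i, m) (i, Suc m) (dops i (w0_word n) f) = dops i (w0_word n) (ddiff (i, m) (i, Suc m) f)"
  by (rule ddiff_dops_commute) (use set_w0_word[of n] assms in auto)

text \<open>In the induction step only the largest letter is new. It commutes with the innermost
  part of the word, completes the next descending block, and this block then meets another copy of
  itself; their product vanishes.\<close>

lemma ddiff_dops_w0:
  assumes "1 \<le> k" "k < n"
  shows "ddiff (i, k) (i, Suc k) (dops i (w0_word n) f) = 0"
  using assms(2)
proof (induction n arbitrary: f)
  case (Suc n)
  show ?case
  proof (cases "k < n")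
    case True
    thus ?thesis using Suc.IH by (simp add: dops_w0_Suc)
  next
    case False
    hence k: "k = n" using Suc by simp
    then obtain n' where n: "n = Suc n'" using assms(1) by (cases n) auto
    have "ddiff (i, n) (i, Suc n) (dops i (w0_word n') g) = dops i (w0_word n') (ddiff (i, n) (i, Suc n) g)" for g
      using ddiff_dops_w0_commute[of n' n i g] n by simp
    moreover have "ddiff (i, n) (i, Suc n) (dops i (down n') g) = dops i (down n) g" for g
      using n by simp
    ultimately have "ddiff (i, k) (i, Suc k) (dops i (w0_word (Suc n)) f) =
        dops i (w0_word n') (dops i (down n) (dops i (down n) f))"
      using k by (simp add: dops_w0_Suc n del: upt_Suc) 
    thus ?thesis using assms k by (simp add: dops_down_down del: upt_Suc)
  qed
qed simp

lemma swap_vars_dops_w0: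
  "1 \<le> k \<Longrightarrow> k < n \<Longrightarrow> swap_vars (i, k) (i, Suc k) (dops i (w0_word n) f) = dops i (w0_word n) f"
  using ddiff_dops_w0[of k n i f] by (simp add: ddiff_eq_0_iff)

text \<open>The mirrored recursion, with the new letters to the left and increasing. Here the
  shorter word acts before the new letters, as needed both for the Vandermonde product and for
  peeling letters off from the left.\<close>

lemma dops_w0_Suc': "dops i (w0_word (Suc n)) f = dops i [Suc 0..<Suc n] (dops i (w0_word n) f)"
proof (induction n arbitrary: f)
  case 0
  show ?case by (simp add: w0_word.simps)
next
  case (Suc n)
  have "dops i (w0_word (Suc (Suc n))) f =
      dops i [Suc 0..<Suc n] (dops i (w0_word n) (dops i (down (Suc n)) f))"
    by (subst dops_w0_Suc) (rule Suc.IH)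
  also have "dops i (down (Suc n)) f = ddiff (i, Suc n) (i, Suc (Suc n)) (dops i (down n) f)" by simp
  also have "dops i (w0_word n) \<dots> = ddiff (i, Suc n) (i, Suc (Suc n)) (dops i (w0_word (Suc n)) f)"
    using ddiff_dops_w0_commute[of n "Suc n" i "dops i (down n) f"] by (simp add: dops_w0_Suc del: upt_Suc)
  finally show ?case by simp
qed

text \<open>Each further divided difference removes the factor that involves its smaller variable;
  the summand antisymmetric in its two variables splits into two, so the number of summands grows by
  one. For \<open>j = 0\<close> the products are empty and the value is
  \<open>n + 1\<close>.\<close>

lemma dops_upt_prod:
  assumes "j \<le> n"
  shows "dops i [Suc j..<Suc n] (\<Prod>k\<in>{1..n}. Var (i, k) - Var (i, Suc n)) =
    (\<Sum>l\<in>{Suc j..Suc n}. \<Prod>k\<in>{1..j}. Var (i, k) - Var (i, l))"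
  using assms
proof (induction rule: inc_induct)
  case base
  show ?case by simp
next
  case (step j)
  let ?A = "\<lambda>l. \<Prod>k\<in>{1..j}. Var (i, k) - Var (i, l) :: 'a xpoly"
  let ?c = "Suc j"
  have inv: "swap_vars (i, ?c) (i, Suc ?c) (?A l) = ?A (transpose ?c (Suc ?c) l)" for l
    by (auto simp: transpose_def intro!: prod.cong)
  have 1: "ddiff (i, ?c) (i, Suc ?c) (?A l * (Var (i, ?c) - Var (i, l))) = ?A l" if "l > Suc ?c" for l
    using that by (intro ddiff_eqI) (auto simp: inv transpose_def algebra_simps)
  have 2: "ddiff (i, ?c) (i, Suc ?c) (?A (Suc ?c) * (Var (i, ?c) - Var (i, Suc ?c))) = ?A ?c + ?A (Suc ?c)"
    by (intro ddiff_eqI) (auto simp: inv algebra_simps)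
  have "dops i [?c..<Suc n] (\<Prod>k\<in>{1..n}. Var (i, k) - Var (i, Suc n)) =
      ddiff (i, ?c) (i, Suc ?c) (\<Sum>l\<in>{Suc ?c..Suc n}. ?A l * (Var (i, ?c) - Var (i, l)))"
    using step by (simp add: upt_conv_Cons mult.commute del: upt_Suc)
  also have "\<dots> = dops i [?c] (\<Sum>l\<in>{Suc ?c..Suc n}. ?A l * (Var (i, ?c) - Var (i, l)))" by simp
  also have "\<dots> = (\<Sum>l\<in>{Suc ?c..Suc n}. ddiff (i, ?c) (i, Suc ?c) (?A l * (Var (i, ?c) - Var (i, l))))"
    by (subst dops_sum) simp
  also have "{Suc ?c..Suc n} = insert (Suc ?c) {Suc (Suc ?c)..Suc n}" using step by auto
  also have "(\<Sum>l\<in>insert (Suc ?c) {Suc (Suc ?c)..Suc n}.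
      ddiff (i, ?c) (i, Suc ?c) (?A l * (Var (i, ?c) - Var (i, l)))) =
      ?A ?c + ?A (Suc ?c) + (\<Sum>l\<in>{Suc (Suc ?c)..Suc n}. ?A l)"
    using 1 2 by simp
  also have "\<dots> = (\<Sum>l\<in>insert ?c (insert (Suc ?c) {Suc (Suc ?c)..Suc n}). ?A l)"
    by simp
  also have "insert ?c (insert (Suc ?c) {Suc (Suc ?c)..Suc n}) = {?c..Suc n}" using step by auto
  finally show ?case .
qed

definition vandermonde :: "'q \<Rightarrow> nat \<Rightarrow> 'q::linorder xpoly" where
  "vandermonde i n = (\<Prod>(k, l)\<in>{(k, l). 1 \<le> k \<and> k < l \<and> l \<le> n}. Var (i, k) - Var (i, l))"

lemma vandermonde_Suc:
  "vandermonde i (Suc n) = (\<Prod>k\<in>{1..n}. Var (i, k) - Var (i, Suc n)) * vandermonde i n"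
proof -
  let ?S = "{(k, l). 1 \<le> k \<and> k < l \<and> l \<le> n}"
  have fin: "finite ?S" by (rule finite_subset[of _ "{..n} \<times> {..n}"]) auto
  have "{(k, l). 1 \<le> k \<and> k < l \<and> l \<le> Suc n} = (\<lambda>k. (k, Suc n)) ` {1..n} \<union> ?S"
    by (auto simp: le_Suc_eq)
  hence "vandermonde i (Suc n) = (\<Prod>(k, l)\<in>(\<lambda>k. (k, Suc n)) ` {1..n}. Var (i, k) - Var (i, l)) * vandermonde i n"
    unfolding vandermonde_def using fin by (simp only:) (rule prod.union_disjoint; auto)
  also have "(\<Prod>(k, l)\<in>(\<lambda>k. (k, Suc n)) ` {1..n}. Var (i, k) - Var (i, l)) =
      (\<Prod>k\<in>{1..n}. Var (i, k) - Var (i, Suc n) :: 'a xpoly)"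
    by (subst prod.reindex) (auto simp: inj_on_def)
  finally show ?thesis .
qed

text \<open>The factors containing the last variable form a product symmetric in the others, which
  passes through the shorter word; the remaining letters turn it into \<open>n + 1\<close>. This is
  the origin of the factor \<open>1 / v_i!\<close> in the projection.\<close>

lemma dops_w0_vandermonde: "dops i (w0_word n) (vandermonde i n) = of_nat (fact n)"
proof (induction n)
  case 0
  have "{(k, l). 1 \<le> k \<and> k < l \<and> l \<le> (0::nat)} = {}" by auto
  hence "vandermonde i 0 = (1 :: 'a xpoly)" unfolding vandermonde_def by (simp only: prod.empty)
  thus ?case by simp
next
  case (Suc n)
  let ?F = "\<Prod>k\<in>{1..n}. Var (i, k) - Var (i, Suc n) :: 'a xpoly"
  have inv: "swap_vars (i, k) (i, Suc k) ?F = ?F" if "1 \<le> k" "k < n" for k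
  proof -
    have "swap_vars (i, k) (i, Suc k) ?F = (\<Prod>l\<in>{1..n}. Var (i, transpose k (Suc k) l) - Var (i, Suc n))"
      using that by (auto simp: transpose_def intro!: prod.cong)
    also have "\<dots> = ?F"
      by (rule prod.reindex_bij_betw[OF permutes_imp_bij[OF permutes_swap_id]]) (use that in auto)
    finally show ?thesis .
  qed
  have "dops i (w0_word (Suc n)) (vandermonde i (Suc n)) =
      dops i [Suc 0..<Suc n] (?F * dops i (w0_word n) (vandermonde i n))"
    unfolding dops_w0_Suc' vandermonde_Suc
    by (subst dops_mult_invariant) (use inv set_w0_word[of n] in auto)
  also have "\<dots> = of_nat (fact n) * dops i [Suc 0..<Suc n] ?F"
    unfolding Suc by (subst mult.commute, subst dops_mult_invariant) (auto simp del: of_nat_fact)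
  also have "\<dots> = of_nat (fact (Suc n))"
    by (subst dops_upt_prod) (auto simp: algebra_simps)
  finally show ?case .
qed

text \<open>With \<open>T\<close> the word \<open>j, ..., n - 1\<close>, the expression
  \<open>x_j T - T x_n\<close> loses the leftmost letter of \<open>T\<close>. The correction coming
  from the shorter word vanishes, because \<open>D_j\<close> moves past its letters and kills
  \<open>g\<close>.\<close>

lemma dops_upt_Var_mult:
  assumes g: "\<And>k. 1 \<le> k \<Longrightarrow> Suc k < n \<Longrightarrow> ddiff (i, k) (i, Suc k) g = 0" and j: "1 \<le> j" "j < n"
  shows "dops i [Suc j..<n] g = Var (i, j) * dops i [j..<n] g - dops i [j..<n] (Var (i, n) * g)"
proof -
  obtain m where n: "n = Suc m" using j by (cases n) auto
  have "j \<le> m" using j n by simp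
  thus ?thesis using j(1)
  proof (induction rule: inc_induct)
    case base
    show ?case by (simp add: n ddiff_Var_mult)
  next
    case (step j)
    let ?D = "ddiff (i, j) (i, Suc j)"
    have up: "[j..<n] = j # [Suc j..<n]" using step n by (simp add: upt_conv_Cons)
    have z: "?D (dops i [Suc (Suc j)..<n] g) = 0"
      using g[of j] step n by (subst ddiff_dops_commute) auto
    have D: "?D (a - b) = ?D a - ?D b" for a b
      using dops_diff[of i "[j]" a b] by simp
    have "dops i [j..<n] (Var (i, n) * g) = ?D (dops i [Suc j..<n] (Var (i, n) * g))"
      by (simp add: up)
    also have "\<dots> = ?D (Var (i, Suc j) * dops i [Suc j..<n] g - dops i [Suc (Suc j)..<n] g)"
      using step by simp
    also have "\<dots> = Var (i, j) * dops i [j..<n] g - dops i [Suc j..<n] g"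
      by (simp add: D z ddiff_Var_mult up)
    finally show ?case by simp
  qed
qed

lemma dops_Var_mult:
  "(\<And>k. k \<in> set ks \<Longrightarrow> y \<noteq> (i, k) \<and> y \<noteq> (i, Suc k)) \<Longrightarrow> dops i ks (Var y * f) = Var y * dops i ks f"
  by (rule dops_mult_invariant) (auto simp: transpose_def)

text \<open>The nilHecke algebra is generated as a two-sided ideal by the operator of the longest word.\<close>

lemma ideal_dops_w0:
  fixes J :: "('q::linorder xpoly \<Rightarrow> 'q xpoly) set"
  assumes J_diff: "\<And>S T. S \<in> J \<Longrightarrow> T \<in> J \<Longrightarrow> (\<lambda>f. S f - T f) \<in> J"
    and J_left: "\<And>T k. T \<in> J \<Longrightarrow> 1 \<le> k \<Longrightarrow> k \<le> n \<Longrightarrow> (\<lambda>f. Var (i, k) * T f) \<in> J"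
    and J_right: "\<And>T k. T \<in> J \<Longrightarrow> 1 \<le> k \<Longrightarrow> k \<le> n \<Longrightarrow> (\<lambda>f. T (Var (i, k) * f)) \<in> J"
    and U: "\<And>k f. U (Var (i, k) * f) = Var (i, k) * U f"
    and "(\<lambda>f. dops i (w0_word n) (U f)) \<in> J"
  shows "U \<in> J"
  using assms(5) J_left J_right
proof (induction n)
  case (Suc n)
  let ?g = "\<lambda>f. dops i (w0_word n) (U f)"
  have "(\<lambda>f. dops i [j..<Suc n] (?g f)) \<in> J" if "1 \<le> j" "j \<le> Suc n" for j
    using that
  proof (induction rule: dec_induct)
    case base
    show ?case using Suc.prems(1) by (simp add: dops_w0_Suc' del: upt_Suc)
  next
    case (step j)
    let ?T = "\<lambda>f. dops i [j..<Suc n] (?g f)"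
    \<comment> \<open>The last variable does not occur in the shorter word and commutes with
      \<open>U\<close>, so multiplying the argument of \<open>?g\<close> by it multiplies the
      value.\<close>
    have g: "?g (Var (i, Suc n) * f) = Var (i, Suc n) * ?g f" for f
      unfolding U by (rule dops_Var_mult) (use set_w0_word[of n] in auto)
    have "(\<lambda>f. Var (i, j) * ?T f - ?T (Var (i, Suc n) * f)) \<in> J"
      using step by (intro J_diff Suc.prems(2) Suc.prems(3)[of ?T]) auto
    also have "(\<lambda>f. Var (i, j) * ?T f - ?T (Var (i, Suc n) * f)) =
        (\<lambda>f. dops i [Suc j..<Suc n] (?g f))"
      unfolding g by (intro ext dops_upt_Var_mult[symmetric] ddiff_dops_w0) (use step in auto)
    finally show ?case .
  qed
  from this[of "Suc n"] have "?g \<in> J" by simp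
  thus ?case by (rule Suc.IH) (use Suc.prems in auto)
qed simp

section \<open>The projection onto symmetric polynomials\<close>

lemma ddiff_poly_in:
  assumes "p \<noteq> q" "p \<in> X" "q \<in> X" "f \<in> poly_in X"
  shows "ddiff p q f \<in> poly_in X"
proof (rule poly_in_cancel)
  show "(Var p - Var q) * ddiff p q f \<in> poly_in X"
    using assms by (auto simp: ddiff_mult)
qed (use assms in auto)

lemma foldr_comp_id: "foldr (\<lambda>x T. F x \<circ> T) xs id f = foldr F xs f"
  by (induction xs) auto

definition perm_vars :: "('q \<Rightarrow> nat \<Rightarrow> nat) \<Rightarrow> 'q::linorder xpoly \<Rightarrow> 'q xpoly" where
  "perm_vars \<pi> = poly_subst (\<lambda>(j, l). Var (j, \<pi> j l))"

lemma perm_vars_comp: "perm_vars \<pi> (perm_vars \<rho> f) = perm_vars (\<lambda>j. \<pi> j \<circ> \<rho> j) f"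
  unfolding perm_vars_def poly_subst_poly_subst by (simp add: case_prod_unfold)

lemma perm_vars_id [simp]: "perm_vars (\<lambda>_. id) f = f"
proof -
  have "(\<lambda>(j, l). Var (j, id l)) = (Var :: _ \<Rightarrow> 'a xpoly)" by auto
  thus ?thesis by (simp only: perm_vars_def poly_subst_ident)
qed

lemma perm_vars_transpose: "perm_vars ((\<lambda>_. id)(i := transpose a b)) = swap_vars (i, a) (i, b)"
  unfolding perm_vars_def swap_vars_def
  by (intro arg_cong[where f = poly_subst]) (auto simp: fun_eq_iff transpose_def)

lemma perm_vars_single_comp:
  "perm_vars ((\<lambda>_. id)(i := \<sigma> \<circ> \<rho>)) f = perm_vars ((\<lambda>_. id)(i := \<sigma>)) (perm_vars ((\<lambda>_. id)(i := \<rho>)) f)"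
  unfolding perm_vars_comp by (intro arg_cong2[where f = perm_vars]) auto

text \<open>Adjacent transpositions generate the symmetric group.\<close>

lemma perm_vars_single_invariant:
  assumes adj: "\<And>k. 1 \<le> k \<Longrightarrow> k < n \<Longrightarrow> swap_vars (i, k) (i, Suc k) f = f"
    and "\<sigma> permutes {1..n}"
  shows "perm_vars ((\<lambda>_. id)(i := \<sigma>)) f = f"
  using assms(2) finite_atLeastAtMost
proof (induction rule: permutes_induct)
  case id
  have "(\<lambda>_. id)(i := id) = (\<lambda>_. id :: nat \<Rightarrow> nat)" by auto
  thus ?case by (simp only: perm_vars_id)
next
  case (swap a b p)
  have lt: "perm_vars ((\<lambda>_. id)(i := transpose a b)) f = f" if "1 \<le> a" "Suc a \<le> b" "b \<le> n" for a b
    using that(2,3)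
  proof (induction rule: dec_induct)
    case base
    show ?case unfolding perm_vars_transpose using adj[of a] that base by simp
  next
    case (step b)
    have "transpose a (Suc b) = transpose b (Suc b) \<circ> (transpose a b \<circ> transpose b (Suc b))"
      using step by (auto simp: transpose_def fun_eq_iff)
    moreover have "perm_vars ((\<lambda>_. id)(i := transpose b (Suc b))) f = f"
      unfolding perm_vars_transpose using adj[of b] step that by simp
    moreover have "perm_vars ((\<lambda>_. id)(i := transpose a b)) f = f"
      by (rule step.IH) (use step.prems in simp)
    ultimately show ?case by (simp only: perm_vars_single_comp)
  qed
  have "perm_vars ((\<lambda>_. id)(i := transpose a b)) f = f"
    using lt[of a b] lt[of b a] swap by (cases "a < b") (auto simp: transpose_commute)
  thus ?case using swap.IH by (simp only: perm_vars_single_comp)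
qed

section \<open>Invariants of the product of symmetric groups and the projection onto them\<close>

context iyangian_data
begin

definition vset :: "('q \<times> nat) set" where
  "vset = {(i, k). i \<in> Qp \<and> 1 \<le> k \<and> k \<le> v i}"

lemma P_eq: "P = poly_in vset"
  by (simp add: P_def poly_in_def vset_def)

lemma finite_Qp: "finite Qp"
  using partition(1) finite_verts by (metis finite_Un)

lemma perm_vars_invariant:
  assumes "f \<in> P" and adj: "\<And>i k. i \<in> Qp \<Longrightarrow> 1 \<le> k \<Longrightarrow> k < v i \<Longrightarrow> swap_vars (i, k) (i, Suc k) f = f"
    and \<pi>: "\<And>i. i \<in> Qp \<Longrightarrow> \<pi> i permutes {1..v i}"
  shows "perm_vars (\<lambda>j. if j \<in> Qp then \<pi> j else id) f = f"
proof -
  have "finite S \<Longrightarrow> S \<subseteq> Qp \<Longrightarrow> perm_vars (\<lambda>j. if j \<in> S then \<pi> j else id) f = f" for S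
  proof (induction S rule: finite_induct)
    case (insert i S)
    have "perm_vars (\<lambda>j. if j \<in> insert i S then \<pi> j else id) f =
        perm_vars ((\<lambda>_. id)(i := \<pi> i)) (perm_vars (\<lambda>j. if j \<in> S then \<pi> j else id) f)"
      unfolding perm_vars_comp using insert(2)
      by (intro arg_cong2[where f = perm_vars]) (auto simp: fun_eq_iff)
    also have "\<dots> = f"
      using insert perm_vars_single_invariant[OF adj \<pi>] by simp
    finally show ?case .
  qed simp
  thus ?thesis using finite_Qp by blast
qed

lemma P_inv_perm_vars:
  "P_inv = {f \<in> P. \<forall>\<pi>. (\<forall>i\<in>Qp. \<pi> i permutes {1..v i}) \<longrightarrow>
     perm_vars (\<lambda>j. if j \<in> Qp then \<pi> j else id) f = f}"
proof -
  have "(\<lambda>(i, k). if i \<in> Qp then Var (i, \<pi> i k) else Var (i, k)) =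
    (\<lambda>(j, l). Var (j, (if j \<in> Qp then \<pi> j else id) l))" for \<pi> :: "'q \<Rightarrow> nat \<Rightarrow> nat"
    by auto
  thus ?thesis unfolding P_inv_def perm_vars_def by simp
qed

text \<open>Adjacent transpositions at the single vertices generate the group. In this form
  invariance says that all the divided differences vanish.\<close>

lemma P_inv_iff:
  "f \<in> P_inv \<longleftrightarrow> f \<in> P \<and> (\<forall>i\<in>Qp. \<forall>k. 1 \<le> k \<longrightarrow> k < v i \<longrightarrow> swap_vars (i, k) (i, Suc k) f = f)"
proof
  assume f: "f \<in> P_inv"
  have "swap_vars (i, k) (i, Suc k) f = f" if "i \<in> Qp" "1 \<le> k" "k < v i" for i k
  proof -
    let ?\<pi> = "(\<lambda>_. id)(i := transpose k (Suc k))"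
    have "?\<pi> j permutes {1..v j}" for j
      using that by (auto simp: permutes_id intro!: permutes_swap_id)
    hence "perm_vars (\<lambda>j. if j \<in> Qp then ?\<pi> j else id) f = f"
      using f by (simp add: P_inv_perm_vars)
    also have "(\<lambda>j. if j \<in> Qp then ?\<pi> j else id) = ?\<pi>" using that by auto
    finally show ?thesis by (simp only: perm_vars_transpose)
  qed
  thus "f \<in> P \<and> (\<forall>i\<in>Qp. \<forall>k. 1 \<le> k \<longrightarrow> k < v i \<longrightarrow> swap_vars (i, k) (i, Suc k) f = f)"
    using f by (simp add: P_inv_def)
next
  assume "f \<in> P \<and> (\<forall>i\<in>Qp. \<forall>k. 1 \<le> k \<longrightarrow> k < v i \<longrightarrow> swap_vars (i, k) (i, Suc k) f = f)"
  thus "f \<in> P_inv" unfolding P_inv_perm_vars using perm_vars_invariant by blast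
qed

lemma P_inv_P: "f \<in> P_inv \<Longrightarrow> f \<in> P"
  by (simp add: P_inv_def)

lemma P_inv_swap: "f \<in> P_inv \<Longrightarrow> i \<in> Qp \<Longrightarrow> 1 \<le> k \<Longrightarrow> k < v i \<Longrightarrow> swap_vars (i, k) (i, Suc k) f = f"
  by (simp add: P_inv_iff)

lemma P_inv_Const [simp, intro]: "Const c \<in> P_inv"
  and P_inv_0 [simp, intro]: "0 \<in> P_inv"
  and P_inv_1 [simp, intro]: "1 \<in> P_inv"
  by (simp_all add: P_inv_iff P_eq)

lemma P_inv_add [simp, intro]: "f \<in> P_inv \<Longrightarrow> g \<in> P_inv \<Longrightarrow> f + g \<in> P_inv"
  and P_inv_diff [simp, intro]: "f \<in> P_inv \<Longrightarrow> g \<in> P_inv \<Longrightarrow> f - g \<in> P_inv"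
  and P_inv_mult [simp, intro]: "f \<in> P_inv \<Longrightarrow> g \<in> P_inv \<Longrightarrow> f * g \<in> P_inv"
  and P_inv_uminus [simp, intro]: "f \<in> P_inv \<Longrightarrow> - f \<in> P_inv"
  by (simp_all add: P_inv_iff P_eq)

lemma dops_P:
  assumes "i \<in> Qp" "set ks \<subseteq> {1..<v i}" "f \<in> P"
  shows "dops i ks f \<in> P"
  using assms(2)
proof (induction ks)
  case (Cons k ks)
  thus ?case using assms(1) by (auto simp: P_eq vset_def intro!: ddiff_poly_in)
qed (use assms in simp)

text \<open>Numerator and denominator both carry the opposite sign compared with
  \<open>ddiff\<close>, so the quotients agree.\<close>

lemma divided_diff_eq: "divided_diff i k f = ddiff (i, k) (i, Suc k) f"
proof -
  have "(\<lambda>(j, l). Var (j, if j = i then transpose k (Suc k) l else l)) =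
      (\<lambda>y. Var (transpose (i, k) (i, Suc k) y) :: 'q xpoly)"
    by (auto simp: fun_eq_iff transpose_def)
  hence "poly_subst (\<lambda>(j, l). Var (j, if j = i then transpose k (Suc k) l else l)) f - f =
      (Var (i, Suc k) - Var (i, k)) * ddiff (i, k) (i, Suc k) f"
    using ddiff_mult[of "(i, k)" "(i, Suc k)" f] by (simp add: swap_vars_def algebra_simps)
  thus ?thesis unfolding divided_diff_def
    by (simp del: to_fract_diff flip: to_fract_diff)
qed

lemma longest_word_eq: "longest_word n = w0_word n"
proof (induction n)
  case (Suc n)
  thus ?case by (cases n) (simp_all add: longest_word_def w0_word.simps)
qed (simp add: longest_word_def)

lemma e_factor_eq:
  "e_factor i f = Const (1 / of_nat (fact (v i))) * dops i (w0_word (v i)) (vandermonde i (v i) * f)"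
  unfolding e_factor_def divided_diff_w0_def foldr_comp_id vandermonde_def longest_word_eq
  by (simp add: dops_def divided_diff_eq[abs_def])

lemma e_factor_P:
  assumes "i \<in> Qp" "f \<in> P" shows "e_factor i f \<in> P"
proof -
  have "vandermonde i (v i) \<in> P"
    unfolding vandermonde_def P_eq using assms(1) by (auto intro!: poly_in_prod simp: vset_def)
  thus ?thesis using dops_P[OF assms(1) set_w0_word] assms(2)
    by (simp add: e_factor_eq P_eq)
qed

lemma e_factor_mult:
  assumes "\<And>k. 1 \<le> k \<Longrightarrow> k < v i \<Longrightarrow> swap_vars (i, k) (i, Suc k) h = h"
  shows "e_factor i (h * f) = h * e_factor i f"
proof -
  have "dops i (w0_word (v i)) (h * (vandermonde i (v i) * f)) =
      h * dops i (w0_word (v i)) (vandermonde i (v i) * f)"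
    by (rule dops_mult_invariant) (use assms set_w0_word[of "v i"] in auto)
  thus ?thesis by (simp add: e_factor_eq mult.left_commute)
qed

lemma e_factor_add: "e_factor i (f + g) = e_factor i f + e_factor i g"
  by (simp add: e_factor_eq distrib_left dops_add)

lemma e_factor_one: "e_factor i 1 = 1"
proof -
  have "(of_nat (fact (v i)) :: hfield) \<noteq> 0" by (simp del: of_nat_fact)
  hence "Const (1 / of_nat (fact (v i))) * Const (of_nat (fact (v i))) = (1 :: 'q xpoly)"
    unfolding Const_mult[symmetric] by (simp del: of_nat_fact)
  thus ?thesis
    by (simp add: e_factor_eq dops_w0_vandermonde del: of_nat_fact)
qed

lemma e_factor_ident:
  assumes "\<And>k. 1 \<le> k \<Longrightarrow> k < v i \<Longrightarrow> swap_vars (i, k) (i, Suc k) f = f"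
  shows "e_factor i f = f"
  using e_factor_mult[of i f 1] assms by (simp add: e_factor_one)

lemma swap_vars_e_factor:
  assumes "1 \<le> k" "k < v i"
  shows "swap_vars (i, k) (i, Suc k) (e_factor i f) = e_factor i f"
  using assms by (simp add: e_factor_eq swap_vars_dops_w0)

lemma swap_vars_e_factor_commute:
  assumes "i \<noteq> j"
  shows "swap_vars (j, k) (j, Suc k) (e_factor i f) = e_factor i (swap_vars (j, k) (j, Suc k) f)"
proof -
  have "swap_vars (j, k) (j, Suc k) (vandermonde i (v i)) = vandermonde i (v i)"
    unfolding vandermonde_def swap_vars_simps
    by (rule prod.cong) (use assms in \<open>auto simp: transpose_def\<close>)
  thus ?thesis unfolding e_factor_eq swap_vars_simps
    by (subst swap_vars_dops_commute) (use assms in auto)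
qed

lemma e_inv_eq: "e_inv f = foldr e_factor (sorted_list_of_set Qp) f"
  unfolding e_inv_def foldr_comp_id ..

text \<open>Each factor makes its argument symmetric at its own vertex and commutes with swaps at
  every other vertex, so the symmetry obtained so far is not lost.\<close>

lemma e_inv_closed:
  assumes "f \<in> P" shows "e_inv f \<in> P_inv"
proof -
  have "set is \<subseteq> Qp \<Longrightarrow> foldr e_factor is f \<in> P \<and> (\<forall>i\<in>set is. \<forall>k. 1 \<le> k \<longrightarrow> k < v i \<longrightarrow>
      swap_vars (i, k) (i, Suc k) (foldr e_factor is f) = foldr e_factor is f)" for "is"
  proof (induction "is")
    case (Cons i "is")
    have "swap_vars (j, k) (j, Suc k) (e_factor i (foldr e_factor is f)) = e_factor i (foldr e_factor is f)"
      if "j \<in> set (i # is)" "1 \<le> k" "k < v j" for j k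
      using that Cons by (cases "i = j") (auto simp: swap_vars_e_factor swap_vars_e_factor_commute)
    thus ?case using Cons by (simp add: e_factor_P)
  qed (use assms in simp)
  from this[of "sorted_list_of_set Qp"] show ?thesis
    by (simp add: e_inv_eq P_inv_iff finite_Qp)
qed

lemma e_inv_mult:
  assumes "h \<in> P_inv" shows "e_inv (h * f) = h * e_inv f"
proof -
  have "set is \<subseteq> Qp \<Longrightarrow> foldr e_factor is (h * f) = h * foldr e_factor is f" for "is"
    by (induction "is") (use assms in \<open>auto simp: P_inv_iff intro!: e_factor_mult\<close>)
  thus ?thesis by (simp add: e_inv_eq finite_Qp)
qed

lemma e_inv_add: "e_inv (f + g) = e_inv f + e_inv g"
proof -
  have "foldr e_factor is (f + g) = foldr e_factor is f + foldr e_factor is g" for "is"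
    by (induction "is") (simp_all add: e_factor_add)
  thus ?thesis by (simp add: e_inv_eq)
qed

lemma e_inv_ident:
  assumes "f \<in> P_inv" shows "e_inv f = f"
proof -
  have "set is \<subseteq> Qp \<Longrightarrow> foldr e_factor is f = f" for "is"
    by (induction "is") (use assms in \<open>auto simp: P_inv_iff intro!: e_factor_ident\<close>)
  thus ?thesis by (simp add: e_inv_eq finite_Qp)
qed

end

section \<open>Laurent series over a subring\<close>

text \<open>Two instances matter: the symmetric polynomials, and those symmetric polynomials whose
  multiplication operators lie in \<open>Y\<close>, both inside the field of fractions.\<close>

locale field_subring =
  fixes K :: "'a::field set"
  assumes K_0 [simp, intro]: "0 \<in> K" and K_1 [simp, intro]: "1 \<in> K"
    and K_add [simp, intro]: "x \<in> K \<Longrightarrow> y \<in> K \<Longrightarrow> x + y \<in> K"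
    and K_mult [simp, intro]: "x \<in> K \<Longrightarrow> y \<in> K \<Longrightarrow> x * y \<in> K"
    and K_uminus [simp, intro]: "x \<in> K \<Longrightarrow> - x \<in> K"
begin

lemma K_diff [simp, intro]: "x \<in> K \<Longrightarrow> y \<in> K \<Longrightarrow> x - y \<in> K"
  using K_add[of x "- y"] by simp

lemma K_sum: "(\<And>i. i \<in> I \<Longrightarrow> f i \<in> K) \<Longrightarrow> sum f I \<in> K"
  by (induction I rule: infinite_finite_induct) auto

lemma K_power [simp, intro]: "x \<in> K \<Longrightarrow> x ^ n \<in> K"
  by (induction n) auto

lemma K_of_nat [simp, intro]: "of_nat n \<in> K"
  by (induction n) auto

lemma K_of_int [simp, intro]: "of_int n \<in> K"
  by (cases n rule: int_cases2) auto

definition over :: "'a fls set" where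
  "over = {s. \<forall>n. fls_nth s n \<in> K}"

lemma over_nth: "s \<in> over \<Longrightarrow> fls_nth s n \<in> K"
  by (simp add: over_def)

lemma over_const [simp, intro]: "c \<in> K \<Longrightarrow> fls_const c \<in> over"
  and over_X_inv [simp, intro]: "fls_X_inv \<in> over"
  and over_X [simp, intro]: "fls_X \<in> over"
  and over_0 [simp, intro]: "0 \<in> over"
  and over_1 [simp, intro]: "1 \<in> over"
  and over_add [simp, intro]: "s \<in> over \<Longrightarrow> t \<in> over \<Longrightarrow> s + t \<in> over"
  and over_diff [simp, intro]: "s \<in> over \<Longrightarrow> t \<in> over \<Longrightarrow> s - t \<in> over"
  and over_uminus [simp, intro]: "s \<in> over \<Longrightarrow> - s \<in> over"
  by (simp_all add: over_def)

lemma over_mult [simp, intro]: "s \<in> over \<Longrightarrow> t \<in> over \<Longrightarrow> s * t \<in> over"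
  by (auto simp: over_def fls_times_nth(2) intro!: K_sum)

lemma over_power [simp, intro]: "s \<in> over \<Longrightarrow> s ^ n \<in> over"
  by (induction n) auto

lemma over_sum: "(\<And>i. i \<in> I \<Longrightarrow> f i \<in> over) \<Longrightarrow> sum f I \<in> over"
  by (induction I rule: infinite_finite_induct) auto

lemma over_prod: "(\<And>i. i \<in> I \<Longrightarrow> f i \<in> over) \<Longrightarrow> prod f I \<in> over"
  by (induction I rule: infinite_finite_induct) auto

lemma over_prod_mset: "(\<And>i. i \<in># M \<Longrightarrow> f i \<in> over) \<Longrightarrow> (\<Prod>i\<in>#M. f i) \<in> over"
  by (induction M) auto

lemma over_deriv: "s \<in> over \<Longrightarrow> fls_deriv s \<in> over"
  by (auto simp: over_def)

text \<open>The coefficients of the inverse are determined recursively by \<open>s y = 1\<close>,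
  and every step divides only by the leading coefficient of \<open>s\<close>.\<close>

lemma over_inverse:
  assumes s: "s \<in> over" and lead: "inverse (fls_nth s (fls_subdegree s)) \<in> K"
  shows "inverse s \<in> over"
proof (cases "s = 0")
  case False
  define d y where "d = fls_subdegree s" and "y = inverse s"
  have dy: "fls_subdegree y = - d" unfolding d_def y_def by (rule fls_inverse_subdegree) 
  have sy: "s * y = 1" using False by (simp add: y_def)
  have sd: "fls_nth s d \<noteq> 0" using False by (simp add: d_def)
  have "fls_nth y (int m - d) \<in> K" for m
  proof (induction m rule: less_induct)
    case (less m)
    have "fls_nth (s * y) (int m) = (\<Sum>i=d..int m + d. fls_nth s i * fls_nth y (int m - i))"
      unfolding fls_times_nth(2) dy d_def[symmetric] by simp
    also have "{d..int m + d} = insert d {d<..int m + d}" by auto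
    also have "(\<Sum>i\<in>insert d {d<..int m + d}. fls_nth s i * fls_nth y (int m - i)) =
        fls_nth s d * fls_nth y (int m - d) + (\<Sum>i\<in>{d<..int m + d}. fls_nth s i * fls_nth y (int m - i))"
      by simp
    finally have "fls_nth s d * fls_nth y (int m - d) =
        fls_nth 1 (int m) - (\<Sum>i\<in>{d<..int m + d}. fls_nth s i * fls_nth y (int m - i))"
      by (simp add: sy)
    also have "\<dots> \<in> K"
    proof (intro K_diff K_sum K_mult)
      fix i assume i: "i \<in> {d<..int m + d}"
      have "int (nat (int m + d - i)) - d = int m - i" using i by simp
      moreover have "nat (int m + d - i) < m" using i by auto
      ultimately show "fls_nth y (int m - i) \<in> K" using less[of "nat (int m + d - i)"] by simp
    qed (use s over_nth in auto)
    finally have "inverse (fls_nth s d) * (fls_nth s d * fls_nth y (int m - d)) \<in> K"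
      using lead by (simp add: d_def)
    thus ?case using sd by (simp flip: mult.assoc)
  qed
  note nonneg = this
  have "fls_nth y n \<in> K" for n
  proof (cases "n < - d")
    case False
    hence "n = int (nat (n + d)) - d" by simp
    thus ?thesis using nonneg by metis
  qed (simp add: dy)
  thus ?thesis by (simp add: over_def y_def)
qed simp

end

text \<open>The derivative is taken with respect to the inverse of \<open>z\<close>. Products of
  linear factors become sums whose coefficients are power sums of the roots.\<close>

definition logderiv :: "'a::field fls \<Rightarrow> 'a fls" where
  "logderiv s = fls_deriv s / s"

lemma logderiv_mult: "s \<noteq> 0 \<Longrightarrow> t \<noteq> 0 \<Longrightarrow> logderiv (s * t) = logderiv s + logderiv t"
  by (simp add: logderiv_def field_simps)

lemma logderiv_1 [simp]: "logderiv 1 = 0"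
  by (simp add: logderiv_def)

lemma logderiv_const [simp]: "logderiv (fls_const c) = 0"
  by (simp add: logderiv_def)

lemma logderiv_inverse: "s \<noteq> 0 \<Longrightarrow> logderiv (inverse s) = - logderiv s"
  using logderiv_mult[of s "inverse s"] by (simp add: add_eq_0_iff)

lemma logderiv_divide: "s \<noteq> 0 \<Longrightarrow> t \<noteq> 0 \<Longrightarrow> logderiv (s / t) = logderiv s - logderiv t"
  by (simp add: divide_inverse logderiv_mult logderiv_inverse)

lemma logderiv_prod:
  "(\<And>i. i \<in> I \<Longrightarrow> f i \<noteq> 0) \<Longrightarrow> logderiv (prod f I) = (\<Sum>i\<in>I. logderiv (f i))"
  by (induction I rule: infinite_finite_induct) (simp_all add: logderiv_mult)

lemma logderiv_prod_mset:
  "(\<And>i. i \<in># M \<Longrightarrow> f i \<noteq> 0) \<Longrightarrow> logderiv (\<Prod>i\<in>#M. f i) = (\<Sum>i\<in>#M. logderiv (f i))"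
proof (induction M)
  case (add x M)
  have "(\<Prod>i\<in>#M. f i) \<noteq> 0" using add.prems by (auto simp: prod_mset_zero_iff)
  thus ?case using add by (simp add: logderiv_mult)
qed simp

text \<open>The geometric expansion of \<open>1 / (z - c)\<close> at infinity, starting at the first
  power of the inverse of \<open>z\<close>.\<close>

lemma inverse_X_inv_minus_const:
  "fls_nth (1 / (fls_X_inv - fls_const c)) n = (if n \<ge> 1 then c ^ nat (n - 1) else 0)"
  for c :: "'a::field"
proof -
  define G where "G = fps_to_fls (Abs_fps (\<lambda>n. c ^ n))"
  have "(1 - fps_const c * fps_X) * Abs_fps (\<lambda>n. c ^ n) = 1"
  proof (rule fps_ext)
    fix n show "fps_nth ((1 - fps_const c * fps_X) * Abs_fps (\<lambda>n. c ^ n)) n = fps_nth 1 n"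
      by (cases n) (simp_all add: left_diff_distrib mult.assoc fps_mult_left_const_nth)
  qed
  hence "fps_to_fls ((1 - fps_const c * fps_X) * Abs_fps (\<lambda>n. c ^ n)) = 1" by simp
  hence 1: "(1 - fls_const c * fls_X) * G = 1"
    unfolding G_def by (simp add: fls_times_fps_to_fls)
  have XX: "fls_X_inv * fls_X = (1 :: 'a fls)"
    by (simp add: fls_X_inv_times_conv_shift fls_X_conv_shift_1)
  have "(fls_X_inv - fls_const c) * (fls_X * G) = (fls_X_inv * fls_X) * G - fls_const c * fls_X * G"
    by (simp add: left_diff_distrib mult.assoc)
  also have "\<dots> = (1 - fls_const c * fls_X) * G"
    unfolding XX by (simp add: left_diff_distrib)
  finally have "(fls_X_inv - fls_const c) * (fls_X * G) = (1 - fls_const c * fls_X) * G" .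
  hence 2: "(fls_X_inv - fls_const c) * (fls_X * G) = 1" using 1 by simp
  hence "fls_X_inv - fls_const c \<noteq> 0" by auto
  hence "1 / (fls_X_inv - fls_const c) = fls_X * G" using 2 by (simp add: field_simps)
  thus ?thesis by (simp add: fls_X_times_conv_shift G_def)
qed

section \<open>The generators preserve symmetric polynomials\<close>

lemma End_algebra_simps:
  "S \<otimes>\<^bsub>End_algebra W\<^esub> T = compose W S T"
  "\<one>\<^bsub>End_algebra W\<^esub> = (\<lambda>f\<in>W. f)"
  "\<zero>\<^bsub>End_algebra W\<^esub> = (\<lambda>f\<in>W. 0)"
  "S \<oplus>\<^bsub>End_algebra W\<^esub> T = (\<lambda>f\<in>W. S f + T f)"
  "c \<odot>\<^bsub>End_algebra W\<^esub> T = (\<lambda>f\<in>W. Const c * T f)"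
  by (simp_all add: End_algebra_def)

lemma End_algebra_carrier:
  "T \<in> carrier (End_algebra W) \<longleftrightarrow> T \<in> extensional W \<and> (\<forall>f\<in>W. T f \<in> W) \<and>
     (\<forall>f\<in>W. \<forall>g\<in>W. T (f + g) = T f + T g) \<and> (\<forall>c. \<forall>f\<in>W. T (Const c * f) = Const c * T f)"
  by (auto simp: End_algebra_def PiE_def)

locale poly_subspace =
  fixes W :: "'q::linorder xpoly set"
  assumes W_0: "0 \<in> W" and W_add: "f \<in> W \<Longrightarrow> g \<in> W \<Longrightarrow> f + g \<in> W"
    and W_Const: "f \<in> W \<Longrightarrow> Const c * f \<in> W"
begin

lemma generated_closed:
  assumes "S \<subseteq> carrier (End_algebra W)"
  shows "generated_subalgebra (End_algebra W) S \<subseteq> carrier (End_algebra W)"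
proof
  fix T assume "T \<in> generated_subalgebra (End_algebra W) S"
  thus "T \<in> carrier (End_algebra W)"
    by induction (use assms in \<open>auto simp: End_algebra_simps End_algebra_carrier W_add W_Const
        distrib_left mult.left_commute compose_def add_ac extensional_def\<close>)
qed

lemma generated_0: "(\<lambda>f\<in>W. 0) \<in> generated_subalgebra (End_algebra W) S"
proof -
  have "0 \<odot>\<^bsub>End_algebra W\<^esub> \<one>\<^bsub>End_algebra W\<^esub> \<in> generated_subalgebra (End_algebra W) S"
    by (intro generated_subalgebra.intros)
  thus ?thesis by (simp add: End_algebra_simps cong: restrict_cong)
qed

lemma assoc_algebra_generated:
  assumes S: "S \<subseteq> carrier (End_algebra W)"
  shows "assoc_algebra ((End_algebra W)\<lparr>carrier := generated_subalgebra (End_algebra W) S\<rparr>)"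
    (is "assoc_algebra ?A")
proof -
  let ?G = "generated_subalgebra (End_algebra W) S"
  have c: "T \<in> extensional W" "f \<in> W \<Longrightarrow> T f \<in> W" "f \<in> W \<Longrightarrow> g \<in> W \<Longrightarrow> T (f + g) = T f + T g"
    "f \<in> W \<Longrightarrow> T (Const k * f) = Const k * T f" if "T \<in> ?G" for T f g k
    using that generated_closed[OF S] by (auto simp: End_algebra_carrier)
  note simps = End_algebra_simps
  have eqI: "T = U" if "T \<in> extensional W" "U \<in> extensional W" "\<And>f. f \<in> W \<Longrightarrow> T f = U f" for T U
    using that by (rule extensionalityI)
  have 0: "(\<lambda>f\<in>W. 0) \<in> ?G" by (rule generated_0)
  have neg: "(\<lambda>f\<in>W. - T f) \<in> ?G" if "T \<in> ?G" for T
    using generated_subalgebra.smult[OF that, of "- 1"] by (simp add: simps cong: restrict_cong)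
  have add: "(\<lambda>f\<in>W. T f + U f) \<in> ?G" if "T \<in> ?G" "U \<in> ?G" for T U
    using generated_subalgebra.add[OF that] by (simp add: simps)
  have mult: "compose W T U \<in> ?G" if "T \<in> ?G" "U \<in> ?G" for T U
    using generated_subalgebra.mult[OF that] by (simp add: simps)
  have smult: "(\<lambda>f\<in>W. Const k * T f) \<in> ?G" if "T \<in> ?G" for T k
    using generated_subalgebra.smult[OF that] by (simp add: simps)
  have one: "(\<lambda>f\<in>W. f) \<in> ?G"
    using generated_subalgebra.one[of "End_algebra W" S] by (simp add: simps)
  have "abelian_group ?A"
  proof (rule abelian_groupI)
    fix T assume "T \<in> carrier ?A"
    thus "\<exists>U\<in>carrier ?A. U \<oplus>\<^bsub>?A\<^esub> T = \<zero>\<^bsub>?A\<^esub>"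
      using neg[of T] by (intro bexI[of _ "\<lambda>f\<in>W. - T f"]) (auto simp: simps)
  qed (use 0 add in \<open>auto simp: simps c intro!: eqI\<close>)
  moreover have "monoid ?A"
    by (rule monoidI) (use one mult in \<open>auto simp: simps c compose_def intro!: eqI\<close>)
  ultimately have "ring ?A"
    by (intro ringI) (auto simp: simps c compose_def abelian_group_def intro!: eqI)
  thus ?thesis
    by (intro assoc_algebra.intro assoc_algebra_axioms.intro)
      (use smult in \<open>auto simp: simps c compose_def distrib_left distrib_right mult.assoc intro!: eqI\<close>)
qed

end

section \<open>Symmetry and polynomiality of sums of fractions\<close>

lemma to_fract_prod [simp]: "to_fract (prod f S) = (\<Prod>x\<in>S. to_fract (f x))"
  by (induction S rule: infinite_finite_induct) simp_all

lemma swap_vars_eq_iff [simp]: "swap_vars p q f = swap_vars p q g \<longleftrightarrow> f = g"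
  by (metis swap_vars_swap_vars)

lemma swap_vars_eq_0_iff [simp]: "swap_vars p q f = 0 \<longleftrightarrow> f = 0"
  using swap_vars_eq_iff[of p q f 0] by simp

text \<open>Swaps of variables are defined on polynomials only. An identity between fractions is
  therefore turned into a polynomial one, to which a swap can be applied, and back.\<close>

lemma fract_sum_clear_denominators:
  fixes F D :: "'b \<Rightarrow> 'q::linorder xpoly"
  assumes "finite S" and D: "\<And>r. r \<in> S \<Longrightarrow> D r \<noteq> 0"
  shows "to_fract g = (\<Sum>r\<in>S. to_fract (F r) / to_fract (D r)) \<longleftrightarrow>
    g * prod D S = (\<Sum>r\<in>S. F r * prod D (S - {r}))"
proof -
  have "to_fract (F r * prod D (S - {r})) = to_fract (F r) / to_fract (D r) * to_fract (prod D S)"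
    if "r \<in> S" for r
    using that D prod.remove[OF \<open>finite S\<close> that, of D] by (simp add: field_simps)
  hence "to_fract (\<Sum>r\<in>S. F r * prod D (S - {r})) =
      (\<Sum>r\<in>S. to_fract (F r) / to_fract (D r)) * to_fract (prod D S)"
    unfolding to_fract_sum sum_distrib_right by (rule sum.cong[OF refl])
  moreover have "to_fract (prod D S) \<noteq> 0"
    using D \<open>finite S\<close> by (simp only: to_fract_eq_0_iff) simp
  ultimately have "to_fract g = (\<Sum>r\<in>S. to_fract (F r) / to_fract (D r)) \<longleftrightarrow>
      to_fract (g * prod D S) = to_fract (\<Sum>r\<in>S. F r * prod D (S - {r}))"
    by (simp only: mult_cancel_right to_fract_mult) simp
  thus ?thesis by (simp only: to_fract_eq_iff)
qed

lemma swap_vars_fract_sum: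
  fixes F D :: "'b \<Rightarrow> 'q::linorder xpoly"
  assumes "finite S" and D: "\<And>r. r \<in> S \<Longrightarrow> D r \<noteq> 0"
    and g: "to_fract g = (\<Sum>r\<in>S. to_fract (F r) / to_fract (D r))"
  shows "to_fract (swap_vars p q g) =
    (\<Sum>r\<in>S. to_fract (swap_vars p q (F r)) / to_fract (swap_vars p q (D r)))"
proof -
  have "g * prod D S = (\<Sum>r\<in>S. F r * prod D (S - {r}))"
    using g by (subst fract_sum_clear_denominators[OF assms(1,2), symmetric])
  hence "swap_vars p q (g * prod D S) = swap_vars p q (\<Sum>r\<in>S. F r * prod D (S - {r}))" by simp
  thus ?thesis
    by (subst fract_sum_clear_denominators) (use assms(1,2) in \<open>simp_all del: to_fract_prod\<close>)
qed

lemma fract_sum_poly_in: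
  fixes F D :: "'b \<Rightarrow> 'q::linorder xpoly"
  assumes "finite S" and D: "\<And>r. r \<in> S \<Longrightarrow> D r \<noteq> 0"
    and "to_fract g = (\<Sum>r\<in>S. to_fract (F r) / to_fract (D r))"
    and "\<And>r. r \<in> S \<Longrightarrow> F r \<in> poly_in X" "\<And>r. r \<in> S \<Longrightarrow> D r \<in> poly_in X"
  shows "g \<in> poly_in X"
proof (rule poly_in_cancel)
  have "prod D S * g = (\<Sum>r\<in>S. F r * prod D (S - {r}))"
    using assms(3) by (subst mult.commute, subst fract_sum_clear_denominators[OF assms(1,2), symmetric])
  also have "\<dots> \<in> poly_in X" using assms by (intro poly_in_sum poly_in_mult poly_in_prod) auto
  finally show "prod D S * g \<in> poly_in X" .
qed (use assms in \<open>auto intro!: poly_in_prod\<close>)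

text \<open>The sum is a Newton divided difference: swapping two nodes and dividing by their difference
  passes from \<open>S - {q}\<close> and \<open>S - {p}\<close> to \<open>S\<close>.\<close>

lemma divided_difference_polynomial:
  fixes F :: "nat \<Rightarrow> 'q::linorder xpoly"
  assumes F: "\<And>p q r. p \<in> N \<Longrightarrow> q \<in> N \<Longrightarrow> r \<in> N \<Longrightarrow> swap_vars (i, p) (i, q) (F r) = F (transpose p q r)"
    and "finite S" "S \<subseteq> N"
  shows "\<exists>g. to_fract g = (\<Sum>r\<in>S. to_fract (F r) / to_fract (\<Prod>k\<in>S - {r}. Var (i, r) - Var (i, k)))"
  using assms(2,3)
proof (induction "card S" arbitrary: S rule: less_induct)
  case less
  show ?case
  proof (cases "\<exists>p q. p \<in> S \<and> q \<in> S \<and> p \<noteq> q")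
    case False
    then consider "S = {}" | p where "S = {p}" by blast
    thus ?thesis
    proof cases
      case 1
      thus ?thesis by (intro exI[of _ 0]) simp
    next
      case (2 p)
      thus ?thesis by (intro exI[of _ "F p"]) simp
    qed
  next
    case True
    then obtain p q where pq: "p \<in> S" "q \<in> S" "p \<noteq> q" by blast
    define T where "T = S - {p, q}"
    have T: "S = insert p (insert q T)" "p \<notin> T" "q \<notin> T" "finite T"
      using pq less.prems by (auto simp: T_def)
    have "card (insert p T) < card S" using T pq by simp
    from less.hyps[OF this] obtain g where
      g: "to_fract g = (\<Sum>r\<in>insert p T. to_fract (F r) / to_fract (\<Prod>k\<in>insert p T - {r}. Var (i, r) - Var (i, k)))"
      using less.prems T by auto
    have "to_fract (swap_vars (i, p) (i, q) g) = (\<Sum>r\<in>insert p T. to_fract (swap_vars (i, p) (i, q) (F r)) /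
      to_fract (swap_vars (i, p) (i, q) (\<Prod>k\<in>insert p T - {r}. Var (i, r) - Var (i, k))))"
      by (rule swap_vars_fract_sum[OF _ _ g]) (use T in auto)
    also have "\<dots> = to_fract (F q) / to_fract (\<Prod>k\<in>T. Var (i, q) - Var (i, k)) +
        (\<Sum>r\<in>T. to_fract (F r) / to_fract ((\<Prod>k\<in>T - {r}. Var (i, r) - Var (i, k)) * (Var (i, r) - Var (i, q))))"
    proof -
      have tr: "transpose p q k = k" if "k \<in> T" for k using that T by (auto simp: transpose_def)
      have trp: "transpose (i, p) (i, q) (i, k) = (i, k)" if "k \<in> T" for k
        using that T by (auto simp: transpose_def)
      have "insert p T - {r} = insert p (T - {r})" if "r \<in> T" for r using that T by auto
      moreover have "swap_vars (i, p) (i, q) (\<Prod>k\<in>T - {r}. Var (i, r) - Var (i, k)) =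
          (\<Prod>k\<in>T - {r}. Var (i, r) - Var (i, k))" if "r \<in> T" for r
        using that by (auto simp: trp intro!: prod.cong)
      moreover have "swap_vars (i, p) (i, q) (\<Prod>k\<in>T. Var (i, p) - Var (i, k)) = (\<Prod>k\<in>T. Var (i, q) - Var (i, k))"
        by (auto simp: trp intro!: prod.cong)
      ultimately show ?thesis
        using T less.prems
        by (auto simp: F tr trp mult.commute simp del: to_fract_prod swap_vars_simps(12) intro!: sum.cong)
    qed
    finally have sg: "to_fract (swap_vars (i, p) (i, q) g) =
        to_fract (F q) / to_fract (\<Prod>k\<in>T. Var (i, q) - Var (i, k)) +
        (\<Sum>r\<in>T. to_fract (F r) / to_fract ((\<Prod>k\<in>T - {r}. Var (i, r) - Var (i, k)) * (Var (i, r) - Var (i, q))))" .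
    have g': "to_fract g = to_fract (F p) / to_fract (\<Prod>k\<in>T. Var (i, p) - Var (i, k)) +
        (\<Sum>r\<in>T. to_fract (F r) / to_fract ((\<Prod>k\<in>T - {r}. Var (i, r) - Var (i, k)) * (Var (i, r) - Var (i, p))))"
    proof -
      have "insert p T - {r} = insert p (T - {r})" if "r \<in> T" for r using that T by auto
      thus ?thesis unfolding g using T by (auto simp: mult.commute simp del: to_fract_prod intro!: sum.cong)
    qed
    define X where "X k = to_fract (Var (i, k) :: 'q xpoly)" for k
    have X: "X a - X b \<noteq> 0" if "a \<noteq> b" for a b using that by (simp add: X_def)
    let ?h = "ddiff (i, p) (i, q) g"
    have "(X p - X q) * to_fract ?h = to_fract g - to_fract (swap_vars (i, p) (i, q) g)"
      using arg_cong[OF ddiff_mult[of "(i, p)" "(i, q)" g], of to_fract] pq by (simp add: X_def)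
    hence "to_fract ?h = (to_fract g - to_fract (swap_vars (i, p) (i, q) g)) / (X p - X q)"
      using X[OF pq(3)] by (simp add: field_simps)
    also have "to_fract g - to_fract (swap_vars (i, p) (i, q) g) =
        to_fract (F p) / (\<Prod>k\<in>T. X p - X k) - to_fract (F q) / (\<Prod>k\<in>T. X q - X k) +
        (\<Sum>r\<in>T. to_fract (F r) / ((\<Prod>k\<in>T - {r}. X r - X k) * (X r - X p)) -
           to_fract (F r) / ((\<Prod>k\<in>T - {r}. X r - X k) * (X r - X q)))"
      unfolding g' sg by (simp add: sum_subtractf X_def)
    also have "\<dots> / (X p - X q) =
        to_fract (F p) / ((X p - X q) * (\<Prod>k\<in>T. X p - X k)) + to_fract (F q) / ((X q - X p) * (\<Prod>k\<in>T. X q - X k)) +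
        (\<Sum>r\<in>T. (to_fract (F r) / ((\<Prod>k\<in>T - {r}. X r - X k) * (X r - X p)) -
           to_fract (F r) / ((\<Prod>k\<in>T - {r}. X r - X k) * (X r - X q))) / (X p - X q))"
    proof -
      have "(a / A - b / B + s) / d = a / (d * A) + b / ((- d) * B) + s / d"
        for a b A B s d :: "'q xpoly fract"
        by (simp add: add_divide_distrib diff_divide_distrib mult.commute)
      from this[of _ _ _ _ _ "X p - X q"] show ?thesis
        unfolding minus_diff_eq sum_divide_distrib[symmetric] .
    qed
    also have "(\<Sum>r\<in>T. (to_fract (F r) / ((\<Prod>k\<in>T - {r}. X r - X k) * (X r - X p)) -
           to_fract (F r) / ((\<Prod>k\<in>T - {r}. X r - X k) * (X r - X q))) / (X p - X q)) =
        (\<Sum>r\<in>T. to_fract (F r) / ((X r - X p) * ((X r - X q) * (\<Prod>k\<in>T - {r}. X r - X k))))"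
    proof (rule sum.cong[OF refl])
      fix r assume r: "r \<in> T"
      \<comment> \<open>Partial fractions: the difference of the reciprocals of
        \<open>X r - X p\<close> and \<open>X r - X q\<close> is \<open>X p - X q\<close> over their
        product, which cancels the outer denominator.\<close>
      have "(a / (d * (X r - X p)) - a / (d * (X r - X q))) / (X p - X q) =
          a / ((X r - X p) * ((X r - X q) * d))" if "d \<noteq> 0" for a d
        using X[of r p] X[of r q] X[OF pq(3)] r T that by (auto simp: divide_simps) (simp add: algebra_simps)
      moreover have "(\<Prod>k\<in>T - {r}. X r - X k) \<noteq> 0" using X T by auto
      ultimately show "(to_fract (F r) / ((\<Prod>k\<in>T - {r}. X r - X k) * (X r - X p)) -
           to_fract (F r) / ((\<Prod>k\<in>T - {r}. X r - X k) * (X r - X q))) / (X p - X q) =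
        to_fract (F r) / ((X r - X p) * ((X r - X q) * (\<Prod>k\<in>T - {r}. X r - X k)))" by blast
    qed
    also have "to_fract (F p) / ((X p - X q) * (\<Prod>k\<in>T. X p - X k)) + to_fract (F q) / ((X q - X p) * (\<Prod>k\<in>T. X q - X k)) +
        (\<Sum>r\<in>T. to_fract (F r) / ((X r - X p) * ((X r - X q) * (\<Prod>k\<in>T - {r}. X r - X k)))) =
        (\<Sum>r\<in>S. to_fract (F r) / (\<Prod>k\<in>S - {r}. X r - X k))"
    proof -
      have "insert p (insert q T) - {r} = insert p (insert q (T - {r}))" if "r \<in> T" for r using that T by auto
      moreover have "insert p (insert q T) - {p} = insert q T" "insert p (insert q T) - {q} = insert p T"
        using T pq by auto
      ultimately show ?thesis unfolding T(1) using T pq by (simp add: add.assoc cong: sum.cong)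
    qed
    finally show ?thesis by (intro exI[of _ ?h]) (simp add: X_def)
  qed
qed

section \<open>Leading coefficients of Laurent series\<close>

lemma field_subring_to_fract:
  assumes "0 \<in> S" "1 \<in> S" "\<And>f g. f \<in> S \<Longrightarrow> g \<in> S \<Longrightarrow> f + g \<in> S"
    "\<And>f g. f \<in> S \<Longrightarrow> g \<in> S \<Longrightarrow> f * g \<in> S" "\<And>f. f \<in> S \<Longrightarrow> - f \<in> S"
  shows "field_subring (to_fract ` S)"
proof
  show "0 \<in> to_fract ` S" "1 \<in> to_fract ` S"
    using assms(1,2) by (metis imageI to_fract_0, metis imageI to_fract_1)
qed (use assms(3-5) in \<open>auto simp flip: to_fract_add to_fract_mult to_fract_uminus\<close>)

definition lead :: "'a::field fls \<Rightarrow> 'a" where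
  "lead s = fls_nth s (fls_subdegree s)"

lemma lead_mult: "lead (s * t) = lead s * lead t"
  by (cases "s = 0 \<or> t = 0") (auto simp: lead_def fls_times_base)

lemma lead_1 [simp]: "lead 1 = 1"
  by (simp add: lead_def)

lemma lead_const [simp]: "lead (fls_const c) = c"
  by (simp add: lead_def)

lemma lead_inverse: "s \<noteq> 0 \<Longrightarrow> lead (inverse s) = inverse (lead s)"
  using lead_mult[of s "inverse s"] by (simp add: inverse_unique)

lemma subdegree_linear:
  fixes c :: "'a::field"
  assumes "a \<noteq> 0"
  shows "fls_subdegree (fls_const a * fls_X_inv + fls_const c) = - 1"
  by (rule fls_subdegree_eqI) (use assms in auto)

lemma lead_linear:
  fixes c :: "'a::field"
  assumes "a \<noteq> 0"
  shows "lead (fls_const a * fls_X_inv + fls_const c) = a"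
  unfolding lead_def subdegree_linear[OF assms] by simp

text \<open>Series whose leading coefficient is a nonzero element of \<open>C(hbar)\<close>; they
  can be inverted over any subring containing the constants.\<close>

definition scalar_lead :: "'q::linorder xpoly fract fls set" where
  "scalar_lead = {s. \<exists>c. c \<noteq> 0 \<and> lead s = to_fract (Const c)}"

lemma scalar_lead_mult: "s \<in> scalar_lead \<Longrightarrow> t \<in> scalar_lead \<Longrightarrow> s * t \<in> scalar_lead"
proof -
  assume "s \<in> scalar_lead" "t \<in> scalar_lead"
  then obtain c d where "c \<noteq> 0" "d \<noteq> 0" "lead s = to_fract (Const c)" "lead t = to_fract (Const d)"
    by (auto simp: scalar_lead_def)
  thus ?thesis by (auto simp: scalar_lead_def lead_mult intro!: exI[of _ "c * d"])
qed

lemma scalar_lead_nonzero: "s \<in> scalar_lead \<Longrightarrow> s \<noteq> 0"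
  by (auto simp: scalar_lead_def lead_def)

lemma to_fract_Const_inverse: "c \<noteq> 0 \<Longrightarrow> to_fract (Const (inverse c)) = inverse (to_fract (Const c))"
  by (rule inverse_unique[symmetric]) (simp flip: to_fract_mult Const_mult)

lemma scalar_lead_inverse: "s \<in> scalar_lead \<Longrightarrow> inverse s \<in> scalar_lead"
proof -
  assume s: "s \<in> scalar_lead"
  then obtain c where "c \<noteq> 0" "lead s = to_fract (Const c)" by (auto simp: scalar_lead_def)
  thus ?thesis using scalar_lead_nonzero[OF s]
    by (auto simp: scalar_lead_def lead_inverse to_fract_Const_inverse intro!: exI[of _ "inverse c"])
qed

lemma scalar_lead_const: "c \<noteq> 0 \<Longrightarrow> fls_const (to_fract (Const c)) \<in> scalar_lead"
  by (auto simp: scalar_lead_def)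

lemma scalar_lead_1: "1 \<in> scalar_lead"
  by (auto simp: scalar_lead_def intro!: exI[of _ 1])

lemma scalar_lead_divide: "s \<in> scalar_lead \<Longrightarrow> t \<in> scalar_lead \<Longrightarrow> s / t \<in> scalar_lead"
  by (simp add: divide_inverse scalar_lead_mult scalar_lead_inverse)

lemma scalar_lead_prod: "(\<And>i. i \<in> I \<Longrightarrow> f i \<in> scalar_lead) \<Longrightarrow> prod f I \<in> scalar_lead"
  by (induction I rule: infinite_finite_induct) (auto simp: scalar_lead_1 scalar_lead_mult)

lemma scalar_lead_prod_mset: "(\<And>i. i \<in># M \<Longrightarrow> f i \<in> scalar_lead) \<Longrightarrow> (\<Prod>i\<in>#M. f i) \<in> scalar_lead"
  by (induction M) (auto simp: scalar_lead_1 scalar_lead_mult)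

lemma over_inverse_scalar_lead:
  assumes "field_subring (to_fract ` S)" "range Const \<subseteq> S"
    and s: "s \<in> field_subring.over (to_fract ` S)" "s \<in> scalar_lead"
  shows "inverse s \<in> field_subring.over (to_fract ` S)"
proof -
  interpret field_subring "to_fract ` S" by fact
  obtain c where "c \<noteq> 0" "lead s = to_fract (Const c)" using s(2) by (auto simp: scalar_lead_def)
  hence "inverse (fls_nth s (fls_subdegree s)) = to_fract (Const (inverse c))"
    by (simp add: to_fract_Const_inverse lead_def)
  thus ?thesis using assms(2) s(1) by (intro over_inverse) auto
qed

section \<open>Variables attached to the vertices of the quiver\<close>

context iyangian_data
begin

text \<open>A vertex and its image under \<tau> share the same variables up to sign; this is the one
  of the two that lies in \<open>Qp\<close> and names them.\<close>

definition pos_rep :: "'q \<Rightarrow> 'q" where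
  "pos_rep j = (if j \<in> Qp then j else \<tau> j)"

lemma Qp_verts: "j \<in> Qp \<Longrightarrow> j \<in> verts Q"
  using partition(1) by blast

lemma tau_not_Qp: "j \<in> Qp \<Longrightarrow> \<tau> j \<notin> Qp"
  using partition(2) tau_partition(1) by blast

lemma tau_Qp: "j \<in> verts Q \<Longrightarrow> j \<notin> Qp \<Longrightarrow> \<tau> j \<in> Qp"
  using partition(1) tau_partition(2) by blast

lemma pos_rep_Qp: "j \<in> verts Q \<Longrightarrow> pos_rep j \<in> Qp"
  by (simp add: pos_rep_def tau_Qp)

lemma pos_rep_tau: "j \<in> verts Q \<Longrightarrow> pos_rep (\<tau> j) = pos_rep j"
  by (auto simp: pos_rep_def tau_Qp tau_not_Qp tau_invol)

lemma v_pos_rep: "j \<in> verts Q \<Longrightarrow> v (pos_rep j) = v j"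
  by (simp add: pos_rep_def v_invariant)

lemma xvar_eq: "xvar j k = (if j \<in> Qp then Var (pos_rep j, k) else - Var (pos_rep j, k))"
  by (simp add: xvar_def pos_rep_def)

lemma xvar_P: "j \<in> verts Q \<Longrightarrow> k \<in> {1..v j} \<Longrightarrow> xvar j k \<in> P"
  using pos_rep_Qp v_pos_rep by (auto simp: xvar_eq P_eq vset_def intro!: poly_in_Var poly_in_uminus)

lemma xvar_diff_nonzero: "r \<noteq> k \<Longrightarrow> xvar j r - xvar j k \<noteq> 0"
  by (auto simp: xvar_eq)

lemma swap_xvar:
  "swap_vars (w, p) (w, q) (xvar j k) = xvar j (if pos_rep j = w then transpose p q k else k)"
  by (auto simp: xvar_eq transpose_def)

lemma P_inv_swap':
  assumes "f \<in> P_inv" "w \<in> Qp" "p \<in> {1..v w}" "q \<in> {1..v w}"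
  shows "swap_vars (w, p) (w, q) f = f"
proof -
  have "perm_vars ((\<lambda>_. id)(w := transpose p q)) f = f"
    using assms by (intro perm_vars_single_invariant[of "v w"] permutes_swap_id) (auto simp: P_inv_iff)
  thus ?thesis unfolding perm_vars_transpose .
qed

lemma P_inv_I:
  assumes "f \<in> P" "\<And>w p q. w \<in> Qp \<Longrightarrow> p \<in> {1..v w} \<Longrightarrow> q \<in> {1..v w} \<Longrightarrow> swap_vars (w, p) (w, q) f = f"
  shows "f \<in> P_inv"
  using assms by (simp add: P_inv_iff)

text \<open>Swapping two variables permutes the factors and moves the omitted index along. Products
  over all indices are treated by omitting 0, which is not an index and is fixed by the
  transposition.\<close>

lemma prod_swap_reindex:
  assumes "j \<in> verts Q" "p \<in> {1..v w}" "q \<in> {1..v w}" "pos_rep j = w \<Longrightarrow> r' = transpose p q r" "pos_rep j \<noteq> w \<Longrightarrow> r' = r"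
  shows "(\<Prod>k\<in>{1..v j} - {r}. g (if pos_rep j = w then transpose p q k else k)) = (\<Prod>k\<in>{1..v j} - {r'}. g k)"
proof (cases "pos_rep j = w")
  case True
  hence pq: "p \<in> {1..v j}" "q \<in> {1..v j}" using assms v_pos_rep by auto
  have inj: "inj (transpose p q)" by simp
  have "transpose p q ` ({1..v j} - {r}) = {1..v j} - {r'}"
    using image_set_diff[OF inj, of "{1..v j}" "{r}"] permutes_image[OF permutes_swap_id[OF pq]]
      True assms(4) by simp
  thus ?thesis using prod.reindex[OF inj_on_subset[OF inj subset_UNIV], of g "{1..v j} - {r}"] True
    by simp
qed (use assms in auto)

lemma emb_simps [simp]:
  "emb (f + g) = emb f + emb g" "emb (f - g) = emb f - emb g" "emb (f * g) = emb f * emb g"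
  "emb (- f) = - emb f" "emb 0 = 0" "emb 1 = 1"
  by (simp_all add: emb_def fls_plus_const fls_minus_const)

lemma emb_prod: "emb (prod h S) = (\<Prod>x\<in>S. emb (h x))"
  by (induction S rule: infinite_finite_induct) simp_all

lemma emb_prod_mset: "emb (\<Prod>x\<in>#M. h x) = (\<Prod>x\<in>#M. emb (h x))"
  by (induction M) simp_all

lemma hb_half: "hb / 2 = emb (Const (hbar / 2))"
proof -
  have "hb = emb (Const (hbar / 2)) * 2"
    by (simp add: hb_def flip: emb_simps(1) Const_add add: mult_2_right)
  moreover have "(2 :: 'q xpoly fract fls) \<noteq> 0"
    by (metis fls_const_eq_0_iff fls_const_numeral zero_neq_numeral)
  ultimately show ?thesis by (simp add: eq_divide_eq)
qed

lemma dop_eq: "dop i r = poly_subst (\<lambda>y. if y = (pos_rep i, r)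
    then Var y + Const (if i \<in> Qp then hbar else - hbar) else Var y)"
  by (auto simp: dop_def pos_rep_def intro!: arg_cong[where f = poly_subst])

lemma dop_simps:
  "dop i r (f + g) = dop i r f + dop i r g" "dop i r (Const c * f) = Const c * dop i r f"
  by (simp_all add: dop_eq)

lemma dop_P: "f \<in> P \<Longrightarrow> dop i r f \<in> P"
  unfolding dop_eq P_eq by (erule poly_in_poly_subst) auto

lemma swap_dop:
  "swap_vars (w, p) (w, q) (dop i r f) =
    dop i (if pos_rep i = w then transpose p q r else r) (swap_vars (w, p) (w, q) f)"
proof -
  have "transpose (w, p) (w, q) y = (pos_rep i, if pos_rep i = w then transpose p q r else r) \<longleftrightarrow> y = (pos_rep i, r)"
    for y :: "'q \<times> nat"
    by (cases y) (auto simp: transpose_def split: if_splits)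
  thus ?thesis
    unfolding dop_eq swap_vars_def poly_subst_poly_subst
    by (intro arg_cong2[where f = poly_subst]) auto
qed

text \<open>The numerator of the coefficient of order \<open>n\<close> in the summand
  \<open>r\<close>, applied to \<open>f\<close>. The case distinction is the expansion of
  \<open>1 / (-z - x - hbar/2)\<close> at infinity, which has no terms of order below 1.\<close>

definition b_num :: "'q \<Rightarrow> int \<Rightarrow> 'q xpoly \<Rightarrow> nat \<Rightarrow> 'q xpoly" where
  "b_num i n f r =
     (if n \<ge> 1 then - ((- xvar i r - Const (hbar / 2)) ^ nat (n - 1)) else 0) *
     (if i \<rightarrow>\<^bsub>Q\<^esub> \<tau> i then \<Prod>k\<in>{1..v (\<tau> i)} - {r}. xvar i r + Const (hbar / 2) - xvar (\<tau> i) k else 1) *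
     (\<Prod>j\<in>{j \<in> verts Q. j \<noteq> \<tau> i \<and> i \<rightarrow>\<^bsub>Q\<^esub> j}. \<Prod>k\<in>{1..v j}. xvar i r + Const (hbar / 2) - xvar j k) *
     (\<Prod>c\<in>#R (\<tau> i). xvar (\<tau> i) r - Const (to_fract [:c:]) * Const hbar) * dop i r f"

definition b_den :: "'q \<Rightarrow> nat \<Rightarrow> 'q xpoly" where
  "b_den i r = (\<Prod>k\<in>{1..v i} - {r}. xvar i r - xvar i k)"

lemma b_summand_nth:
  "fls_nth (b_summand i r * emb (dop i r f)) n = to_fract (b_num i n f r) / to_fract (b_den i r)"
proof -
  define u where "u = xvar i r + Const (hbar / 2)"
  define L where "L = (if n \<ge> 1 then - ((- xvar i r - Const (hbar / 2)) ^ nat (n - 1)) else 0)"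
  define A where "A = (if i \<rightarrow>\<^bsub>Q\<^esub> \<tau> i then \<Prod>k\<in>{1..v (\<tau> i)} - {r}. u - xvar (\<tau> i) k else 1)"
  define B where "B = (\<Prod>j\<in>{j \<in> verts Q. j \<noteq> \<tau> i \<and> i \<rightarrow>\<^bsub>Q\<^esub> j}. \<Prod>k\<in>{1..v j}. u - xvar j k)"
  define C where "C = (\<Prod>c\<in>#R (\<tau> i). xvar (\<tau> i) r - Const (to_fract [:c:]) * Const hbar)"
  define d D where "d = dop i r f" and "D = b_den i r"
  have num: "b_num i n f r = L * A * B * C * d"
    unfolding b_num_def L_def A_def B_def C_def d_def u_def ..
  have L: "to_fract L = - (if n \<ge> 1 then to_fract (- u) ^ nat (n - 1) else 0)"
  proof -
    have "to_fract (g ^ m) = to_fract g ^ m" for g :: "'q xpoly" and m by (induction m) simp_all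
    thus ?thesis by (simp add: L_def u_def)
  qed
  have "1 / (- zv - emb (xvar i r) - hb / 2) = - (1 / (fls_X_inv - fls_const (to_fract (- u))))"
  proof -
    have "- zv - emb (xvar i r) - hb / 2 = - (fls_X_inv - fls_const (to_fract (- u)))"
      unfolding hb_half zv_def emb_def u_def by (simp flip: fls_plus_const fls_minus_const)
    thus ?thesis by (simp only: minus_divide_right)
  qed
  moreover have "(if i \<rightarrow>\<^bsub>Q\<^esub> \<tau> i then V_del (\<tau> i) r (emb (xvar i r) + hb / 2) else 1) = emb A"
    by (simp add: V_del_def hb_half emb_prod A_def u_def)
  moreover have "(\<Prod>j\<in>{j \<in> verts Q. j \<noteq> \<tau> i \<and> i \<rightarrow>\<^bsub>Q\<^esub> j}. V j (emb (xvar i r) + hb / 2)) = emb B"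
    by (simp add: V_def hb_half emb_prod B_def u_def)
  moreover have "pfun (\<tau> i) (emb (xvar (\<tau> i) r)) = emb C"
    by (simp add: pfun_def hb_def emb_prod_mset C_def)
  moreover have "V_del i r (emb (xvar i r)) = emb D"
    by (simp add: V_del_def b_den_def emb_prod D_def)
  ultimately have "b_summand i r * emb (dop i r f) =
      - (1 / (fls_X_inv - fls_const (to_fract (- u)))) * emb A * emb B * (emb C / emb D) * emb d"
    unfolding b_summand_def d_def by simp
  also have "\<dots> = - (1 / (fls_X_inv - fls_const (to_fract (- u)))) *
      fls_const (to_fract A * to_fract B * (to_fract C / to_fract D) * to_fract d)"
    unfolding emb_def fls_const_divide_const fls_const_mult_const[symmetric] by (simp only: mult.assoc)
  finally have "fls_nth (b_summand i r * emb (dop i r f)) n =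
      - (if n \<ge> 1 then to_fract (- u) ^ nat (n - 1) else 0) *
      (to_fract A * to_fract B * (to_fract C / to_fract D) * to_fract d)"
    by (simp only: fls_mult_const_nth fls_uminus_nth inverse_X_inv_minus_const)
  thus ?thesis
    unfolding num L[symmetric] D_def[symmetric] by simp
qed

end

lemma fls_nth_sum: "fls_nth (sum f S) n = (\<Sum>x\<in>S. fls_nth (f x) n)"
  by (induction S rule: infinite_finite_induct) simp_all

lemma swap_vars_prod_mset: "swap_vars p q (\<Prod>c\<in>#M. h c) = (\<Prod>c\<in>#M. swap_vars p q (h c))"
  by (induction M) simp_all

text \<open>Stated for an arbitrary ring homomorphism because it serves both the embedding into
  Laurent series and the swaps of variables.\<close>

lemma map_poly_prod_linear:
  fixes h :: "'a::comm_ring_1 \<Rightarrow> 'b::comm_ring_1"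
  assumes h: "h 0 = 0" "h 1 = 1" "\<And>x y. h (x + y) = h x + h y" "\<And>x y. h (x * y) = h x * h y"
    "\<And>x. h (- x) = - h x"
  shows "map_poly h (\<Prod>k\<in>S. [:- x k, 1:]) = (\<Prod>k\<in>S. [:- h (x k), 1:])"
proof -
  have hd: "h (x - y) = h x - h y" for x y using h(3)[of x "- y"] by (simp add: h)
  have "map_poly h ([:- a, 1:] * p) = [:- h a, 1:] * map_poly h p" for a p
  proof (rule poly_eqI)
    fix n show "coeff (map_poly h ([:- a, 1:] * p)) n = coeff ([:- h a, 1:] * map_poly h p) n"
      by (cases n) (simp_all add: coeff_map_poly h hd)
  qed
  moreover have "map_poly h 1 = 1" using h(1,2) by (simp add: poly_eq_iff coeff_map_poly)
  ultimately show ?thesis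
    by (induction S rule: infinite_finite_induct) (simp_all del: mult_pCons_left)
qed

lemma minus_one_powi: "(- 1 :: 'a::field) powi n = 1 \<or> (- 1 :: 'a) powi n = - 1"
  by (cases "even (nat n)"; cases "even (nat (- n))") (auto simp: power_int_def)

lemma linear_scalar_lead:
  fixes b :: "'q::linorder xpoly fract"
  assumes "c \<noteq> 0" "s = fls_const (to_fract (Const c)) * fls_X_inv + fls_const b"
  shows "s \<in> scalar_lead"
proof -
  have "to_fract (Const c) \<noteq> (0 :: 'q xpoly fract)" using assms(1) by simp
  from lead_linear[OF this, of b] show ?thesis using assms by (auto simp: scalar_lead_def)
qed

section \<open>The coefficients of \<open>b_i(z)\<close>\<close>

context iyangian_data
begin

lemma b_num_swap:
  assumes i: "i \<in> verts Q" and f: "f \<in> P_inv" and w: "w \<in> Qp" "p \<in> {1..v w}" "q \<in> {1..v w}"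
  shows "swap_vars (w, p) (w, q) (b_num i n f r) = b_num i n f (if pos_rep i = w then transpose p q r else r)"
proof -
  let ?r = "if pos_rep i = w then transpose p q r else r"
  let ?s = "swap_vars (w, p) (w, q)"
  have "?s (\<Prod>k\<in>{1..v (\<tau> i)} - {r}. xvar i r + Const (hbar / 2) - xvar (\<tau> i) k) =
      (\<Prod>k\<in>{1..v (\<tau> i)} - {?r}. xvar i ?r + Const (hbar / 2) - xvar (\<tau> i) k)"
    unfolding swap_vars_simps swap_xvar
    by (rule prod_swap_reindex[OF tau_verts[OF i] w(2,3)]) (use pos_rep_tau[OF i] in auto)
  hence A: "?s (if i \<rightarrow>\<^bsub>Q\<^esub> \<tau> i then \<Prod>k\<in>{1..v (\<tau> i)} - {r}. xvar i r + Const (hbar / 2) - xvar (\<tau> i) k else 1) =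
      (if i \<rightarrow>\<^bsub>Q\<^esub> \<tau> i then \<Prod>k\<in>{1..v (\<tau> i)} - {?r}. xvar i ?r + Const (hbar / 2) - xvar (\<tau> i) k else 1)"
    by (simp del: swap_vars_simps(12))
  have "?s (\<Prod>k\<in>{1..v j}. xvar i r + Const (hbar / 2) - xvar j k) =
      (\<Prod>k\<in>{1..v j}. xvar i ?r + Const (hbar / 2) - xvar j k)" if "j \<in> verts Q" for j
  proof -
    have e: "{1..v j} = {1..v j} - {0}" by auto
    have "transpose p q 0 = 0" using w by (auto simp: transpose_def)
    thus ?thesis
      unfolding swap_vars_simps swap_xvar
      by (subst (1 2) e) (rule prod_swap_reindex[OF that w(2,3)], auto)
  qed
  hence B: "?s (\<Prod>j\<in>{j \<in> verts Q. j \<noteq> \<tau> i \<and> i \<rightarrow>\<^bsub>Q\<^esub> j}. \<Prod>k\<in>{1..v j}. xvar i r + Const (hbar / 2) - xvar j k) =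
      (\<Prod>j\<in>{j \<in> verts Q. j \<noteq> \<tau> i \<and> i \<rightarrow>\<^bsub>Q\<^esub> j}. \<Prod>k\<in>{1..v j}. xvar i ?r + Const (hbar / 2) - xvar j k)"
    by (subst swap_vars_simps(12), intro prod.cong) auto
  have C: "?s (\<Prod>c\<in>#R (\<tau> i). xvar (\<tau> i) r - Const (to_fract [:c:]) * Const hbar) =
      (\<Prod>c\<in>#R (\<tau> i). xvar (\<tau> i) ?r - Const (to_fract [:c:]) * Const hbar)"
    unfolding swap_vars_prod_mset swap_vars_simps swap_xvar pos_rep_tau[OF i] ..
  have d: "?s (dop i r f) = dop i ?r f"
    unfolding swap_dop using P_inv_swap'[OF f w] by simp
  have L: "?s (if n \<ge> 1 then - ((- xvar i r - Const (hbar / 2)) ^ nat (n - 1)) else 0) =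
      (if n \<ge> 1 then - ((- xvar i ?r - Const (hbar / 2)) ^ nat (n - 1)) else 0)"
    by (simp add: swap_xvar)
  show ?thesis
    unfolding b_num_def swap_vars_simps(3) A B C d L ..
qed

lemma b_den_swap:
  assumes i: "i \<in> verts Q" and w: "p \<in> {1..v w}" "q \<in> {1..v w}"
  shows "swap_vars (w, p) (w, q) (b_den i r) = b_den i (if pos_rep i = w then transpose p q r else r)"
  unfolding b_den_def swap_vars_simps swap_xvar
  by (rule prod_swap_reindex[OF i w]) auto

lemma b_num_P:
  assumes "i \<in> verts Q" "f \<in> P" "r \<in> {1..v i}"
  shows "b_num i n f r \<in> P"
proof -
  have x: "xvar i r \<in> P" "\<And>j k. j \<in> verts Q \<Longrightarrow> k \<in> {1..v j} \<Longrightarrow> xvar j k \<in> P" "xvar (\<tau> i) r \<in> P"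
    using assms by (auto intro: xvar_P simp: tau_verts v_invariant)
  have "(\<Prod>c\<in>#M. xvar (\<tau> i) r - Const (to_fract [:c:]) * Const hbar) \<in> P" for M
    by (induction M) (use x(3) in \<open>auto simp: P_eq intro!: poly_in_mult\<close>)
  thus ?thesis
    unfolding b_num_def using x dop_P[OF assms(2)] tau_verts[OF assms(1)]
    by (auto simp: P_eq intro!: poly_in_mult poly_in_prod)
qed

lemma b_den_nonzero: "b_den i r \<noteq> 0"
proof -
  have "xvar i r \<noteq> xvar i k" if "k \<noteq> r" for k using xvar_diff_nonzero[of r k i] that by auto
  thus ?thesis by (auto simp: b_den_def)
qed

lemma b_den_P: "i \<in> verts Q \<Longrightarrow> r \<in> {1..v i} \<Longrightarrow> b_den i r \<in> P"
  using xvar_P by (auto simp: b_den_def P_eq intro!: poly_in_prod)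

text \<open>Swaps of the nodes permute the numerators, so the sum is a divided difference and hence
  a polynomial. It is symmetric because a swap at the vertex itself permutes the summands and a swap
  at another vertex fixes each of them.\<close>

lemma b_sum_polynomial:
  assumes i: "i \<in> verts Q" and f: "f \<in> P_inv"
  obtains g where "g \<in> P_inv"
    "fls_nth (\<Sum>r\<in>{1..v i}. b_summand i r * emb (dop i r f)) n = to_fract g"
proof -
  let ?N = "{1..v i}"
  \<comment> \<open>At a vertex outside \<open>Qp\<close> all variables are negated, so the
    denominators differ from those of Newton interpolation by a sign independent of
    \<open>r\<close>. As the sign squares to 1, it can be moved into the numerators.\<close>
  define c :: "'q xpoly" where "c = (if i \<in> Qp then 1 else (- 1) ^ (v i - 1))"
  have c: "c * c = 1" by (simp add: c_def flip: power_add mult_2)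
  have sc: "swap_vars p q c = c" for p q by (simp add: c_def)
  have den: "b_den i r = c * (\<Prod>k\<in>?N - {r}. Var (pos_rep i, r) - Var (pos_rep i, k))" if "r \<in> ?N" for r
  proof (cases "i \<in> Qp")
    case False
    have "b_den i r = (\<Prod>k\<in>?N - {r}. (- 1) * (Var (pos_rep i, r) - Var (pos_rep i, k)))"
      unfolding b_den_def by (rule prod.cong) (use False in \<open>auto simp: xvar_eq\<close>)
    also have "\<dots> = (- 1) ^ card (?N - {r}) * (\<Prod>k\<in>?N - {r}. Var (pos_rep i, r) - Var (pos_rep i, k))"
      by (simp only: prod.distrib prod_constant)
    finally show ?thesis using False that by (simp add: c_def)
  qed (simp add: b_den_def xvar_eq c_def)
  let ?F = "\<lambda>r. c * b_num i n f r"
  have vN: "v (pos_rep i) = v i" using v_pos_rep[OF i] .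
  have "swap_vars (pos_rep i, p) (pos_rep i, q) (?F r) = ?F (transpose p q r)"
    if "p \<in> ?N" "q \<in> ?N" "r \<in> ?N" for p q r
    using b_num_swap[OF i f pos_rep_Qp[OF i], of p q] that vN sc by simp
  from divided_difference_polynomial[of ?N "pos_rep i" ?F, OF this, of ?N]
  obtain g where g: "to_fract g = (\<Sum>r\<in>?N. to_fract (?F r) /
      to_fract (\<Prod>k\<in>?N - {r}. Var (pos_rep i, r) - Var (pos_rep i, k)))" by auto
  have "to_fract (?F r) / to_fract (\<Prod>k\<in>?N - {r}. Var (pos_rep i, r) - Var (pos_rep i, k)) =
      to_fract (b_num i n f r) / to_fract (b_den i r)" if "r \<in> ?N" for r
  proof -
    have "to_fract c * to_fract c = 1" using c by (metis to_fract_1 to_fract_mult)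
    moreover from this have c0: "to_fract c \<noteq> 0" by auto
    ultimately have "to_fract c * x / y = x / (to_fract c * y)" for x y :: "'q xpoly fract"
      using mult_divide_mult_cancel_left[OF c0, of "to_fract c * x" y] by (simp flip: mult.assoc)
    thus ?thesis unfolding den[OF that] by (simp del: to_fract_prod)
  qed
  hence g': "to_fract g = (\<Sum>r\<in>?N. to_fract (b_num i n f r) / to_fract (b_den i r))"
    unfolding g by (rule sum.cong[OF refl])
  have "g \<in> P_inv"
  proof (rule P_inv_I)
    show "g \<in> P" unfolding P_eq
      by (rule fract_sum_poly_in[OF _ _ g'])
        (use b_den_nonzero b_den_P[OF i] b_num_P[OF i P_inv_P[OF f]] in \<open>auto simp: P_eq\<close>)
    fix w p q assume w: "w \<in> Qp" "p \<in> {1..v w}" "q \<in> {1..v w}"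
    let ?t = "\<lambda>r. if pos_rep i = w then transpose p q r else r"
    have "to_fract (swap_vars (w, p) (w, q) g) =
        (\<Sum>r\<in>?N. to_fract (b_num i n f (?t r)) / to_fract (b_den i (?t r)))"
      using swap_vars_fract_sum[OF _ _ g', of "(w, p)" "(w, q)"] b_den_nonzero
      unfolding b_num_swap[OF i f w] b_den_swap[OF i w(2,3)] by simp
    also have "\<dots> = to_fract g"
    proof (cases "pos_rep i = w")
      case True
      hence "transpose p q permutes ?N" using w vN by (intro permutes_swap_id) auto
      from sum.permute[OF this, of "\<lambda>r. to_fract (b_num i n f r) / to_fract (b_den i r)"] show ?thesis
        using True unfolding g' by (simp add: comp_def)
    qed (simp add: g')
    finally show "swap_vars (w, p) (w, q) g = g" by simp
  qed
  thus ?thesis using that g' by (simp add: fls_nth_sum b_summand_nth)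
qed

lemma b_coeff_closed:
  assumes i: "i \<in> verts Q"
  shows "b_coeff i n \<in> carrier (End_algebra P_inv)"
  unfolding End_algebra_carrier
proof (intro conjI ballI allI)
  let ?S = "\<lambda>f. \<Sum>r\<in>{1..v i}. b_summand i r * emb (dop i r f)"
  have b: "b_coeff i n f = g" if "f \<in> P_inv" "fls_nth (?S f) n = to_fract g" for f g
    using that by (simp add: b_coeff_def)
  show "b_coeff i n \<in> extensional P_inv" by (simp add: b_coeff_def)
  fix f assume f: "f \<in> P_inv"
  obtain f' where f': "f' \<in> P_inv" "fls_nth (?S f) n = to_fract f'" by (rule b_sum_polynomial[OF i f])
  show "b_coeff i n f \<in> P_inv" using b[OF f f'(2)] f'(1) by simp
  show "b_coeff i n (Const c * f) = Const c * b_coeff i n f" for c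
  proof -
    have "?S (Const c * f) = fls_const (to_fract (Const c)) * ?S f"
      unfolding sum_distrib_left
      by (rule sum.cong) (auto simp: dop_simps mult.left_commute emb_def simp flip: fls_const_mult_const)
    hence *: "fls_nth (?S (Const c * f)) n = to_fract (Const c * f')" using f' by simp
    show ?thesis using b[OF _ *] b[OF f f'(2)] f by simp
  qed
  fix g assume g: "g \<in> P_inv"
  obtain g' where g': "g' \<in> P_inv" "fls_nth (?S g) n = to_fract g'" by (rule b_sum_polynomial[OF i g])
  have "?S (f + g) = ?S f + ?S g"
    by (simp add: dop_simps distrib_left sum.distrib)
  hence *: "fls_nth (?S (f + g)) n = to_fract (f' + g')" using f' g' by simp
  show "b_coeff i n (f + g) = b_coeff i n f + b_coeff i n g"
    using b[OF _ *] b[OF f f'(2)] b[OF g g'(2)] f g by simp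
qed

section \<open>The coefficients of \<open>h_i(z)\<close>\<close>

definition V_poly :: "'q \<Rightarrow> 'q xpoly poly" where
  "V_poly j = (\<Prod>k\<in>{1..v j}. [:- xvar j k, 1:])"

lemma V_eq_poly: "V j w = poly (map_poly emb (V_poly j)) w"
  unfolding V_poly_def V_def
  by (subst map_poly_prod_linear) (simp_all add: poly_prod)

lemma coeff_V_poly:
  assumes j: "j \<in> verts Q" shows "coeff (V_poly j) n \<in> P_inv"
proof (rule P_inv_I)
  have "coeff (\<Prod>k\<in>S. [:- xvar j k, 1:]) n \<in> P" if "finite S" "S \<subseteq> {1..v j}" for S
    using that
  proof (induction S arbitrary: n rule: finite_induct)
    case empty
    show ?case by (cases n) (simp_all add: P_eq)
  next
    case (insert k S)
    thus ?case using xvar_P[OF j, of k] by (cases n) (auto simp: P_eq)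
  qed
  thus "coeff (V_poly j) n \<in> P" by (simp add: V_poly_def)
  fix w p q assume w: "w \<in> Qp" "p \<in> {1..v w}" "q \<in> {1..v w}"
  have "map_poly (swap_vars (w, p) (w, q)) (V_poly j) =
      (\<Prod>k\<in>{1..v j}. [:- swap_vars (w, p) (w, q) (xvar j k), 1:])"
    unfolding V_poly_def by (rule map_poly_prod_linear) simp_all
  also have "\<dots> = V_poly j"
  proof -
    have "{1..v j} = {1..v j} - {0}" by auto
    moreover have "transpose p q 0 = 0" using w by (auto simp: transpose_def)
    ultimately show ?thesis unfolding V_poly_def swap_xvar
      using prod_swap_reindex[OF j w(2,3), of 0 0 "\<lambda>k. [:- xvar j k, 1:]"] by simp
  qed
  finally have "coeff (map_poly (swap_vars (w, p) (w, q)) (V_poly j)) n = coeff (V_poly j) n" by simp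
  thus "swap_vars (w, p) (w, q) (coeff (V_poly j) n) = coeff (V_poly j) n"
    by (simp add: coeff_map_poly)
qed

lemma field_subring_P_inv: "field_subring (to_fract ` P_inv)"
  by (rule field_subring_to_fract) auto

interpretation KP: field_subring "to_fract ` P_inv"
  by (rule field_subring_P_inv)

lemma V_over: "j \<in> verts Q \<Longrightarrow> w \<in> KP.over \<Longrightarrow> V j w \<in> KP.over"
  unfolding V_eq_poly poly_altdef
  by (auto intro!: KP.over_sum KP.over_mult KP.over_power simp: coeff_map_poly emb_def coeff_V_poly)

text \<open>The arguments at which the factors of \<open>h_i(z)\<close> are evaluated. With
  \<open>c\<close> nonzero the term in \<open>z\<close> dominates every variable subtracted from it,
  so leading coefficients remain scalars.\<close>

definition linear_z :: "'q xpoly fract fls \<Rightarrow> bool" where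
  "linear_z w \<longleftrightarrow> (\<exists>c d. c \<noteq> 0 \<and> w = fls_const (to_fract (Const c)) * fls_X_inv + emb (Const d))"

lemma linear_z_zv [simp]: "linear_z zv" "linear_z (- zv)" "linear_z (2 * zv)"
    "linear_z (- zv + hb / 2)" "linear_z (- zv - hb / 2)"
  and linear_z_shift: "linear_z w \<Longrightarrow> linear_z (w - emb (Const d) * hb)"
proof -
  have 2: "fls_const (to_fract (Const 2)) = (2 :: 'q xpoly fract fls)"
  proof -
    have "Const 2 = (2 :: 'q xpoly)" using Const_add[of 1 1] by simp
    moreover have "to_fract (2 :: 'q xpoly) = 2" using to_fract_add[of "1 :: 'q xpoly" 1] by simp
    ultimately show ?thesis by simp
  qed
  show "linear_z zv" unfolding linear_z_def zv_def
    by (intro exI[of _ 1] exI[of _ 0]) simp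
  show "linear_z (- zv)" unfolding linear_z_def zv_def
    by (intro exI[of _ "- 1"] exI[of _ 0]) simp
  show "linear_z (2 * zv)" unfolding linear_z_def zv_def
    by (intro exI[of _ 2] exI[of _ 0]) (simp add: 2)
  show "linear_z (- zv + hb / 2)" unfolding linear_z_def zv_def hb_half
    by (intro exI[of _ "- 1"] exI[of _ "hbar / 2"]) simp
  show "linear_z (- zv - hb / 2)" unfolding linear_z_def zv_def hb_half
    by (intro exI[of _ "- 1"] exI[of _ "- (hbar / 2)"]) simp
  assume "linear_z w"
  then obtain c e where c: "c \<noteq> 0" "w = fls_const (to_fract (Const c)) * fls_X_inv + emb (Const e)"
    by (auto simp: linear_z_def)
  show "linear_z (w - emb (Const d) * hb)"
    unfolding linear_z_def hb_def
    by (intro exI[of _ c] exI[of _ "e - d * hbar"]) (simp add: c)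
qed

lemma linear_z_diff_scalar_lead: "linear_z w \<Longrightarrow> w - emb x \<in> scalar_lead"
proof -
  assume "linear_z w"
  then obtain c d where "c \<noteq> 0" "w = fls_const (to_fract (Const c)) * fls_X_inv + emb (Const d)"
    by (auto simp: linear_z_def)
  thus ?thesis
    by (intro linear_scalar_lead[of c _ "to_fract (Const d) - to_fract x"])
      (simp_all add: emb_def flip: fls_minus_const)
qed

lemma linear_z_over: "linear_z w \<Longrightarrow> w \<in> KP.over"
  by (auto simp: linear_z_def emb_def)

lemma linear_z_scalar_lead: "linear_z w \<Longrightarrow> w \<in> scalar_lead"
  using linear_z_diff_scalar_lead[of w 0] by simp

lemma V_scalar_lead: "linear_z w \<Longrightarrow> V j w \<in> scalar_lead"
  unfolding V_def by (intro scalar_lead_prod linear_z_diff_scalar_lead)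

lemma pfun_scalar_lead: "linear_z w \<Longrightarrow> pfun i w \<in> scalar_lead"
  unfolding pfun_def by (intro scalar_lead_prod_mset linear_z_scalar_lead linear_z_shift)

lemma pfun_over: "linear_z w \<Longrightarrow> pfun i w \<in> KP.over"
  unfolding pfun_def by (intro KP.over_prod_mset linear_z_over linear_z_shift)

lemma cartan_tau: "i \<in> verts Q \<Longrightarrow> cartan Q i (\<tau> i) = 0 \<or> cartan Q i (\<tau> i) = - 1"
  using tau_no_fixed[of i] by (auto simp: cartan_def)

lemma inverse_over: "s \<in> KP.over \<Longrightarrow> s \<in> scalar_lead \<Longrightarrow> inverse s \<in> KP.over"
  by (rule over_inverse_scalar_lead[OF field_subring_P_inv]) auto

text \<open>Each factor has symmetric coefficients and is a product or an inverse of linear series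
  with scalar leading coefficients, up to sign. Both properties survive products and
  inverses.\<close>

lemma hser_over_scalar_lead:
  assumes i: "i \<in> verts Q"
  shows "hser i \<in> KP.over" "hser i \<in> scalar_lead"
proof -
  have m1: "- 1 \<in> (scalar_lead :: 'q xpoly fract fls set)"
    using scalar_lead_const[of "- 1"] by simp
  have 1: "(- 1) powi n \<in> KP.over" "(- 1) powi n \<in> (scalar_lead :: 'q xpoly fract fls set)" for n
  proof -
    have e: "(- 1 :: 'q xpoly fract fls) powi n \<in> {1, - 1}"
      using minus_one_powi[of n, where 'a = "'q xpoly fract fls"] by blast
    have "{1, - 1} \<subseteq> KP.over" by auto
    thus "(- 1) powi n \<in> KP.over" using e by (rule subsetD)
    have "{1, - 1} \<subseteq> (scalar_lead :: 'q xpoly fract fls set)" using m1 scalar_lead_1 by simp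
    thus "(- 1) powi n \<in> (scalar_lead :: 'q xpoly fract fls set)" using e by (rule subsetD)
  qed
  have 2: "(2 * zv) powi cartan Q i (\<tau> i) \<in> KP.over" "(2 * zv) powi cartan Q i (\<tau> i) \<in> scalar_lead"
  proof -
    have "(2 * zv) powi cartan Q i (\<tau> i) = 1 \<or> (2 * zv) powi cartan Q i (\<tau> i) = inverse (2 * zv)"
      using cartan_tau[OF i] power_int_0_right[of "2 * zv"] power_int_minus1_right[of "2 * zv"] by metis
    moreover have "inverse (2 * zv) \<in> KP.over" "inverse (2 * zv) \<in> scalar_lead"
      by (intro inverse_over linear_z_over linear_z_scalar_lead scalar_lead_inverse linear_z_zv)+
    ultimately show "(2 * zv) powi cartan Q i (\<tau> i) \<in> KP.over"
        "(2 * zv) powi cartan Q i (\<tau> i) \<in> scalar_lead"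
      using scalar_lead_1 by (metis KP.over_1)+
  qed
  note zvs = linear_z_zv[THEN linear_z_over]
  have d: "s / t \<in> KP.over" if "s \<in> KP.over" "t \<in> KP.over" "t \<in> scalar_lead" for s t
    using that by (simp add: divide_inverse inverse_over)
  show "hser i \<in> KP.over"
    unfolding hser_def
    by (intro KP.over_mult 1 2 d KP.over_prod scalar_lead_mult V_over pfun_over V_scalar_lead
        linear_z_zv zvs i) auto
  show "hser i \<in> scalar_lead"
    unfolding hser_def
    by (intro scalar_lead_mult 1 2 scalar_lead_divide scalar_lead_prod V_scalar_lead
        pfun_scalar_lead linear_z_zv)
qed

lemma hser_nth:
  assumes "i \<in> verts Q"
  obtains g where "g \<in> P_inv" "fls_nth (hser i) n = to_fract g"
  using KP.over_nth[OF hser_over_scalar_lead(1)[OF assms], of n] by auto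

lemma h_coeff_eq:
  "fls_nth (hser i) n = to_fract g \<Longrightarrow> h_coeff i n = (\<lambda>f\<in>P_inv. g * f)"
  by (auto simp: h_coeff_def emb_def fun_eq_iff simp flip: to_fract_mult)

lemma mult_closed: "g \<in> P_inv \<Longrightarrow> (\<lambda>f\<in>P_inv. g * f) \<in> carrier (End_algebra P_inv)"
  by (auto simp: End_algebra_carrier distrib_left mult.left_commute)

lemma h_coeff_closed:
  assumes "i \<in> verts Q" shows "h_coeff i n \<in> carrier (End_algebra P_inv)"
proof -
  obtain g where "g \<in> P_inv" "fls_nth (hser i) n = to_fract g" by (rule hser_nth[OF assms])
  thus ?thesis by (simp add: h_coeff_eq mult_closed)
qed

lemma Y_generators:
  "{b_coeff i n |i n. i \<in> verts Q} \<union> {h_coeff i n |i n. i \<in> verts Q} \<subseteq> carrier (End_algebra P_inv)"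
  using b_coeff_closed h_coeff_closed by auto

lemma poly_subspace_P_inv: "poly_subspace P_inv"
  by unfold_locales auto

lemma Y_carrier_eq: "carrier Y = generated_subalgebra (End_algebra P_inv)
    ({b_coeff i n |i n. i \<in> verts Q} \<union> {h_coeff i n |i n. i \<in> verts Q})"
  by (simp add: Y_def)

lemma Y_carrier: "carrier Y \<subseteq> carrier (End_algebra P_inv)"
  using poly_subspace.generated_closed[OF poly_subspace_P_inv Y_generators] unfolding Y_carrier_eq .

lemma assoc_algebra_Y: "assoc_algebra Y"
  unfolding Y_def by (rule poly_subspace.assoc_algebra_generated[OF poly_subspace_P_inv Y_generators])

end

section \<open>Symmetric polynomials lie in the truncated shifted iYangian\<close>

text \<open>As \<open>a\<close> is its own inverse, the root is \<open>a * y\<close>. The derivative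
  of \<open>z\<close> with respect to its inverse is \<open>- z^2\<close>, which shifts the
  geometric expansion by two places; so the coefficient of order \<open>n\<close> carries the power
  \<open>n + 1\<close> of the root.\<close>

lemma logderiv_linear_nth:
  fixes a y :: "'a::field"
  assumes "a = 1 \<or> a = - 1" "n \<ge> 0"
  shows "fls_nth (logderiv (fls_const a * fls_X_inv - fls_const y)) n = - ((a * y) ^ nat (n + 1))"
proof -
  have aa: "a * a = 1" using assms(1) by auto
  define w :: "'a fls" where "w = fls_X_inv - fls_const (a * y)"
  have "fls_const a * fls_X_inv - fls_const y = fls_const a * w"
    using aa by (simp add: w_def right_diff_distrib fls_const_mult_const flip: mult.assoc)
  moreover have "a \<noteq> 0" using aa by auto
  moreover have "w \<noteq> 0"
  proof
    assume "w = 0"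
    hence "fls_nth w (- 1) = 0" by simp
    thus False by (simp add: w_def)
  qed
  ultimately have "logderiv (fls_const a * fls_X_inv - fls_const y) = logderiv w"
    by (simp add: logderiv_mult)
  also have "\<dots> = - (fls_X_inv ^ 2 * (1 / w))"
    by (simp add: logderiv_def w_def)
  finally have "fls_nth (logderiv (fls_const a * fls_X_inv - fls_const y)) n =
      - fls_nth (fls_X_inv ^ 2 * (1 / w)) n" by simp
  also have "fls_nth (fls_X_inv ^ 2 * (1 / w)) n = fls_nth (1 / w) (n + 2)"
    by (simp only: fls_X_inv_power_times_conv_shift fls_shift_nth) simp
  also have "\<dots> = (a * y) ^ nat (n + 1)"
    unfolding w_def inverse_X_inv_minus_const using assms(2) by (simp add: algebra_simps)
  finally show ?thesis .
qed

lemma logderiv_X_inv_multiple_nth: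
  fixes a :: "'a::field"
  assumes "a \<noteq> 0" "n \<ge> 0"
  shows "fls_nth (logderiv (fls_const a * fls_X_inv)) n = 0"
proof -
  have "logderiv (fls_const a * fls_X_inv) = logderiv (fls_const 1 * fls_X_inv - fls_const 0)"
    using assms(1) by (simp add: logderiv_mult)
  thus ?thesis using logderiv_linear_nth[of 1 n 0] assms(2) by (simp add: power_0_left)
qed

section \<open>Real linear algebra and symmetric functions\<close>

lemma to_fract_power: "to_fract (f ^ n) = to_fract f ^ n"
  by (induction n) simp_all

text \<open>A basis of \<open>G\<close> stays independent when \<open>x\<close> is added, so the
  values 0 on the basis and 1 at \<open>x\<close> can be prescribed.\<close>

lemma separating_functional:
  fixes scale :: "real \<Rightarrow> 'v::ab_group_add \<Rightarrow> 'v"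
  assumes "vector_space scale" "module.subspace scale G" "x \<notin> G"
  obtains \<psi> where "Vector_Spaces.linear scale (*) \<psi>" "\<And>g. g \<in> G \<Longrightarrow> \<psi> g = 0" "\<psi> x = 1"
proof -
  interpret vs: vector_space scale by fact
  interpret vector_space_pair scale "(*) :: real \<Rightarrow> real \<Rightarrow> real"
    by unfold_locales (auto simp: algebra_simps)
  obtain B where B: "B \<subseteq> G" "vs.independent B" "G \<subseteq> vs.span B"
    using vs.maximal_independent_subset by blast
  have sB: "vs.span B \<subseteq> G" using B(1) assms(2) by (rule vs.span_minimal)
  hence x: "x \<notin> vs.span B" using assms(3) by blast
  hence "vs.independent (insert x B)" using B(2) by (simp add: vs.independent_insert)
  from linear_independent_extend[OF this, of "\<lambda>z. if z = x then 1 else 0"]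
  obtain \<psi> where \<psi>: "Vector_Spaces.linear scale (*) \<psi>" "\<forall>z\<in>insert x B. \<psi> z = (if z = x then 1 else 0)"
    by blast
  have xB: "x \<notin> B" using x vs.span_base by blast
  have "\<psi> g = 0" if "g \<in> G" for g
  proof (rule linear_eq_0_on_span[OF \<psi>(1)])
    show "g \<in> vs.span B" using that B(3) by blast
    show "\<And>b. b \<in> B \<Longrightarrow> \<psi> b = 0" using \<psi>(2) xB by auto
  qed
  thus ?thesis using that \<psi> by simp
qed

text \<open>For a real symmetric matrix the kernel and the image meet trivially; a linear functional
  reduces the statement for vectors with entries in an arbitrary space to this fact.\<close>

lemma symmetric_system:
  fixes scale :: "real \<Rightarrow> 'v::ab_group_add \<Rightarrow> 'v"
  assumes "vector_space scale" "module.subspace scale G" and sym: "\<And>i j. i \<in> I \<Longrightarrow> j \<in> I \<Longrightarrow> a i j = a j i"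
    and y: "\<And>i. i \<in> I \<Longrightarrow> (\<Sum>j\<in>I. scale (a i j) (y j)) \<in> G"
    and w: "\<And>i. i \<in> I \<Longrightarrow> (\<Sum>j\<in>I. scale (a i j) (w j)) + y i \<in> G"
    and "finite I" and "i0 \<in> I"
  shows "y i0 \<in> G"
proof (rule ccontr)
  assume "y i0 \<notin> G"
  from separating_functional[OF assms(1,2) this] obtain \<psi> where
    \<psi>: "Vector_Spaces.linear scale (*) \<psi>" "\<And>g. g \<in> G \<Longrightarrow> \<psi> g = 0" "\<psi> (y i0) = 1" by blast
  interpret Vector_Spaces.linear scale "(*)" \<psi> by fact
  have y': "(\<Sum>j\<in>I. a i j * \<psi> (y j)) = 0" if "i \<in> I" for i
    using \<psi>(2)[OF y[OF that]] by (simp add: sum scale)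
  have w': "\<psi> (y i) = - (\<Sum>j\<in>I. a i j * \<psi> (w j))" if "i \<in> I" for i
    using \<psi>(2)[OF w[OF that]] by (simp add: sum scale add add_eq_0_iff)
  \<comment> \<open>Writing one factor by the second relation and moving the matrix across by
    symmetry leaves the first relation, which is zero. A sum of real squares vanishes only if every
    square does.\<close>
  have "(\<Sum>i\<in>I. \<psi> (y i) * \<psi> (y i)) = (\<Sum>i\<in>I. - (\<Sum>j\<in>I. \<psi> (y i) * (a i j * \<psi> (w j))))"
    by (rule sum.cong) (auto simp: w' sum_distrib_left)
  also have "\<dots> = - (\<Sum>i\<in>I. \<Sum>j\<in>I. \<psi> (y i) * (a i j * \<psi> (w j)))"
    by (rule sum_negf)
  also have "(\<Sum>i\<in>I. \<Sum>j\<in>I. \<psi> (y i) * (a i j * \<psi> (w j))) =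
      (\<Sum>j\<in>I. \<Sum>i\<in>I. \<psi> (y i) * (a i j * \<psi> (w j)))" by (rule sum.swap)
  also have "\<dots> = (\<Sum>j\<in>I. \<psi> (w j) * (\<Sum>i\<in>I. a j i * \<psi> (y i)))"
    unfolding sum_distrib_left
  proof (intro sum.cong refl)
    fix i j assume "j \<in> I" "i \<in> I"
    thus "\<psi> (y i) * (a i j * \<psi> (w j)) = \<psi> (w j) * (a j i * \<psi> (y i))"
      using sym[of j i] by simp
  qed
  also have "\<dots> = 0" using y' by simp
  finally have "(\<Sum>i\<in>I. \<psi> (y i) * \<psi> (y i)) = 0" by simp
  hence "\<psi> (y i0) * \<psi> (y i0) = 0"
    using assms(6,7) by (subst (asm) sum_nonneg_eq_0_iff) auto
  thus False using \<psi>(3) by simp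
qed

text \<open>Polynomials over \<open>C(hbar)\<close> are regarded as a real vector space. Functionals
  then take real values, for which sums of squares are definite; complex values would not
  do.\<close>

definition real_const :: "real \<Rightarrow> hfield" where
  "real_const r = to_fract [:complex_of_real r:]"

lemma real_const_simps [simp]:
  "real_const (r + s) = real_const r + real_const s" "real_const (r * s) = real_const r * real_const s"
  "real_const (- r) = - real_const r" "real_const 0 = 0" "real_const 1 = 1"
  by (simp_all add: real_const_def pCons_one flip: to_fract_add to_fract_mult to_fract_uminus)

lemma vector_space_real_const: "vector_space (\<lambda>r f. Const (real_const r) * f)"
  by unfold_locales (simp_all add: algebra_simps)

text \<open>Induction on the number of exponents. The sum over a new index distinct from the old
  ones is a power sum times the shorter expression, minus the terms where the new index equals an
  old one. There the two exponents merge, so that the number of exponents has dropped. No division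
  is involved.\<close>

lemma distinct_list_sum_in_subring:
  fixes x :: "'i \<Rightarrow> 'r::comm_ring_1"
  assumes I: "finite I" and G: "1 \<in> G" "\<And>f g. f \<in> G \<Longrightarrow> g \<in> G \<Longrightarrow> f + g \<in> G"
    "\<And>f g. f \<in> G \<Longrightarrow> g \<in> G \<Longrightarrow> f * g \<in> G" "\<And>f. f \<in> G \<Longrightarrow> - f \<in> G"
    and p: "\<And>m. (\<Sum>k\<in>I. x k ^ m) \<in> G"
  shows "(\<Sum>ks | length ks = length as \<and> distinct ks \<and> set ks \<subseteq> I. \<Prod>l<length as. x (ks ! l) ^ (as ! l)) \<in> G"
proof (induction "length as" arbitrary: as)
  case 0
  have "{ks. length ks = length as \<and> distinct ks \<and> set ks \<subseteq> I} = {[]}" using 0 by auto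
  thus ?case using 0 G(1) by simp
next
  case (Suc n)
  then obtain a bs where as: "as = a # bs" "length bs = n" by (cases as) auto
  define L where "L = {ks. length ks = n \<and> distinct ks \<and> set ks \<subseteq> I}"
  have fin: "finite L"
    by (rule finite_subset[OF _ finite_lists_length_eq[OF I, of n]]) (auto simp: L_def)
  define M where "M cs = (\<Sum>ks\<in>L. \<Prod>l<n. x (ks ! l) ^ (cs ! l))" for cs :: "nat list"
  have M: "M cs \<in> G" if "length cs = n" for cs
    using Suc.hyps(1)[of cs] that by (simp add: M_def L_def)
  have S0: "0 \<in> G" using G(2)[OF G(1) G(4)[OF G(1)]] by simp
  have sumG: "sum h J \<in> G" if "\<And>j. j \<in> J \<Longrightarrow> h j \<in> G" for h :: "nat \<Rightarrow> 'r" and J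
    using that by (induction J rule: infinite_finite_induct) (auto simp: S0 G(2))
  have "{ks. length ks = length as \<and> distinct ks \<and> set ks \<subseteq> I} =
      (\<lambda>(ks, k). k # ks) ` (SIGMA ks:L. I - set ks)"
  proof safe
    fix ks assume "length ks = length as" "distinct ks" "set ks \<subseteq> I"
    thus "ks \<in> (\<lambda>(ks, k). k # ks) ` (SIGMA ks:L. I - set ks)"
      using as by (cases ks) (auto simp: L_def image_iff)
  qed (use as in \<open>auto simp: L_def\<close>)
  hence "(\<Sum>ks | length ks = length as \<and> distinct ks \<and> set ks \<subseteq> I. \<Prod>l<length as. x (ks ! l) ^ (as ! l)) =
      (\<Sum>ks\<in>(\<lambda>(ks, k). k # ks) ` (SIGMA ks:L. I - set ks). \<Prod>l<length as. x (ks ! l) ^ (as ! l))"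
    by simp
  also have "\<dots> = (\<Sum>(ks, k)\<in>(SIGMA ks:L. I - set ks). \<Prod>l<length as. x ((k # ks) ! l) ^ (as ! l))"
    by (subst sum.reindex) (auto simp: inj_on_def case_prod_unfold)
  also have "\<dots> = (\<Sum>ks\<in>L. \<Sum>k\<in>I - set ks. \<Prod>l<length as. x ((k # ks) ! l) ^ (as ! l))"
    using fin I by (subst sum.Sigma) auto
  also have "\<dots> = (\<Sum>ks\<in>L. (\<Sum>k\<in>I. x k ^ a) * (\<Prod>l<n. x (ks ! l) ^ (bs ! l)) -
      (\<Sum>j<n. \<Prod>l<n. x (ks ! l) ^ (bs[j := bs ! j + a] ! l)))"
  proof (rule sum.cong[OF refl])
    fix ks assume "ks \<in> L"
    hence ks: "length ks = n" "distinct ks" "set ks \<subseteq> I" by (auto simp: L_def)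
    let ?P = "\<Prod>l<n. x (ks ! l) ^ (bs ! l)"
    have "(\<Sum>k\<in>I - set ks. \<Prod>l<length as. x ((k # ks) ! l) ^ (as ! l)) = (\<Sum>k\<in>I - set ks. x k ^ a * ?P)"
      using as by (simp only: length_Cons prod.lessThan_Suc_shift) simp
    also have "\<dots> = (\<Sum>k\<in>I. x k ^ a * ?P) - (\<Sum>k\<in>set ks. x k ^ a * ?P)"
      using I ks(3) by (rule sum_diff)
    also have "(\<Sum>k\<in>set ks. x k ^ a * ?P) = (\<Sum>j<n. x (ks ! j) ^ a * ?P)"
      using sum.reindex_bij_betw[OF bij_betw_nth[OF ks(2) refl refl], of "\<lambda>k. x k ^ a * ?P"] ks(1) by simp
    also have "\<dots> = (\<Sum>j<n. \<Prod>l<n. x (ks ! l) ^ (bs[j := bs ! j + a] ! l))"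
    proof (rule sum.cong[OF refl])
      fix j assume j: "j \<in> {..<n}"
      have "(\<Prod>l<n. x (ks ! l) ^ (bs[j := bs ! j + a] ! l)) =
          (\<Prod>l<n. (if l = j then x (ks ! j) ^ a else 1) * x (ks ! l) ^ (bs ! l))"
        using as(2) by (intro prod.cong) (auto simp: nth_list_update power_add mult.commute)
      also have "\<dots> = x (ks ! j) ^ a * ?P" using j by (simp add: prod.distrib)
      finally show "x (ks ! j) ^ a * ?P = (\<Prod>l<n. x (ks ! l) ^ (bs[j := bs ! j + a] ! l))" by simp
    qed
    finally show "(\<Sum>k\<in>I - set ks. \<Prod>l<length as. x ((k # ks) ! l) ^ (as ! l)) =
      (\<Sum>k\<in>I. x k ^ a) * ?P - (\<Sum>j<n. \<Prod>l<n. x (ks ! l) ^ (bs[j := bs ! j + a] ! l))"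
      by (simp add: sum_distrib_right)
  qed
  also have "\<dots> = (\<Sum>k\<in>I. x k ^ a) * M bs + - (\<Sum>j<n. M (bs[j := bs ! j + a]))"
    unfolding sum_subtractf M_def sum_distrib_left by (subst sum.swap[of _ L "{..<n}"]) simp
  also have "\<dots> \<in> G"
    using as(2) by (intro G(2,3,4) p M sumG) auto
  finally show ?case .
qed

text \<open>A permutation of \<open>{1..n}\<close> is the same as a list of \<open>n\<close>
  distinct elements of that set, position \<open>l\<close> holding the image of
  \<open>l + 1\<close>. So the symmetrised monomials are a special case of the sums over distinct
  indices.\<close>

lemma permutation_sum_in_subring:
  fixes x :: "nat \<Rightarrow> 'r::comm_ring_1"
  assumes G: "1 \<in> G" "\<And>f g. f \<in> G \<Longrightarrow> g \<in> G \<Longrightarrow> f + g \<in> G"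
    "\<And>f g. f \<in> G \<Longrightarrow> g \<in> G \<Longrightarrow> f * g \<in> G" "\<And>f. f \<in> G \<Longrightarrow> - f \<in> G"
    and p: "\<And>m. (\<Sum>k\<in>{1..n}. x k ^ m) \<in> G"
  shows "(\<Sum>\<sigma> | \<sigma> permutes {1..n}. \<Prod>k\<in>{1..n}. x (\<sigma> k) ^ a k) \<in> G"
proof -
  define as where "as = map (\<lambda>l. a (Suc l)) [0..<n]"
  have shift: "(\<Prod>k\<in>{1..n}. h k) = (\<Prod>l<n. h (Suc l))" for h :: "nat \<Rightarrow> 'r"
    by (rule prod.reindex_bij_witness[of _ Suc "\<lambda>k. k - 1"]) auto
  have "(\<Sum>\<sigma> | \<sigma> permutes {1..n}. \<Prod>k\<in>{1..n}. x (\<sigma> k) ^ a k) =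
    (\<Sum>ks | length ks = length as \<and> distinct ks \<and> set ks \<subseteq> {1..n}. \<Prod>l<length as. x (ks ! l) ^ (as ! l))"
  proof (rule sum.reindex_bij_witness[of _ "\<lambda>ks k. if k \<in> {1..n} then ks ! (k - 1) else k"
        "\<lambda>\<sigma>. map (\<lambda>l. \<sigma> (Suc l)) [0..<n]"])
    fix \<sigma> assume "\<sigma> \<in> {\<sigma>. \<sigma> permutes {1..n}}"
    hence \<sigma>: "\<sigma> permutes {1..n}" by simp
    show "(\<lambda>k. if k \<in> {1..n} then map (\<lambda>l. \<sigma> (Suc l)) [0..<n] ! (k - 1) else k) = \<sigma>"
      using permutes_not_in[OF \<sigma>] by (auto simp: fun_eq_iff)
    show "map (\<lambda>l. \<sigma> (Suc l)) [0..<n] \<in> {ks. length ks = length as \<and> distinct ks \<and> set ks \<subseteq> {1..n}}"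
      using permutes_inj[OF \<sigma>] permutes_in_image[OF \<sigma>]
      by (auto simp: as_def distinct_map inj_on_def inj_def)
    show "(\<Prod>l<length as. x (map (\<lambda>l. \<sigma> (Suc l)) [0..<n] ! l) ^ (as ! l)) = (\<Prod>k\<in>{1..n}. x (\<sigma> k) ^ a k)"
      unfolding shift by (auto simp: as_def intro!: prod.cong)
  next
    fix ks assume "ks \<in> {ks. length ks = length as \<and> distinct ks \<and> set ks \<subseteq> {1..n}}"
    hence ks: "length ks = n" "distinct ks" "set ks \<subseteq> {1..n}" by (auto simp: as_def)
    show "map (\<lambda>l. if Suc l \<in> {1..n} then ks ! (Suc l - 1) else Suc l) [0..<n] = ks"
      using ks(1) by (intro nth_equalityI) auto
    let ?\<sigma> = "\<lambda>k. if k \<in> {1..n} then ks ! (k - 1) else k"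
    have inj: "inj_on ?\<sigma> {1..n}"
    proof (rule inj_onI)
      fix k l assume "k \<in> {1..n}" "l \<in> {1..n}" "?\<sigma> k = ?\<sigma> l"
      hence "k - 1 = l - 1" using ks nth_eq_iff_index_eq[OF ks(2), of "k - 1" "l - 1"] by auto
      thus "k = l" using \<open>k \<in> {1..n}\<close> \<open>l \<in> {1..n}\<close> by auto
    qed
    have "ks ! (k - 1) \<in> {1..n}" if "k \<in> {1..n}" for k
    proof -
      have "ks ! (k - 1) \<in> set ks" using that ks(1) by (intro nth_mem) auto
      thus ?thesis using ks(3) by blast
    qed
    hence "?\<sigma> ` {1..n} \<subseteq> {1..n}" by auto
    hence "?\<sigma> ` {1..n} = {1..n}" using inj by (intro endo_inj_surj) auto
    hence "bij_betw ?\<sigma> {1..n} {1..n}" using inj by (simp add: bij_betw_def)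
    thus "(\<lambda>k. if k \<in> {1..n} then ks ! (k - 1) else k) \<in> {\<sigma>. \<sigma> permutes {1..n}}"
      by (auto intro: bij_imp_permutes)
  qed
  also have "\<dots> \<in> G"
    by (rule distinct_list_sum_in_subring) (use G p in auto)
  finally show ?thesis .
qed

lemma hbar_nonzero: "hbar \<noteq> 0"
  by (simp add: hbar_def)

lemma Const_2: "Const 2 = 2"
  using Const_add[of 1 1] by simp

lemma real_const_diff: "real_const (r - s) = real_const r - real_const s"
  using real_const_simps(1)[of r "- s"] by simp

lemma real_const_2: "real_const 2 = 2"
  using real_const_simps(1)[of 1 1] by simp

lemma real_const_power: "real_const (r ^ n) = real_const r ^ n"
  by (induction n) simp_all

section \<open>Power sums in the truncated shifted iYangian\<close>

context iyangian_data
begin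

text \<open>A commutative subalgebra of Gelfand-Tsetlin type. The aim is to show that it contains
  every symmetric polynomial.\<close>

definition GT :: "'q xpoly set" where
  "GT = {g \<in> P_inv. (\<lambda>f\<in>P_inv. g * f) \<in> carrier Y}"

lemma GT_Const: "Const c \<in> GT"
proof -
  have "c \<odot>\<^bsub>End_algebra P_inv\<^esub> \<one>\<^bsub>End_algebra P_inv\<^esub> \<in> carrier Y"
    unfolding Y_carrier_eq by (intro generated_subalgebra.smult generated_subalgebra.one)
  also have "c \<odot>\<^bsub>End_algebra P_inv\<^esub> \<one>\<^bsub>End_algebra P_inv\<^esub> = (\<lambda>f\<in>P_inv. Const c * f)"
    by (auto simp: End_algebra_simps)
  finally show ?thesis unfolding GT_def by (intro CollectI conjI P_inv_Const)
qed

lemma GT_0: "0 \<in> GT" and GT_1: "1 \<in> GT"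
  using GT_Const[of 0] GT_Const[of 1] by simp_all

lemma GT_add: "g \<in> GT \<Longrightarrow> h \<in> GT \<Longrightarrow> g + h \<in> GT"
proof -
  assume gh: "g \<in> GT" "h \<in> GT"
  hence "(\<lambda>f\<in>P_inv. g * f) \<oplus>\<^bsub>End_algebra P_inv\<^esub> (\<lambda>f\<in>P_inv. h * f) \<in> carrier Y"
    unfolding Y_carrier_eq GT_def by (intro generated_subalgebra.add) auto
  also have "(\<lambda>f\<in>P_inv. g * f) \<oplus>\<^bsub>End_algebra P_inv\<^esub> (\<lambda>f\<in>P_inv. h * f) = (\<lambda>f\<in>P_inv. (g + h) * f)"
    by (auto simp: End_algebra_simps distrib_right)
  finally show ?thesis
    using gh unfolding GT_def by (intro CollectI conjI P_inv_add) blast+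
qed

lemma GT_mult: "g \<in> GT \<Longrightarrow> h \<in> GT \<Longrightarrow> g * h \<in> GT"
proof -
  assume gh: "g \<in> GT" "h \<in> GT"
  hence "(\<lambda>f\<in>P_inv. g * f) \<otimes>\<^bsub>End_algebra P_inv\<^esub> (\<lambda>f\<in>P_inv. h * f) \<in> carrier Y"
    unfolding Y_carrier_eq GT_def by (intro generated_subalgebra.mult) auto
  also have "(\<lambda>f\<in>P_inv. g * f) \<otimes>\<^bsub>End_algebra P_inv\<^esub> (\<lambda>f\<in>P_inv. h * f) = (\<lambda>f\<in>P_inv. (g * h) * f)"
    using gh by (auto simp: End_algebra_simps compose_def mult.assoc GT_def fun_eq_iff)
  finally show ?thesis
    using gh unfolding GT_def by (intro CollectI conjI P_inv_mult) blast+
qed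

lemma GT_uminus: "g \<in> GT \<Longrightarrow> - g \<in> GT"
  using GT_mult[OF GT_Const[of "- 1"], of g] by simp

lemma GT_diff: "g \<in> GT \<Longrightarrow> h \<in> GT \<Longrightarrow> g - h \<in> GT"
  using GT_add[OF _ GT_uminus, of g h] by simp

lemma GT_sum: "(\<And>x. x \<in> S \<Longrightarrow> h x \<in> GT) \<Longrightarrow> sum h S \<in> GT"
  by (induction S rule: infinite_finite_induct) (auto simp: GT_0 GT_add)

lemma GT_prod: "(\<And>x. x \<in> S \<Longrightarrow> h x \<in> GT) \<Longrightarrow> prod h S \<in> GT"
  by (induction S rule: infinite_finite_induct) (auto simp: GT_1 GT_mult)

lemma field_subring_GT: "field_subring (to_fract ` GT)"
  by (rule field_subring_to_fract) (auto intro: GT_0 GT_1 GT_add GT_mult GT_uminus)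

interpretation KG: field_subring "to_fract ` GT"
  by (rule field_subring_GT)

lemma to_fract_GT_iff: "to_fract g \<in> to_fract ` GT \<longleftrightarrow> g \<in> GT"
  by auto

lemma hser_over_GT:
  assumes i: "i \<in> verts Q" shows "hser i \<in> KG.over"
proof -
  have "fls_nth (hser i) n \<in> to_fract ` GT" for n
  proof -
    obtain g where g: "g \<in> P_inv" "fls_nth (hser i) n = to_fract g" by (rule hser_nth[OF i])
    have "h_coeff i n \<in> carrier Y"
      unfolding Y_carrier_eq using i by (intro generated_subalgebra.incl) blast
    hence "g \<in> GT" using g by (simp add: GT_def h_coeff_eq)
    thus ?thesis using g(2) by simp
  qed
  thus ?thesis by (simp add: KG.over_def)
qed

text \<open>The coefficients of the inverse of \<open>h_i(z)\<close> are polynomials in those of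
  \<open>h_i(z)\<close> and the inverse of the leading one, which is a scalar. Hence passing to the
  logarithmic derivative does not leave \<open>Y\<close>.\<close>

lemma logderiv_hser_over_GT:
  assumes i: "i \<in> verts Q" shows "logderiv (hser i) \<in> KG.over"
proof -
  have "inverse (hser i) \<in> KG.over"
    by (rule over_inverse_scalar_lead[OF field_subring_GT _ hser_over_GT[OF i] hser_over_scalar_lead(2)[OF i]])
      (auto intro: GT_Const)
  thus ?thesis
    unfolding logderiv_def divide_inverse by (intro KG.over_mult KG.over_deriv hser_over_GT i)
qed

lemma V_logderiv_nth:
  assumes "n \<ge> 0"
  shows "fls_nth (logderiv (V j (- zv + emb (Const d)))) n =
    to_fract (- (\<Sum>k\<in>{1..v j}. (Const d - xvar j k) ^ nat (n + 1)))"
proof -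
  have lin: "- zv + emb (Const d) - emb x = fls_const (- 1) * fls_X_inv - fls_const (to_fract (x - Const d))" for x
    by (simp add: zv_def emb_def flip: fls_minus_const)
  have "- zv + emb (Const d) - emb x \<noteq> 0" for x
  proof
    assume "- zv + emb (Const d) - emb x = 0"
    hence "fls_nth (- zv + emb (Const d) - emb x) (- 1) = 0" by simp
    thus False by (simp add: zv_def emb_def)
  qed
  hence "logderiv (V j (- zv + emb (Const d))) =
      (\<Sum>k\<in>{1..v j}. logderiv (- zv + emb (Const d) - emb (xvar j k)))"
    unfolding V_def by (rule logderiv_prod)
  hence "fls_nth (logderiv (V j (- zv + emb (Const d)))) n =
      (\<Sum>k\<in>{1..v j}. - ((- 1 * to_fract (xvar j k - Const d)) ^ nat (n + 1)))"
    by (simp only: lin fls_nth_sum logderiv_linear_nth[OF disjI2[OF refl] assms])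
  also have "\<dots> = to_fract (- (\<Sum>k\<in>{1..v j}. (Const d - xvar j k) ^ nat (n + 1)))"
    by (simp add: to_fract_power sum_negf)
  finally show ?thesis .
qed

text \<open>The roots of these factors are scalars, so their power sums are constants.\<close>

lemma pfun_logderiv_nth:
  assumes "n \<ge> 0" "a = 1 \<or> a = - 1"
  shows "fls_nth (logderiv (pfun i (fls_const a * fls_X_inv))) n \<in> to_fract ` GT"
proof -
  have a: "a \<in> to_fract ` GT" using assms(2) by auto
  let ?w = "fls_const a * fls_X_inv"
  have lin: "?w - emb (Const (to_fract [:c:])) * hb = ?w - fls_const (to_fract (Const (to_fract [:c:] * hbar)))" for c
    by (simp add: hb_def emb_def)
  have "?w - emb (Const (to_fract [:c:])) * hb \<noteq> 0" for c
  proof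
    assume "?w - emb (Const (to_fract [:c:])) * hb = 0"
    hence "fls_nth (?w - emb (Const (to_fract [:c:])) * hb) (- 1) = 0" by simp
    thus False using assms(2) unfolding lin by auto
  qed
  hence "logderiv (pfun i ?w) = (\<Sum>c\<in>#R i. logderiv (?w - emb (Const (to_fract [:c:])) * hb))"
    unfolding pfun_def by (rule logderiv_prod_mset)
  moreover have "fls_nth (\<Sum>c\<in>#M. logderiv (?w - emb (Const (to_fract [:c:])) * hb)) n \<in> to_fract ` GT" for M
  proof (induction M)
    case (add c M)
    have "fls_nth (logderiv (?w - emb (Const (to_fract [:c:])) * hb)) n \<in> to_fract ` GT"
      unfolding lin logderiv_linear_nth[OF assms(2,1)]
      using a GT_Const by (intro KG.K_uminus KG.K_power KG.K_mult) auto
    thus ?case using add by simp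
  qed simp
  ultimately show ?thesis by simp
qed

text \<open>The roots of the two shifted factors \<open>V_i\<close> give the first sum and those of
  the neighbouring \<open>V_j\<close> the second. The prefactors contribute nothing in the orders
  considered, and the factors \<open>p_i\<close>, \<open>p_{\<tau> i}\<close> only constants. No
  arrow starts at \<open>\<tau> i\<close>, so the last product of \<open>h_i(z)\<close> is
  empty.\<close>

lemma hser_relation:
  assumes i: "i \<in> Qp" and N: "N \<ge> 1"
  shows "(\<Sum>k\<in>{1..v i}. (Const (hbar / 2) - Var (i, k)) ^ N + (- Const (hbar / 2) - Var (i, k)) ^ N)
    - (\<Sum>j\<in>{j \<in> verts Q. i \<rightarrow>\<^bsub>Q\<^esub> j}. \<Sum>k\<in>{1..v j}. Var (pos_rep j, k) ^ N) \<in> GT"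
proof -
  have iv: "i \<in> verts Q" using i by (rule Qp_verts)
  \<comment> \<open>Power sums of degree \<open>N\<close> sit in the coefficient of order
    \<open>N - 1\<close>. The bound \<open>N \<ge> 1\<close> excludes order -1, in which the degree
    in \<open>z\<close> appears.\<close>
  define n where "n = int N - 1"
  have n: "n \<ge> 0" "nat (n + 1) = N" using N by (auto simp: n_def)
  have arr: "tl \<in> Qp \<and> hd \<in> Qm" if "tl \<rightarrow>\<^bsub>Q\<^esub> hd" for tl hd
    using that arrows_direction by (auto simp: arcs_ends_def arc_to_ends_def)
  have empty: "{j \<in> verts Q. \<tau> i \<rightarrow>\<^bsub>Q\<^esub> j} = {}"
    using arr tau_not_Qp[OF i] by blast
  define c0 where "c0 = (- 1 :: 'q xpoly fract fls) powi (int (v i) - 1 + of_bool (i \<rightarrow>\<^bsub>Q\<^esub> \<tau> i))"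
  define z0 where "z0 = (2 * zv) powi cartan Q i (\<tau> i)"
  define A where "A = pfun i (- zv) * pfun (\<tau> i) zv"
  define B where "B = V i (- zv + hb / 2) * V i (- zv - hb / 2)"
  define C where "C = (\<Prod>j\<in>{j \<in> verts Q. i \<rightarrow>\<^bsub>Q\<^esub> j}. V j (- zv))"
  have h: "hser i = c0 * z0 * (A / B) * C"
    unfolding hser_def empty c0_def z0_def A_def B_def C_def by simp
  have hnz: "c0 * z0 * (A / B) * C \<noteq> 0"
    using scalar_lead_nonzero[OF hser_over_scalar_lead(2)[OF iv]] unfolding h .
  hence nz: "c0 \<noteq> 0" "z0 \<noteq> 0" "A \<noteq> 0" "B \<noteq> 0" "C \<noteq> 0" by auto
  have ld: "logderiv (hser i) = logderiv c0 + logderiv z0 + (logderiv A - logderiv B) + logderiv C"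
    unfolding h using nz by (simp add: logderiv_mult logderiv_divide)
  have c0: "fls_nth (logderiv c0) n = 0"
    using minus_one_powi[where 'a = "'q xpoly fract fls", of "int (v i) - 1 + of_bool (i \<rightarrow>\<^bsub>Q\<^esub> \<tau> i)"]
    by (auto simp: c0_def[symmetric] logderiv_def)
  have z0: "fls_nth (logderiv z0) n = 0"
  proof -
    have two: "2 * zv = fls_const 2 * (fls_X_inv :: 'q xpoly fract fls)"
      by (simp add: zv_def)
    have l: "fls_nth (logderiv (2 * zv)) n = 0"
      unfolding two by (rule logderiv_X_inv_multiple_nth) (use n in auto)
    have "z0 = 1 \<or> z0 = inverse (2 * zv)"
      using cartan_tau[OF iv] power_int_0_right[of "2 * zv"] power_int_minus1_right[of "2 * zv"]
      unfolding z0_def by metis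
    moreover have nz2: "2 * zv \<noteq> 0" by (rule scalar_lead_nonzero[OF linear_z_scalar_lead]) simp
    have "fls_nth (logderiv (inverse (2 * zv))) n = 0"
      unfolding logderiv_inverse[OF nz2] fls_uminus_nth l by simp
    ultimately show ?thesis by (elim disjE) (simp, simp only:)
  qed
  have A: "fls_nth (logderiv A) n \<in> to_fract ` GT"
  proof -
    have zs: "- zv = fls_const (- 1) * (fls_X_inv :: 'q xpoly fract fls)"
        "zv = fls_const 1 * (fls_X_inv :: 'q xpoly fract fls)"
      by (simp_all add: zv_def)
    have "logderiv A = logderiv (pfun i (- zv)) + logderiv (pfun (\<tau> i) zv)"
      using nz(3) unfolding A_def by (intro logderiv_mult) auto
    moreover have "fls_nth (logderiv (pfun i (- zv))) n \<in> to_fract ` GT"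
      unfolding zs(1) by (rule pfun_logderiv_nth) (use n in auto)
    moreover have "fls_nth (logderiv (pfun (\<tau> i) zv)) n \<in> to_fract ` GT"
      unfolding zs(2) by (rule pfun_logderiv_nth) (use n in auto)
    ultimately show ?thesis by simp
  qed
  let ?B = "\<Sum>k\<in>{1..v i}. (Const (hbar / 2) - Var (i, k)) ^ N + (- Const (hbar / 2) - Var (i, k)) ^ N :: 'q xpoly"
  have B: "fls_nth (logderiv B) n = to_fract (- ?B)"
  proof -
    have hm: "- zv - hb / 2 = - zv + emb (Const (- (hbar / 2)))" by (simp add: hb_half)
    have hp: "- zv + hb / 2 = - zv + emb (Const (hbar / 2))" by (simp add: hb_half)
    have "logderiv B = logderiv (V i (- zv + hb / 2)) + logderiv (V i (- zv - hb / 2))"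
      using nz(4) unfolding B_def by (intro logderiv_mult) auto
    thus ?thesis
      unfolding hm hp using V_logderiv_nth[OF n(1), of i "hbar / 2"] V_logderiv_nth[OF n(1), of i "- (hbar / 2)"] i
      by (simp add: n(2) sum.distrib xvar_def)
  qed
  let ?C = "\<Sum>j\<in>{j \<in> verts Q. i \<rightarrow>\<^bsub>Q\<^esub> j}. \<Sum>k\<in>{1..v j}. Var (pos_rep j, k) ^ N :: 'q xpoly"
  have C: "fls_nth (logderiv C) n = to_fract (- ?C)"
  proof -
    have fin: "finite {j \<in> verts Q. i \<rightarrow>\<^bsub>Q\<^esub> j}" by simp
    have "logderiv C = (\<Sum>j\<in>{j \<in> verts Q. i \<rightarrow>\<^bsub>Q\<^esub> j}. logderiv (V j (- zv)))"
      using nz(5) fin unfolding C_def by (intro logderiv_prod) auto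
    hence "fls_nth (logderiv C) n = (\<Sum>j\<in>{j \<in> verts Q. i \<rightarrow>\<^bsub>Q\<^esub> j}. fls_nth (logderiv (V j (- zv))) n)"
      by (simp add: fls_nth_sum)
    also have "\<dots> = (\<Sum>j\<in>{j \<in> verts Q. i \<rightarrow>\<^bsub>Q\<^esub> j}. to_fract (- (\<Sum>k\<in>{1..v j}. Var (pos_rep j, k) ^ N)))"
    proof (rule sum.cong[OF refl])
      fix j assume "j \<in> {j \<in> verts Q. i \<rightarrow>\<^bsub>Q\<^esub> j}"
      hence "j \<notin> Qp" using arr partition(2) by blast
      thus "fls_nth (logderiv (V j (- zv))) n = to_fract (- (\<Sum>k\<in>{1..v j}. Var (pos_rep j, k) ^ N))"
        using V_logderiv_nth[OF n(1), of j 0] by (simp add: n(2) xvar_eq)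
    qed
    finally show ?thesis by (simp add: sum_negf)
  qed
  have "fls_nth (logderiv (hser i)) n \<in> to_fract ` GT"
    using KG.over_nth[OF logderiv_hser_over_GT[OF iv]] .
  hence "fls_nth (logderiv (hser i)) n - fls_nth (logderiv A) n \<in> to_fract ` GT"
    using A by (rule KG.K_diff)
  moreover have "fls_nth (logderiv (hser i)) n - fls_nth (logderiv A) n = to_fract (?B - ?C)"
    unfolding ld using c0 z0 B C by simp
  ultimately have "to_fract (?B - ?C) \<in> to_fract ` GT" by simp
  thus ?thesis unfolding to_fract_GT_iff .
qed

definition power_sum :: "'q \<Rightarrow> nat \<Rightarrow> 'q xpoly" where
  "power_sum i N = (\<Sum>k\<in>{1..v i}. Var (i, k) ^ N)"

text \<open>The coefficient of \<open>X^(N-m)\<close> in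
  \<open>(X + hbar/2)^N + (X - hbar/2)^N\<close>: it is 2 for \<open>m = 0\<close>, zero for odd
  \<open>m\<close>, and a nonzero multiple of \<open>hbar^2\<close> for \<open>m = 2\<close> if
  \<open>N \<ge> 2\<close>.\<close>

definition shift_coeff :: "nat \<Rightarrow> nat \<Rightarrow> hfield" where
  "shift_coeff N m = of_nat (N choose m) * ((hbar / 2) ^ m + (- (hbar / 2)) ^ m)"

text \<open>Each neighbour of \<open>i\<close> lies in \<open>Qm\<close> and is replaced by its
  partner in \<open>Qp\<close>, which has the same variables. Roots at \<open>i\<close> carry the
  opposite sign to roots at the neighbours; multiplication by \<open>(-1)^N\<close> moves this sign
  to the neighbours.\<close>

lemma power_sum_relation:
  assumes i: "i \<in> Qp" and N: "N \<ge> 1"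
  shows "(\<Sum>m\<le>N. Const (shift_coeff N m) * power_sum i (N - m))
    - (- 1) ^ N * (\<Sum>j\<in>{j \<in> Qp. i \<rightarrow>\<^bsub>Q\<^esub> \<tau> j}. power_sum j N) \<in> GT"
proof -
  let ?h = "Const (hbar / 2) :: 'q xpoly"
  have arr: "tl \<in> Qp \<and> hd \<in> Qm" if "tl \<rightarrow>\<^bsub>Q\<^esub> hd" for tl hd
    using that arrows_direction by (auto simp: arcs_ends_def arc_to_ends_def)
  have A: "(?h - X) ^ N + (- ?h - X) ^ N = (- 1) ^ N * (\<Sum>m\<le>N. Const (shift_coeff N m) * X ^ (N - m))" for X
  proof -
    have "(?h - X) ^ N = (- 1) ^ N * (- ?h + X) ^ N" "(- ?h - X) ^ N = (- 1) ^ N * (?h + X) ^ N"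
      unfolding power_mult_distrib[symmetric] by (rule arg_cong[where f = "\<lambda>t. t ^ N"], simp)+
    moreover have "(?h + X) ^ N + (- ?h + X) ^ N = (\<Sum>m\<le>N. Const (shift_coeff N m) * X ^ (N - m))"
      unfolding binomial_ring sum.distrib[symmetric]
      by (rule sum.cong) (simp_all add: shift_coeff_def algebra_simps)
    ultimately show ?thesis by (simp only: add.commute distrib_left[symmetric])
  qed
  have "(\<Sum>k\<in>{1..v i}. (?h - Var (i, k)) ^ N + (- ?h - Var (i, k)) ^ N) =
      (- 1) ^ N * (\<Sum>m\<le>N. Const (shift_coeff N m) * power_sum i (N - m))"
    unfolding A power_sum_def sum_distrib_left by (rule sum.swap)
  moreover have "(\<Sum>j\<in>{j \<in> verts Q. i \<rightarrow>\<^bsub>Q\<^esub> j}. \<Sum>k\<in>{1..v j}. Var (pos_rep j, k) ^ N) =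
      (\<Sum>j\<in>{j \<in> Qp. i \<rightarrow>\<^bsub>Q\<^esub> \<tau> j}. power_sum j N)"
  proof (rule sum.reindex_bij_witness[of _ \<tau> \<tau>])
    fix j assume j: "j \<in> {j \<in> verts Q. i \<rightarrow>\<^bsub>Q\<^esub> j}"
    hence nQp: "j \<notin> Qp" using arr partition(2) by blast
    show "\<tau> (\<tau> j) = j" "\<tau> j \<in> {j \<in> Qp. i \<rightarrow>\<^bsub>Q\<^esub> \<tau> j}" using j nQp by (auto simp: tau_invol tau_Qp)
    show "power_sum (\<tau> j) N = (\<Sum>k\<in>{1..v j}. Var (pos_rep j, k) ^ N)"
      using j nQp by (simp add: power_sum_def pos_rep_def v_invariant)
  next
    fix j assume "j \<in> {j \<in> Qp. i \<rightarrow>\<^bsub>Q\<^esub> \<tau> j}"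
    thus "\<tau> (\<tau> j) = j" "\<tau> j \<in> {j \<in> verts Q. i \<rightarrow>\<^bsub>Q\<^esub> j}"
      by (auto simp: tau_invol tau_verts Qp_verts)
  qed
  ultimately have "(- 1) ^ N * (\<Sum>m\<le>N. Const (shift_coeff N m) * power_sum i (N - m)) -
      (\<Sum>j\<in>{j \<in> Qp. i \<rightarrow>\<^bsub>Q\<^esub> \<tau> j}. power_sum j N) \<in> GT"
    using hser_relation[OF i N] by simp
  from GT_mult[OF GT_Const[of "(- 1) ^ N"] this] show ?thesis
    by (simp add: right_diff_distrib flip: mult.assoc power_mult_distrib)
qed

lemma power_sum_GT: "i \<in> Qp \<Longrightarrow> power_sum i N \<in> GT"
proof (induction N arbitrary: i rule: less_induct)
  case (less N)
  show ?case
  proof (cases "N = 0")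
    case True
    thus ?thesis using GT_Const[of "of_nat (v i)"] by (simp add: power_sum_def)
  next
    case False
    \<comment> \<open>The sign depends on \<open>N\<close> only through its parity, so this one
      matrix occurs in the relation of degree \<open>N\<close> and in that of degree
      \<open>N + 2\<close>.\<close>
    define a :: "'q \<Rightarrow> 'q \<Rightarrow> real" where
      "a i j = (if i = j then 2 else 0) - (if i \<rightarrow>\<^bsub>Q\<^esub> \<tau> j then (- 1) ^ N else 0)" for i j
    define c where "c = shift_coeff (N + 2) 2"
    have sc: "shift_coeff M 0 = 2" "shift_coeff M 1 = 0" for M by (simp_all add: shift_coeff_def)
    have c: "c \<noteq> 0"
    proof -
      have "of_nat (N + 2 choose 2) \<noteq> (0 :: hfield)"
        by (simp only: of_nat_eq_0_iff binomial_eq_0_iff)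
      moreover have "(hbar / 2) ^ 2 + (- (hbar / 2)) ^ 2 \<noteq> 0"
        using hbar_nonzero by (simp flip: mult_2)
      ultimately show ?thesis unfolding c_def shift_coeff_def by simp
    qed
    have row: "(\<Sum>j\<in>Qp. Const (real_const (a i j)) * y j) =
        2 * y i - (- 1) ^ N * (\<Sum>j\<in>{j \<in> Qp. i \<rightarrow>\<^bsub>Q\<^esub> \<tau> j}. y j)" if "i \<in> Qp" for i and y :: "'q \<Rightarrow> 'q xpoly"
    proof -
      have rc: "Const (real_const 2) = (2 :: 'q xpoly)" "Const (real_const ((- 1) ^ N)) = ((- 1) ^ N :: 'q xpoly)"
        by (simp_all add: real_const_2 Const_2 real_const_power)
      have "(\<Sum>j\<in>Qp. Const (real_const (a i j)) * y j) =
          (\<Sum>j\<in>Qp. (if i = j then 2 * y j else 0) - (- 1) ^ N * (if i \<rightarrow>\<^bsub>Q\<^esub> \<tau> j then y j else 0))"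
        by (rule sum.cong) (auto simp: a_def rc left_diff_distrib real_const_diff)
      thus ?thesis using that finite_Qp
        by (simp add: sum_subtractf sum.inter_filter flip: sum_distrib_left)
    qed
    have low: "(\<Sum>m\<in>{k..M}. Const (shift_coeff M m) * power_sum i (M - m)) \<in> GT"
      if "i \<in> Qp" "M - k < N" for M k i
      using that less.IH by (intro GT_sum GT_mult GT_Const) auto
    have y: "2 * power_sum i N - (- 1) ^ N * (\<Sum>j\<in>{j \<in> Qp. i \<rightarrow>\<^bsub>Q\<^esub> \<tau> j}. power_sum j N) \<in> GT" if i: "i \<in> Qp" for i
    proof -
      have "{..N} = insert 0 {1..N}" using False by auto
      hence "(\<Sum>m\<le>N. Const (shift_coeff N m) * power_sum i (N - m)) =
          2 * power_sum i N + (\<Sum>m\<in>{1..N}. Const (shift_coeff N m) * power_sum i (N - m))"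
        by (simp add: sc Const_2)
      thus ?thesis using GT_diff[OF power_sum_relation[OF i, of N] low[of i N 1]] False i
        by (simp add: algebra_simps)
    qed
    \<comment> \<open>In degree \<open>N + 2\<close> the term of degree \<open>N + 1\<close> has
      coefficient zero, the next one is the multiple by \<open>c\<close> of the unknown, and all
      further terms have degree below \<open>N\<close>.\<close>
    have w: "2 * power_sum i (N + 2) - (- 1) ^ N * (\<Sum>j\<in>{j \<in> Qp. i \<rightarrow>\<^bsub>Q\<^esub> \<tau> j}. power_sum j (N + 2)) +
        Const c * power_sum i N \<in> GT" if i: "i \<in> Qp" for i
    proof -
      have "{..N + 2} = insert 0 (insert 1 (insert 2 {3..N + 2}))" using False by auto
      hence "(\<Sum>m\<le>N + 2. Const (shift_coeff (N + 2) m) * power_sum i (N + 2 - m)) =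
          2 * power_sum i (N + 2) + Const c * power_sum i N +
          (\<Sum>m\<in>{3..N + 2}. Const (shift_coeff (N + 2) m) * power_sum i (N + 2 - m))"
        using sc[of "N + 2"] by (simp only: c_def) (simp add: Const_2 add.assoc)
      thus ?thesis using GT_diff[OF power_sum_relation[OF i, of "N + 2"] low[of i "N + 2" 3]] False i
        by (simp add: algebra_simps)
    qed
    have "Const c * power_sum i N \<in> GT"
    \<comment> \<open>The linear system allows only real scalars, and \<open>c\<close> involves
      \<open>hbar\<close>; so the unknown vector is taken with the factor \<open>c\<close>, which is
      removed at the end.\<close>
    proof (rule symmetric_system[where I = Qp and a = a and w = "\<lambda>i. power_sum i (N + 2)"
          and y = "\<lambda>i. Const c * power_sum i N", OF vector_space_real_const])
      interpret vector_space "\<lambda>r f. Const (real_const r) * f :: 'q xpoly" by (rule vector_space_real_const)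
      show "subspace GT" unfolding subspace_def using GT_0 GT_add GT_mult GT_Const by blast
      show "a i j = a j i" if "i \<in> Qp" "j \<in> Qp" for i j
      proof -
        \<comment> \<open>The involution reverses arrows and exchanges their ends with partners, so
          it sends an arrow from \<open>i\<close> to \<open>\<tau> j\<close> to one from
          \<open>j\<close> to \<open>\<tau> i\<close>.\<close>
        have *: "j \<rightarrow>\<^bsub>Q\<^esub> \<tau> i" if ij: "i \<rightarrow>\<^bsub>Q\<^esub> \<tau> j" "i \<in> Qp" "j \<in> Qp" for i j
        proof -
          obtain e where e: "e \<in> arcs Q" "tail Q e = i" "head Q e = \<tau> j"
            using ij(1) by (auto simp: arcs_ends_def arc_to_ends_def)
          hence "tail Q (\<tau>a e) = j" "head Q (\<tau>a e) = \<tau> i"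
            using tau_tail[OF e(1)] tau_head[OF e(1)] tau_invol[OF Qp_verts[OF ij(3)]] by simp_all
          thus ?thesis using tau_arcs[OF e(1)] by (auto simp: arcs_ends_def arc_to_ends_def image_iff)
        qed
        show ?thesis using *[of i j] *[of j i] that by (auto simp: a_def)
      qed
      show "(\<Sum>j\<in>Qp. Const (real_const (a i j)) * (Const c * power_sum j N)) \<in> GT" if "i \<in> Qp" for i
        using GT_mult[OF GT_Const[of c] y[OF that]] unfolding row[OF that]
        by (simp add: algebra_simps sum_distrib_left)
      show "(\<Sum>j\<in>Qp. Const (real_const (a i j)) * power_sum j (N + 2)) + Const c * power_sum i N \<in> GT"
        if "i \<in> Qp" for i
        unfolding row[OF that] by (rule w[OF that])
    qed (use finite_Qp less.prems in auto)
    from GT_mult[OF GT_Const[of "inverse c"] this] show ?thesis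
      using c by (simp flip: mult.assoc Const_mult)
  qed
qed

end

lemma generated_subalgebra_mono:
  "S \<subseteq> T \<Longrightarrow> generated_subalgebra A S \<subseteq> generated_subalgebra A T"
proof
  fix x assume "S \<subseteq> T" "x \<in> generated_subalgebra A S"
  from this(2,1) show "x \<in> generated_subalgebra A T"
    by induction (auto intro: generated_subalgebra.intros)
qed

section \<open>All symmetric polynomials in the truncated shifted iYangian\<close>

context iyangian_data
begin

lemma vset_Sigma: "vset = (SIGMA i:Qp. {1..v i})"
  by (auto simp: vset_def)

text \<open>A symmetric polynomial is the average of its monomials over the group, whose order is
  invertible. The sum over the translates of a monomial factors over the vertices into symmetrised
  monomials, which are expressed by power sums.\<close>

lemma P_inv_GT:
  assumes f: "f \<in> P_inv" shows "f \<in> GT"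
proof -
  let ?S = "PiE Qp (\<lambda>i. {\<sigma>. \<sigma> permutes {1..v i}})"
  let ?act = "\<lambda>\<pi>. perm_vars (\<lambda>j. if j \<in> Qp then \<pi> j else id) :: 'q xpoly \<Rightarrow> 'q xpoly"
  have finS: "finite ?S" by (intro finite_PiE finite_Qp finite_permutations) simp
  have "(\<lambda>i\<in>Qp. id) \<in> ?S" by (auto simp: permutes_id)
  hence "?S \<noteq> {}" by blast
  hence cS: "card ?S \<noteq> 0" using finS unfolding card_eq_0_iff by blast
  have mono: "(\<Sum>\<pi>\<in>?S. ?act \<pi> (monom_subst Var m)) \<in> GT" if m: "Poly_Mapping.keys m \<subseteq> vset" for m
  proof -
    have "monom_subst Var m = (\<Prod>(i, k)\<in>vset. Var (i, k) ^ Poly_Mapping.lookup m (i, k))"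
      using monom_subst_superset[OF _ m, of Var] finite_Qp by (simp add: vset_Sigma case_prod_unfold)
    also have "\<dots> = (\<Prod>i\<in>Qp. \<Prod>k\<in>{1..v i}. Var (i, k) ^ Poly_Mapping.lookup m (i, k))"
      unfolding vset_Sigma using finite_Qp by (subst prod.Sigma) auto
    finally have "?act \<pi> (monom_subst Var m) =
        (\<Prod>i\<in>Qp. \<Prod>k\<in>{1..v i}. Var (i, \<pi> i k) ^ Poly_Mapping.lookup m (i, k))" for \<pi>
      by (simp add: perm_vars_def)
    hence "(\<Sum>\<pi>\<in>?S. ?act \<pi> (monom_subst Var m)) =
        (\<Sum>\<pi>\<in>?S. \<Prod>i\<in>Qp. \<Prod>k\<in>{1..v i}. Var (i, \<pi> i k) ^ Poly_Mapping.lookup m (i, k))" by simp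
    also have "\<dots> = (\<Prod>i\<in>Qp. \<Sum>\<sigma> | \<sigma> permutes {1..v i}. \<Prod>k\<in>{1..v i}. Var (i, \<sigma> k) ^ Poly_Mapping.lookup m (i, k))"
      by (rule prod_sum_PiE[symmetric]) (auto simp: finite_Qp finite_permutations)
    also have "\<dots> \<in> GT"
    proof (rule GT_prod)
      fix i assume i: "i \<in> Qp"
      show "(\<Sum>\<sigma> | \<sigma> permutes {1..v i}. \<Prod>k\<in>{1..v i}. Var (i, \<sigma> k) ^ Poly_Mapping.lookup m (i, k)) \<in> GT"
        by (rule permutation_sum_in_subring[where G = GT and n = "v i" and x = "\<lambda>k. Var (i, k)"
              and a = "\<lambda>k. Poly_Mapping.lookup m (i, k)"])
          (use GT_1 GT_add GT_mult GT_uminus power_sum_GT[OF i] in \<open>auto simp: power_sum_def\<close>)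
    qed
    finally show ?thesis .
  qed
  have exp: "f = (\<Sum>m\<in>Poly_Mapping.keys f. Const (Poly_Mapping.lookup f m) * monom_subst Var m)"
    using poly_mapping_eq_sum_single[of f] by (simp only: single_eq_Const_Var)
  have "Const (of_nat (card ?S)) * f = (\<Sum>\<pi>\<in>?S. f)" by simp
  also have "\<dots> = (\<Sum>\<pi>\<in>?S. ?act \<pi> f)"
    by (rule sum.cong) (use f in \<open>auto simp: P_inv_perm_vars\<close>)
  also have "\<dots> = (\<Sum>\<pi>\<in>?S. \<Sum>m\<in>Poly_Mapping.keys f. Const (Poly_Mapping.lookup f m) * ?act \<pi> (monom_subst Var m))"
    by (rule sum.cong[OF refl], subst exp) (simp add: perm_vars_def)
  also have "\<dots> = (\<Sum>m\<in>Poly_Mapping.keys f. Const (Poly_Mapping.lookup f m) * (\<Sum>\<pi>\<in>?S. ?act \<pi> (monom_subst Var m)))"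
    unfolding sum_distrib_left by (rule sum.swap)
  also have "\<dots> \<in> GT"
  proof (rule GT_sum, rule GT_mult, rule GT_Const, rule mono)
    fix m assume "m \<in> Poly_Mapping.keys f"
    thus "Poly_Mapping.keys m \<subseteq> vset" using P_inv_P[OF f] unfolding P_eq poly_in_def by blast
  qed
  finally have *: "Const (of_nat (card ?S)) * f \<in> GT" .
  have "inverse (of_nat (card ?S)) * of_nat (card ?S) = (1 :: hfield)"
    by (rule left_inverse) (use cS in \<open>simp only: of_nat_eq_0_iff not_False_eq_True\<close>)
  hence "Const (inverse (of_nat (card ?S))) * (Const (of_nat (card ?S)) * f) = f"
    by (simp only: mult.assoc[symmetric] Const_mult[symmetric] Const_1 mult_1_left)
  thus ?thesis using GT_mult[OF GT_Const *, of "inverse (of_nat (card ?S))"] by (simp only:)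
qed

lemma mult_Y: "g \<in> P_inv \<Longrightarrow> (\<lambda>f\<in>P_inv. g * f) \<in> carrier Y"
  using P_inv_GT by (auto simp: GT_def)

lemma Y_props:
  assumes "X \<in> carrier Y"
  shows "X \<in> extensional P_inv" "f \<in> P_inv \<Longrightarrow> X f \<in> P_inv"
    "f \<in> P_inv \<Longrightarrow> g \<in> P_inv \<Longrightarrow> X (f + g) = X f + X g"
    "f \<in> P_inv \<Longrightarrow> X (Const c * f) = Const c * X f"
  using assms Y_carrier by (auto simp: End_algebra_carrier)

lemma Y_comp: "X \<in> carrier Y \<Longrightarrow> X' \<in> carrier Y \<Longrightarrow> (\<lambda>f\<in>P_inv. X (X' f)) \<in> carrier Y"
  unfolding Y_carrier_eq
  by (drule (1) generated_subalgebra.mult) (simp only: End_algebra_simps compose_def)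

lemma Y_add: "X \<in> carrier Y \<Longrightarrow> X' \<in> carrier Y \<Longrightarrow> (\<lambda>f\<in>P_inv. X f + X' f) \<in> carrier Y"
  unfolding Y_carrier_eq
  by (drule (1) generated_subalgebra.add) (simp only: End_algebra_simps)

lemma Y_smult: "X \<in> carrier Y \<Longrightarrow> (\<lambda>f\<in>P_inv. Const c * X f) \<in> carrier Y"
  unfolding Y_carrier_eq
  by (drule generated_subalgebra.smult[of _ _ _ c]) (simp only: End_algebra_simps)

section \<open>The corner of the flag algebra\<close>

definition nilHecke_gens :: "('q xpoly \<Rightarrow> 'q xpoly) set" where
  "nilHecke_gens = {\<lambda>f\<in>P. divided_diff i k f |i k. i \<in> Qp \<and> 1 \<le> k \<and> k < v i} \<union>
      {\<lambda>f\<in>P. g * f |g. g \<in> P}"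

definition NH :: "(hfield, 'q xpoly \<Rightarrow> 'q xpoly) module" where
  "NH = (End_algebra P)\<lparr>carrier := generated_subalgebra (End_algebra P) nilHecke_gens\<rparr>"

lemma NH_carrier_eq: "carrier NH = generated_subalgebra (End_algebra P) nilHecke_gens"
  by (simp add: NH_def)

lemma FY_carrier_eq: "carrier FY = generated_subalgebra (End_algebra P)
    (nilHecke_gens \<union> {\<lambda>f\<in>P. X (e_inv f) |X. X \<in> carrier Y})"
  by (simp add: FY_def nilHecke_gens_def)

lemma poly_subspace_P: "poly_subspace P"
  by unfold_locales (simp_all add: P_eq)

lemma P_closed: "1 \<in> P" "f \<in> P \<Longrightarrow> g \<in> P \<Longrightarrow> f + g \<in> P" "f \<in> P \<Longrightarrow> g \<in> P \<Longrightarrow> f * g \<in> P" "Const c \<in> P"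
  by (simp_all add: P_eq)

lemma divided_diff_P: "i \<in> Qp \<Longrightarrow> 1 \<le> k \<Longrightarrow> k < v i \<Longrightarrow> f \<in> P \<Longrightarrow> divided_diff i k f \<in> P"
  using dops_P[of i "[k]" f] by (simp add: divided_diff_eq)

lemma divided_diff_mult:
  "i \<in> Qp \<Longrightarrow> 1 \<le> k \<Longrightarrow> k < v i \<Longrightarrow> h \<in> P_inv \<Longrightarrow> divided_diff i k (h * f) = h * divided_diff i k f"
  unfolding divided_diff_eq by (rule ddiff_mult_invariant) (simp_all add: P_inv_swap)

lemma divided_diff_add: "divided_diff i k (f + g) = divided_diff i k f + divided_diff i k g"
  unfolding divided_diff_eq by (rule ddiff_add) simp

lemma nilHecke_gens_closed: "nilHecke_gens \<subseteq> carrier (End_algebra P)"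
  unfolding nilHecke_gens_def
  by (auto simp: End_algebra_carrier divided_diff_P divided_diff_add distrib_left mult.left_commute
      divided_diff_mult P_closed)

lemma FY_gens_closed:
  "nilHecke_gens \<union> {\<lambda>f\<in>P. X (e_inv f) |X. X \<in> carrier Y} \<subseteq> carrier (End_algebra P)"
proof -
  have "(\<lambda>f\<in>P. X (e_inv f)) \<in> carrier (End_algebra P)" if "X \<in> carrier Y" for X
    using Y_props[OF that] e_inv_closed P_inv_P
    by (auto simp: End_algebra_carrier e_inv_add e_inv_mult P_eq)
  thus ?thesis using nilHecke_gens_closed by auto
qed

lemma assoc_algebra_NH: "assoc_algebra NH"
  unfolding NH_def by (rule poly_subspace.assoc_algebra_generated[OF poly_subspace_P nilHecke_gens_closed])

lemma FY_eq: "FY = (End_algebra P)\<lparr>carrier := generated_subalgebra (End_algebra P)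
    (nilHecke_gens \<union> {\<lambda>f\<in>P. X (e_inv f) |X. X \<in> carrier Y})\<rparr>"
  by (simp add: FY_def nilHecke_gens_def)

lemma assoc_algebra_FY: "assoc_algebra FY"
  unfolding FY_eq by (rule poly_subspace.assoc_algebra_generated[OF poly_subspace_P FY_gens_closed])

lemma NH_FY: "carrier NH \<subseteq> carrier FY"
  unfolding NH_carrier_eq FY_carrier_eq by (rule generated_subalgebra_mono) auto

lemma FY_End: "carrier FY \<subseteq> carrier (End_algebra P)"
  unfolding FY_carrier_eq by (rule poly_subspace.generated_closed[OF poly_subspace_P FY_gens_closed])

lemma FY_props:
  assumes "T \<in> carrier FY"
  shows "T \<in> extensional P" "f \<in> P \<Longrightarrow> T f \<in> P" "f \<in> P \<Longrightarrow> g \<in> P \<Longrightarrow> T (f + g) = T f + T g"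
    "f \<in> P \<Longrightarrow> T (Const c * f) = Const c * T f"
  using assms FY_End by (auto simp: End_algebra_carrier)

lemma NH_mult:
  assumes "T \<in> carrier NH" "h \<in> P_inv" "f \<in> P"
  shows "T (h * f) = h * T f"
  using assms(1,3) unfolding NH_carrier_eq
proof (induction arbitrary: f)
  case one
  thus ?case using assms(2) P_inv_P by (simp add: End_algebra_simps P_eq)
next
  case (incl T)
  thus ?case using assms(2) P_inv_P[OF assms(2)]
    by (auto simp: nilHecke_gens_def divided_diff_mult P_eq mult.left_commute)
next
  case (smult T c)
  thus ?case using assms(2) P_inv_P by (simp add: End_algebra_simps P_eq mult.left_commute)
next
  case (add T U)
  thus ?case using assms(2) P_inv_P by (simp add: End_algebra_simps P_eq distrib_left)
next
  case (mult T U)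
  hence "U f \<in> P" using FY_props(2)[of U f] NH_FY by (auto simp: NH_carrier_eq)
  thus ?case using mult assms(2) P_inv_P by (simp add: End_algebra_simps compose_def P_eq)
qed

lemma algebra_ops:
  "S \<otimes>\<^bsub>NH\<^esub> T = compose P S T" "S \<oplus>\<^bsub>NH\<^esub> T = (\<lambda>f\<in>P. S f + T f)" "\<one>\<^bsub>NH\<^esub> = (\<lambda>f\<in>P. f)"
  "S \<otimes>\<^bsub>FY\<^esub> T = compose P S T" "S \<oplus>\<^bsub>FY\<^esub> T = (\<lambda>f\<in>P. S f + T f)" "\<one>\<^bsub>FY\<^esub> = (\<lambda>f\<in>P. f)"
  "c \<odot>\<^bsub>FY\<^esub> T = (\<lambda>f\<in>P. Const c * T f)"
  "X \<otimes>\<^bsub>Y\<^esub> X' = compose P_inv X X'" "X \<oplus>\<^bsub>Y\<^esub> X' = (\<lambda>f\<in>P_inv. X f + X' f)" "\<one>\<^bsub>Y\<^esub> = (\<lambda>f\<in>P_inv. f)"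
  "c \<odot>\<^bsub>Y\<^esub> X = (\<lambda>f\<in>P_inv. Const c * X f)"
  by (simp_all add: NH_def FY_eq Y_def End_algebra_simps)

section \<open>The longest element of the product of symmetric groups\<close>

definition w0_ops :: "'q list \<Rightarrow> 'q xpoly \<Rightarrow> 'q xpoly" where
  "w0_ops is = foldr (\<lambda>i. dops i (w0_word (v i))) is"

lemma w0_ops_simps [simp]:
  "w0_ops [] f = f" "w0_ops (i # is) f = dops i (w0_word (v i)) (w0_ops is f)"
  by (simp_all add: w0_ops_def)

lemma w0_ops_P: "set is \<subseteq> Qp \<Longrightarrow> f \<in> P \<Longrightarrow> w0_ops is f \<in> P"
  by (induction "is") (auto intro: dops_P[OF _ set_w0_word])

lemma w0_ops_P_inv:
  assumes "f \<in> P" shows "w0_ops (sorted_list_of_set Qp) f \<in> P_inv"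
proof -
  have "\<forall>i\<in>set is. \<forall>k. 1 \<le> k \<longrightarrow> k < v i \<longrightarrow> swap_vars (i, k) (i, Suc k) (w0_ops is f) = w0_ops is f" for "is"
  proof (induction "is")
    case (Cons i "is")
    have "swap_vars (j, k) (j, Suc k) (dops i (w0_word (v i)) (w0_ops is f)) = dops i (w0_word (v i)) (w0_ops is f)"
      if "j \<in> set (i # is)" "1 \<le> k" "k < v j" for j k
    proof (cases "i = j")
      case False
      hence "swap_vars (j, k) (j, Suc k) (dops i (w0_word (v i)) (w0_ops is f)) =
          dops i (w0_word (v i)) (swap_vars (j, k) (j, Suc k) (w0_ops is f))"
        by (intro swap_vars_dops_commute) auto
      thus ?thesis using that Cons False by auto
    qed (use that swap_vars_dops_w0 in simp)
    thus ?case by simp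
  qed simp
  thus ?thesis using w0_ops_P[OF _ assms] by (simp add: P_inv_iff finite_Qp)
qed

lemma NH_dops:
  assumes "(\<lambda>f\<in>P. T f) \<in> carrier NH" "\<And>f. f \<in> P \<Longrightarrow> T f \<in> P" "i \<in> Qp" "set ks \<subseteq> {1..<v i}"
  shows "(\<lambda>f\<in>P. dops i ks (T f)) \<in> carrier NH"
  using assms(4)
proof (induction ks)
  case (Cons k ks)
  have a: "(\<lambda>f\<in>P. divided_diff i k f) \<in> carrier NH"
    unfolding NH_carrier_eq nilHecke_gens_def using assms(3) Cons.prems
    by (intro generated_subalgebra.incl) auto
  have b: "(\<lambda>f\<in>P. dops i ks (T f)) \<in> carrier NH"
    by (rule Cons.IH) (use Cons.prems in simp)
  from generated_subalgebra.mult[OF a[unfolded NH_carrier_eq] b[unfolded NH_carrier_eq]]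
  have "compose P (\<lambda>f\<in>P. divided_diff i k f) (\<lambda>f\<in>P. dops i ks (T f)) \<in> carrier NH"
    unfolding NH_carrier_eq End_algebra_simps .
  also have "compose P (\<lambda>f\<in>P. divided_diff i k f) (\<lambda>f\<in>P. dops i ks (T f)) = (\<lambda>f\<in>P. dops i (k # ks) (T f))"
    unfolding compose_def using assms(2,3) Cons.prems dops_P[of i ks]
    by (intro restrict_ext) (simp add: divided_diff_eq)
  finally show ?case .
qed (use assms in simp)

lemma NH_w0_ops: "set is \<subseteq> Qp \<Longrightarrow> (\<lambda>f\<in>P. w0_ops is f) \<in> carrier NH"
proof (induction "is")
  case Nil
  have "\<one>\<^bsub>End_algebra P\<^esub> \<in> carrier NH" unfolding NH_carrier_eq by (rule generated_subalgebra.one)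
  thus ?case by (simp only: End_algebra_simps w0_ops_simps)
next
  case (Cons i "is")
  have "(\<lambda>f\<in>P. dops i (w0_word (v i)) (w0_ops is f)) \<in> carrier NH"
  proof (rule NH_dops[OF _ _ _ set_w0_word])
    show "(\<lambda>f\<in>P. w0_ops is f) \<in> carrier NH" by (rule Cons.IH) (use Cons.prems in simp)
  qed (use Cons.prems w0_ops_P in auto)
  thus ?case by (simp only: w0_ops_simps)
qed

abbreviation W0 :: "'q xpoly \<Rightarrow> 'q xpoly" where
  "W0 \<equiv> \<lambda>f\<in>P. w0_ops (sorted_list_of_set Qp) f"

lemma W0_NH: "W0 \<in> carrier NH"
  by (rule NH_w0_ops) (simp add: finite_Qp)

text \<open>The vertices are stripped off one at a time. The operators at the remaining vertices
  commute with the variables at the current one, and they play the part of \<open>U\<close> in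
  \<open>ideal_dops_w0\<close>.\<close>

lemma one_in_ideal_W0: "\<one>\<^bsub>NH\<^esub> \<in> genideal NH {W0}"
proof -
  interpret NH: assoc_algebra NH by (rule assoc_algebra_NH)
  let ?I = "genideal NH {W0}"
  interpret I: ideal ?I NH by (rule NH.genideal_ideal) (simp add: W0_NH)
  \<comment> \<open>Elements of the algebra are undefined outside \<open>P\<close>, whereas the
    peeling argument treats functions on all polynomials; membership is therefore tested after
    restriction.\<close>
  define J where "J = {T. (\<lambda>f\<in>P. T f) \<in> ?I}"
  have mult: "(\<lambda>f\<in>P. g * f) \<in> carrier NH" if "g \<in> P" for g
    unfolding NH_carrier_eq nilHecke_gens_def using that by (intro generated_subalgebra.incl) auto
  have J_P: "T f \<in> P" if "T \<in> J" "f \<in> P" for T f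
  proof -
    have "(\<lambda>f\<in>P. T f) \<in> carrier FY" using that(1) I.Icarr NH_FY by (auto simp: J_def)
    from FY_props(2)[OF this that(2)] that(2) show ?thesis by simp
  qed
  have left: "(\<lambda>f. g * T f) \<in> J" if "T \<in> J" "g \<in> P" for g T
  proof -
    have "(\<lambda>f\<in>P. g * f) \<otimes>\<^bsub>NH\<^esub> (\<lambda>f\<in>P. T f) \<in> ?I"
      using that mult by (intro I.I_l_closed) (auto simp: J_def)
    also have "(\<lambda>f\<in>P. g * f) \<otimes>\<^bsub>NH\<^esub> (\<lambda>f\<in>P. T f) = (\<lambda>f\<in>P. g * T f)"
      unfolding algebra_ops compose_def using J_P[OF that(1)] by (intro restrict_ext) simp
    finally show ?thesis unfolding J_def by blast
  qed
  have right: "(\<lambda>f. T (g * f)) \<in> J" if "T \<in> J" "g \<in> P" for g T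
  proof -
    have "(\<lambda>f\<in>P. T f) \<otimes>\<^bsub>NH\<^esub> (\<lambda>f\<in>P. g * f) \<in> ?I"
      using that mult by (intro I.I_r_closed) (auto simp: J_def)
    also have "(\<lambda>f\<in>P. T f) \<otimes>\<^bsub>NH\<^esub> (\<lambda>f\<in>P. g * f) = (\<lambda>f\<in>P. T (g * f))"
      unfolding algebra_ops compose_def using that(2) by (intro restrict_ext) (simp add: P_eq)
    finally show ?thesis unfolding J_def by blast
  qed
  have diff: "(\<lambda>f. S f - T f) \<in> J" if "S \<in> J" "T \<in> J" for S T
  proof -
    have "(\<lambda>f\<in>P. S f) \<oplus>\<^bsub>NH\<^esub> (\<lambda>f\<in>P. - 1 * T f) \<in> ?I"
      using that(1) left[OF that(2), of "- 1"] by (intro I.a_closed) (auto simp: J_def P_eq)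
    also have "(\<lambda>f\<in>P. S f) \<oplus>\<^bsub>NH\<^esub> (\<lambda>f\<in>P. - 1 * T f) = (\<lambda>f\<in>P. S f - T f)"
      unfolding algebra_ops by (intro restrict_ext) simp
    finally show ?thesis unfolding J_def by blast
  qed
  have Var: "Var (i, k) \<in> P" if "i \<in> Qp" "1 \<le> k" "k \<le> v i" for i k
    using that by (auto simp: P_eq vset_def)
  have step: "set is \<subseteq> Qp \<Longrightarrow> distinct is \<Longrightarrow> w0_ops is \<in> J \<Longrightarrow> (\<lambda>f. f) \<in> J" for "is"
  proof (induction "is")
    case (Cons i "is")
    have "w0_ops ls (Var (i, k) * f) = Var (i, k) * w0_ops ls f" if "i \<notin> set ls" for ls k f
      using that by (induction ls) (simp_all add: dops_Var_mult)
    moreover have "(\<lambda>f. dops i (w0_word (v i)) (w0_ops is f)) \<in> J"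
      using Cons.prems(3) by (simp add: w0_ops_def comp_def)
    moreover have i: "i \<in> Qp" "i \<notin> set is" using Cons.prems by auto
    ultimately have "w0_ops is \<in> J"
      by (intro ideal_dops_w0[where J = J and n = "v i" and i = i and U = "w0_ops is"] diff
          left[OF _ Var] right[OF _ Var])
    thus ?case using Cons by simp
  qed (simp add: w0_ops_def id_def)
  have "w0_ops (sorted_list_of_set Qp) \<in> J"
    unfolding J_def mem_Collect_eq by (rule NH.genideal_self'[OF W0_NH])
  hence "(\<lambda>f. f) \<in> J" by (intro step[of "sorted_list_of_set Qp"]) (simp_all add: finite_Qp)
  thus ?thesis unfolding J_def mem_Collect_eq algebra_ops .
qed

lemma one_in_span_W0: "\<one>\<^bsub>NH\<^esub> \<in> corner_span NH W0 (carrier NH)"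
proof -
  interpret NH: assoc_algebra NH by (rule assoc_algebra_NH)
  show ?thesis using NH.genideal_subset_corner_span[OF W0_NH] one_in_ideal_W0 by blast
qed

lemma corner_span_W0_NH: "x \<in> corner_span NH W0 (carrier NH) \<Longrightarrow> x \<in> carrier NH"
proof (induction rule: corner_span.induct)
  interpret NH: assoc_algebra NH by (rule assoc_algebra_NH)
  {
    case (gen p q)
    thus ?case by (intro NH.m_closed W0_NH)
  next
    case (add x y)
    thus ?case by (intro NH.a_closed)
  }
qed

text \<open>A symmetric \<open>f\<close> passes through \<open>n\<close> and through the projection.
  On symmetric polynomials a compressed nilHecke operator is thus multiplication by the symmetric
  polynomial \<open>e_inv (n 1)\<close>.\<close>

lemma e_inv_NH:
  assumes "n \<in> carrier NH" "f \<in> P_inv"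
  shows "e_inv (n f) = e_inv (n 1) * f"
proof -
  have "n (f * 1) = f * n 1" by (rule NH_mult[OF assms]) (simp add: P_eq)
  thus ?thesis using e_inv_mult[OF assms(2), of "n 1"] by (simp add: mult.commute)
qed

text \<open>Compressing a product of elements of \<open>FY\<close> by \<open>e_inv\<close> gives a product of compressions once
  a factor \<open>1 = \<Sum> p W q\<close> with \<open>p\<close>, \<open>q\<close> in the nilHecke algebra is inserted in between.\<close>

lemma FY_compression:
  assumes "a \<in> carrier FY"
  shows "n \<in> carrier NH \<Longrightarrow> n' \<in> carrier NH \<Longrightarrow> (\<lambda>f\<in>P_inv. e_inv (n (a (n' f)))) \<in> carrier Y"
  using assms unfolding FY_carrier_eq
proof (induction arbitrary: n n')
  have NHp: "T f \<in> P" if "T \<in> carrier NH" "f \<in> P" for T f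
    using FY_props(2) NH_FY that by blast
  have P1: "1 \<in> P" by (simp add: P_eq)
  interpret NH: assoc_algebra NH by (rule assoc_algebra_NH)
  \<comment> \<open>For a nilHecke element in the middle the whole composite is nilHecke, and its
    compression is multiplication by a symmetric polynomial. This is where the membership of all
    symmetric polynomials in \<open>Y\<close> is used.\<close>
  have lin: "(\<lambda>f\<in>P_inv. e_inv (n (m (n' f)))) \<in> carrier Y"
    if "n \<in> carrier NH" "m \<in> carrier NH" "n' \<in> carrier NH" for n m n'
  proof -
    have "n \<otimes>\<^bsub>NH\<^esub> (m \<otimes>\<^bsub>NH\<^esub> n') \<in> carrier NH" by (intro NH.m_closed that)
    note e = e_inv_NH[OF this]
    have c: "(n \<otimes>\<^bsub>NH\<^esub> (m \<otimes>\<^bsub>NH\<^esub> n')) f = n (m (n' f))" if "f \<in> P" for f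
      using that by (simp add: algebra_ops compose_def)
    have "e_inv (n (m (n' f))) = e_inv (n (m (n' 1))) * f" if "f \<in> P_inv" for f
      using e[OF that] P1 P_inv_P[OF that] by (simp add: c)
    hence eq: "(\<lambda>f\<in>P_inv. e_inv (n (m (n' f)))) = (\<lambda>f\<in>P_inv. e_inv (n (m (n' 1))) * f)"
      by (rule restrict_ext)
    show ?thesis unfolding eq
      by (rule mult_Y[OF e_inv_closed[OF NHp[OF that(1) NHp[OF that(2) NHp[OF that(3) P1]]]]])
  qed
  {
    case one
    have "\<one>\<^bsub>End_algebra P\<^esub> \<in> carrier NH"
      unfolding NH_carrier_eq by (rule generated_subalgebra.one)
    thus ?case by (rule lin[OF one.prems(1) _ one.prems(2)])
  next
    case (incl a)
    then consider "a \<in> nilHecke_gens" | X where "X \<in> carrier Y" "a = (\<lambda>f\<in>P. X (e_inv f))" by blast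
    thus ?case
    proof cases
      case 1
      hence "a \<in> carrier NH" unfolding NH_carrier_eq by (rule generated_subalgebra.incl)
      thus ?thesis by (rule lin[OF incl.prems(1) _ incl.prems(2)])
    next
      case (2 X)
      \<comment> \<open>A generator coming from \<open>X\<close> already contains the projection, so
        the compression is \<open>X\<close> between two multiplications by symmetric
        polynomials.\<close>
      have u: "e_inv (n 1) \<in> P_inv" "e_inv (n' 1) \<in> P_inv" using incl NHp P1 e_inv_closed by blast+
      have "(\<lambda>f\<in>P_inv. (\<lambda>f\<in>P_inv. e_inv (n 1) * f) ((\<lambda>f\<in>P_inv. X ((\<lambda>f\<in>P_inv. e_inv (n' 1) * f) f)) f)) \<in> carrier Y"
        using 2 u by (intro Y_comp mult_Y)
      also have "(\<lambda>f\<in>P_inv. (\<lambda>f\<in>P_inv. e_inv (n 1) * f) ((\<lambda>f\<in>P_inv. X ((\<lambda>f\<in>P_inv. e_inv (n' 1) * f) f)) f)) =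
          (\<lambda>f\<in>P_inv. e_inv (n (a (n' f))))"
      proof (rule restrict_ext)
        fix f assume f: "f \<in> P_inv"
        have "n' f \<in> P" using incl NHp P_inv_P[OF f] by blast
        hence "a (n' f) = X (e_inv (n' 1) * f)" using 2(2) e_inv_NH[OF incl(3) f] by simp
        moreover have z: "X (e_inv (n' 1) * f) \<in> P_inv" using Y_props(2)[OF 2(1)] u f by simp
        ultimately show "(\<lambda>f\<in>P_inv. e_inv (n 1) * f) ((\<lambda>f\<in>P_inv. X ((\<lambda>f\<in>P_inv. e_inv (n' 1) * f) f)) f) =
            e_inv (n (a (n' f)))"
          using f u e_inv_NH[OF incl(2) z] by simp
      qed
      finally show ?thesis .
    qed
  next
    case (smult a c)
    have aF: "a \<in> carrier FY" using smult by (simp add: FY_carrier_eq)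
    have "(\<lambda>f\<in>P_inv. Const c * (\<lambda>f\<in>P_inv. e_inv (n (a (n' f)))) f) \<in> carrier Y"
      by (rule Y_smult[OF smult.IH[OF smult.prems]])
    also have "(\<lambda>f\<in>P_inv. Const c * (\<lambda>f\<in>P_inv. e_inv (n (a (n' f)))) f) =
        (\<lambda>f\<in>P_inv. e_inv (n ((c \<odot>\<^bsub>End_algebra P\<^esub> a) (n' f))))"
    proof (rule restrict_ext)
      fix f assume f: "f \<in> P_inv"
      have "n' f \<in> P" using smult.prems NHp P_inv_P[OF f] by blast
      thus "Const c * (\<lambda>f\<in>P_inv. e_inv (n (a (n' f)))) f = e_inv (n ((c \<odot>\<^bsub>End_algebra P\<^esub> a) (n' f)))"
        using f NH_mult[OF smult.prems(1) P_inv_Const, of "a (n' f)" c] FY_props(2)[OF aF]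
        by (simp add: End_algebra_simps e_inv_mult)
    qed
    finally show ?case .
  next
    case (add a b)
    have F: "a \<in> carrier FY" "b \<in> carrier FY" using add by (simp_all add: FY_carrier_eq)
    have "(\<lambda>f\<in>P_inv. (\<lambda>f\<in>P_inv. e_inv (n (a (n' f)))) f + (\<lambda>f\<in>P_inv. e_inv (n (b (n' f)))) f) \<in> carrier Y"
      by (rule Y_add[OF add.IH(1)[OF add.prems] add.IH(2)[OF add.prems]])
    also have "(\<lambda>f\<in>P_inv. (\<lambda>f\<in>P_inv. e_inv (n (a (n' f)))) f + (\<lambda>f\<in>P_inv. e_inv (n (b (n' f)))) f) =
        (\<lambda>f\<in>P_inv. e_inv (n ((a \<oplus>\<^bsub>End_algebra P\<^esub> b) (n' f))))"
    proof (rule restrict_ext)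
      fix f assume f: "f \<in> P_inv"
      have "n' f \<in> P" using add.prems NHp P_inv_P[OF f] by blast
      thus "(\<lambda>f\<in>P_inv. e_inv (n (a (n' f)))) f + (\<lambda>f\<in>P_inv. e_inv (n (b (n' f)))) f =
          e_inv (n ((a \<oplus>\<^bsub>End_algebra P\<^esub> b) (n' f)))"
        using f FY_props(3)[of n "a (n' f)" "b (n' f)"] add.prems(1) NH_FY FY_props(2)[OF F(1)] FY_props(2)[OF F(2)]
        by (auto simp: End_algebra_simps e_inv_add)
    qed
    finally show ?case .
  next
    case (mult a b)
    have F: "a \<in> carrier FY" "b \<in> carrier FY" using mult by (simp_all add: FY_carrier_eq)
    \<comment> \<open>The unit between \<open>a\<close> and \<open>b\<close> is replaced by
      \<open>p W0 q\<close>. Since \<open>W0\<close> produces symmetric polynomials, the projection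
      may be inserted after it, which splits the composite into two compressions. The factors
      \<open>p\<close> and \<open>W0 q\<close> are absorbed by the arbitrary nilHecke operators of
      the induction hypotheses.\<close>
    have "(\<lambda>f\<in>P_inv. e_inv (n (a (x (b (n' f)))))) \<in> carrier Y" if "x \<in> corner_span NH W0 (carrier NH)" for x
      using that
    proof induction
      case (gen p q)
      have Wq: "W0 \<otimes>\<^bsub>NH\<^esub> q \<in> carrier NH" using gen by (intro NH.m_closed W0_NH)
      have "(\<lambda>f\<in>P_inv. (\<lambda>f\<in>P_inv. e_inv (n (a (p f)))) ((\<lambda>f\<in>P_inv. e_inv ((W0 \<otimes>\<^bsub>NH\<^esub> q) (b (n' f)))) f)) \<in> carrier Y"
        using mult.IH(1)[OF mult.prems(1) gen(1)] mult.IH(2)[OF Wq mult.prems(2)] by (rule Y_comp)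
      also have "(\<lambda>f\<in>P_inv. (\<lambda>f\<in>P_inv. e_inv (n (a (p f)))) ((\<lambda>f\<in>P_inv. e_inv ((W0 \<otimes>\<^bsub>NH\<^esub> q) (b (n' f)))) f)) =
          (\<lambda>f\<in>P_inv. e_inv (n (a ((p \<otimes>\<^bsub>NH\<^esub> W0 \<otimes>\<^bsub>NH\<^esub> q) (b (n' f))))))"
      proof (rule restrict_ext)
        fix f assume f: "f \<in> P_inv"
        have y: "b (n' f) \<in> P" using mult.prems NHp P_inv_P[OF f] FY_props(2)[OF F(2)] by blast
        have qP: "q (b (n' f)) \<in> P" using y gen NHp by blast
        have W: "W0 (q (b (n' f))) \<in> P_inv" using w0_ops_P_inv[OF qP] qP by simp
        show "(\<lambda>f\<in>P_inv. e_inv (n (a (p f)))) ((\<lambda>f\<in>P_inv. e_inv ((W0 \<otimes>\<^bsub>NH\<^esub> q) (b (n' f)))) f) =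
            e_inv (n (a ((p \<otimes>\<^bsub>NH\<^esub> W0 \<otimes>\<^bsub>NH\<^esub> q) (b (n' f)))))"
          using f y W qP unfolding algebra_ops compose_def by (simp add: e_inv_ident)
      qed
      finally show ?case .
    next
      case (add x y)
      have xy: "x \<in> carrier NH" "y \<in> carrier NH" using add corner_span_W0_NH by blast+
      from Y_add[OF add.IH]
      have "(\<lambda>f\<in>P_inv. (\<lambda>f\<in>P_inv. e_inv (n (a (x (b (n' f)))))) f + (\<lambda>f\<in>P_inv. e_inv (n (a (y (b (n' f)))))) f) \<in> carrier Y" .
      also have "(\<lambda>f\<in>P_inv. (\<lambda>f\<in>P_inv. e_inv (n (a (x (b (n' f)))))) f + (\<lambda>f\<in>P_inv. e_inv (n (a (y (b (n' f)))))) f) =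
          (\<lambda>f\<in>P_inv. e_inv (n (a ((x \<oplus>\<^bsub>NH\<^esub> y) (b (n' f))))))"
      proof (rule restrict_ext)
        fix f assume f: "f \<in> P_inv"
        let ?z = "b (n' f)"
        have z: "?z \<in> P" using mult.prems NHp P_inv_P[OF f] FY_props(2)[OF F(2)] by blast
        have xz: "x ?z \<in> P" "y ?z \<in> P" using xy NHp z by blast+
        have "a (x ?z) \<in> P" "a (y ?z) \<in> P" using FY_props(2)[OF F(1)] xz by blast+
        hence "n (a (x ?z + y ?z)) = n (a (x ?z)) + n (a (y ?z))"
          using FY_props(3)[OF F(1) xz] FY_props(3)[of n] mult.prems(1) NH_FY by auto
        thus "(\<lambda>f\<in>P_inv. e_inv (n (a (x (b (n' f)))))) f + (\<lambda>f\<in>P_inv. e_inv (n (a (y (b (n' f)))))) f =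
            e_inv (n (a ((x \<oplus>\<^bsub>NH\<^esub> y) (b (n' f)))))"
          using f z by (simp add: algebra_ops e_inv_add)
      qed
      finally show ?case .
    qed
    from this[OF one_in_span_W0]
    have "(\<lambda>f\<in>P_inv. e_inv (n (a (\<one>\<^bsub>NH\<^esub> (b (n' f)))))) \<in> carrier Y" .
    also have "(\<lambda>f\<in>P_inv. e_inv (n (a (\<one>\<^bsub>NH\<^esub> (b (n' f)))))) =
        (\<lambda>f\<in>P_inv. e_inv (n ((a \<otimes>\<^bsub>End_algebra P\<^esub> b) (n' f))))"
    proof (rule restrict_ext)
      fix f assume f: "f \<in> P_inv"
      have n'f: "n' f \<in> P" using mult.prems NHp P_inv_P[OF f] by blast
      thus "e_inv (n (a (\<one>\<^bsub>NH\<^esub> (b (n' f))))) = e_inv (n ((a \<otimes>\<^bsub>End_algebra P\<^esub> b) (n' f)))"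
        using FY_props(2)[OF F(2) n'f] by (simp add: algebra_ops End_algebra_simps compose_def)
    qed
    finally show ?case .
  }
qed

text \<open>The compression with trivial nilHecke factors identifies the corner with
  \<open>Y\<close>, and its injectivity holds because the projection fixes symmetric polynomials.
  Fullness is inherited from the nilHecke algebra.\<close>

lemma full_corner_FY: "full_corner FY Y (\<lambda>f\<in>P. e_inv f) (\<lambda>X. \<lambda>f\<in>P. X (e_inv f))"
proof -
  let ?e = "\<lambda>f\<in>P. e_inv f" and ?\<iota> = "\<lambda>X. \<lambda>f\<in>P. X (e_inv f)"
  interpret FY: assoc_algebra FY by (rule assoc_algebra_FY)
  interpret Y: assoc_algebra Y by (rule assoc_algebra_Y)
  have \<iota>: "?\<iota> X \<in> carrier FY" if "X \<in> carrier Y" for X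
    unfolding FY_carrier_eq using that by (intro generated_subalgebra.incl) blast
  have \<iota>1: "?\<iota> \<one>\<^bsub>Y\<^esub> = ?e"
    unfolding algebra_ops by (intro restrict_ext) (simp add: e_inv_closed)
  have e: "?e \<in> carrier FY" using \<iota>[OF Y.one_closed] unfolding \<iota>1 .
  have one_NH: "(\<lambda>f\<in>P. f) \<in> carrier NH"
    using generated_subalgebra.one[of "End_algebra P" nilHecke_gens]
    unfolding NH_carrier_eq End_algebra_simps .
  show ?thesis
  proof (unfold_locales)
    show "?e \<in> carrier FY" by (rule e)
    show "?\<iota> X \<in> carrier FY" if "X \<in> carrier Y" for X by (rule \<iota>[OF that])
    show "inj_on ?\<iota> (carrier Y)"
    proof (rule inj_onI)
      fix X X' assume X: "X \<in> carrier Y" "X' \<in> carrier Y" "?\<iota> X = ?\<iota> X'"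
      show "X = X'"
      proof (rule extensionalityI[OF Y_props(1)[OF X(1)] Y_props(1)[OF X(2)]])
        fix f assume f: "f \<in> P_inv"
        show "X f = X' f" using fun_cong[OF X(3), of f] f P_inv_P[OF f] by (simp add: e_inv_ident)
      qed
    qed
    show "?\<iota> (X \<oplus>\<^bsub>Y\<^esub> X') = ?\<iota> X \<oplus>\<^bsub>FY\<^esub> ?\<iota> X'" for X X'
      unfolding algebra_ops by (intro restrict_ext) (simp add: e_inv_closed)
    show "?\<iota> (X \<otimes>\<^bsub>Y\<^esub> X') = ?\<iota> X \<otimes>\<^bsub>FY\<^esub> ?\<iota> X'" if "X \<in> carrier Y" "X' \<in> carrier Y" for X X'
      unfolding algebra_ops compose_def
      by (intro restrict_ext) (simp add: e_inv_closed Y_props(2)[OF that(2)] P_inv_P e_inv_ident)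
    show "?\<iota> \<one>\<^bsub>Y\<^esub> = ?e" by (rule \<iota>1)
    show "?\<iota> (k \<odot>\<^bsub>Y\<^esub> X) = k \<odot>\<^bsub>FY\<^esub> ?\<iota> X" for k X
      unfolding algebra_ops by (intro restrict_ext) (simp add: e_inv_closed)
    show "?e \<otimes>\<^bsub>FY\<^esub> a \<otimes>\<^bsub>FY\<^esub> ?e \<in> ?\<iota> ` carrier Y" if a: "a \<in> carrier FY" for a
    proof (rule image_eqI)
      show "(\<lambda>f\<in>P_inv. e_inv ((\<lambda>f\<in>P. f) (a ((\<lambda>f\<in>P. f) f)))) \<in> carrier Y"
        by (rule FY_compression[OF a one_NH one_NH])
      show "?e \<otimes>\<^bsub>FY\<^esub> a \<otimes>\<^bsub>FY\<^esub> ?e =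
          ?\<iota> (\<lambda>f\<in>P_inv. e_inv ((\<lambda>f\<in>P. f) (a ((\<lambda>f\<in>P. f) f))))"
        unfolding algebra_ops compose_def
        by (intro restrict_ext) (simp add: e_inv_closed P_inv_P FY_props(2)[OF a])
    qed
    show "\<one>\<^bsub>FY\<^esub> \<in> genideal FY {?e}"
    proof -
      interpret I: ideal "genideal FY {?e}" FY by (rule FY.genideal_ideal) (simp add: e)
      have eI: "?e \<in> genideal FY {?e}" by (rule FY.genideal_self'[OF e])
      have "x \<in> genideal FY {?e}" if "x \<in> corner_span NH W0 (carrier NH)" for x
        using that
      proof induction
        case (gen p q)
        have F: "p \<in> carrier FY" "q \<in> carrier FY" "W0 \<in> carrier FY" using gen W0_NH NH_FY by blast+
        \<comment> \<open>Values of \<open>W0\<close> are symmetric and hence fixed by the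
          projection, so inserting it in front of \<open>W0\<close> leaves \<open>p W0 q\<close>
          unchanged and exhibits it as an element of the ideal.\<close>
        have "p \<otimes>\<^bsub>FY\<^esub> ?e \<otimes>\<^bsub>FY\<^esub> (W0 \<otimes>\<^bsub>FY\<^esub> q) \<in> genideal FY {?e}"
          using F by (intro I.I_r_closed I.I_l_closed eI) auto
        also have "p \<otimes>\<^bsub>FY\<^esub> ?e \<otimes>\<^bsub>FY\<^esub> (W0 \<otimes>\<^bsub>FY\<^esub> q) = p \<otimes>\<^bsub>NH\<^esub> W0 \<otimes>\<^bsub>NH\<^esub> q"
          unfolding algebra_ops compose_def
        proof (rule restrict_ext)
          fix f assume f: "f \<in> P"
          have qP: "q f \<in> P" using FY_props(2)[OF F(2) f] .
          hence "w0_ops (sorted_list_of_set Qp) (q f) \<in> P_inv" by (rule w0_ops_P_inv)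
          thus "(\<lambda>x\<in>P. p (?e x)) ((\<lambda>x\<in>P. W0 (q x)) f) = (\<lambda>x\<in>P. p (W0 x)) (q f)"
            using f qP by (simp add: e_inv_ident P_inv_P)
        qed
        finally show ?case .
      next
        case (add x y)
        hence "x \<oplus>\<^bsub>FY\<^esub> y \<in> genideal FY {?e}" by (intro I.a_closed)
        thus ?case unfolding algebra_ops .
      qed
      from this[OF one_in_span_W0] show ?thesis unfolding algebra_ops .
    qed
    show "infinite (UNIV :: hfield set)" by (rule infinite_UNIV_char_0)
  qed
qed

end

theorem theorem3p12:
  fixes Q :: "('q::linorder, 'e) pre_digraph"
    and \<tau> :: "'q \<Rightarrow> 'q" and \<tau>a :: "'e \<Rightarrow> 'e"
    and Qp Qm :: "'q set"
    and lam :: "'q \<Rightarrow> nat" and mu :: "'q \<Rightarrow> int" and v :: "'q \<Rightarrow> nat"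
    and R :: "'q \<Rightarrow> complex multiset"
  assumes "iyangian_data Q \<tau> \<tau>a Qp Qm lam mu v R"
  shows "morita_equivalent TYPE('u)
           (iyangian_data.FY Q \<tau> Qp v R) (iyangian_data.Y Q \<tau> Qp v R)"
  by (rule full_corner.morita_equivalent[OF iyangian_data.full_corner_FY[OF assms]])

end
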